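(* Let $p\in(0,1)$ and $\alpha\in(0,1)$ be fixed, let $X\sim\mathrm{Bin}(n,p)$, and let $L_{CP}$ denote the length of the two-sided $1-\alpha$ Clopper--Pearson interval based on $X$. The Clopper--Pearson interval is asymptotically wider than the $1-\alpha$ Wald, Wilson score, Agresti--Coull, Jeffreys and (for any fixed $a,b>0$) Bayesian $Beta(a,b)$ intervals: if $L$ is the length of any one of these intervals, then $E(L_{CP})>E(L)$ for all sufficiently large $n$. In particular, as $n\to\infty$, if $L_J$ is the length of the Jeffreys interval, then $$E(L_{CP})=E(L_J)+n^{-1}+O(n^{-2}),$$ and if $L_A$ denotes the length of the Wilson score interval or the length of the Agresti--Coull interval, then $$E(L_{CP})=E(L_A)+n^{-1}+O(n^{-3/2}).$$
   Context: Notation: $\hat p=X/n$, $\hat q=1-\hat p$, $z=z_{\alpha/2}$ is the upper $\alpha/2$ quantile of the standard normal distribution, and $B(\gamma,a,b)$ is the $\gamma$-quantile of the $Beta(a,b)$ distribution. All intervals are two-sided with nominal level $1-\alpha$ and are based on an observation $X$ from $n$ trials. Clopper--Pearson interval: $(p_L,p_U)$, where for $X\in\{1,\dots,n-1\}$, $p_L$ solves $\sum_{k=X}^n\binom{n}{k}p_L^k(1-p_L)^{n-k}=\alpha/2$ and $p_U$ solves $\sum_{k=0}^{X}\binom{n}{k}p_U^k(1-p_U)^{n-k}=\alpha/2$ (equivalently $p_L=B(\alpha/2,X,n-X+1)$, $p_U=B(1-\alpha/2,X+1,n-X)$); for $X=0$ it is $(0,1-(\alpha/2)^{1/n})$ and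 for $X=n$ it is $((\alpha/2)^{1/n},1)$. Wald interval: $\hat p\pm z\sqrt{\hat p\hat q/n}$. Wilson score interval: $\frac{X+z^2/2}{n+z^2}\pm\frac{z}{n+z^2}\sqrt{\hat p\hat q n+z^2/4}$. Agresti--Coull interval: $\tilde p\pm z\sqrt{\tilde p\tilde q/\tilde n}$, where $\tilde n=n+z^2$, $\tilde X=X+z^2/2$, $\tilde p=\tilde X/\tilde n$, $\tilde q=1-\tilde p$. Bayesian $Beta(a,b)$ interval: $(B(\alpha/2,X+a,n-X+b),\,B(1-\alpha/2,X+a,n-X+b))$. Jeffreys interval: the Bayesian $Beta(1/2,1/2)$ interval $(B(\alpha/2,X+1/2,n-X+1/2),\,B(1-\alpha/2,X+1/2,n-X+1/2))$. *)

theory Defs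
  imports "HOL-Probability.Probability" "HOL-Library.Landau_Symbols"
begin

definition quantile :: "real measure \<Rightarrow> real \<Rightarrow> real" where
  "quantile M \<gamma> = Inf {x. \<gamma> \<le> cdf M x}"

definition upper_normal_quantile :: "real \<Rightarrow> real" where
  "upper_normal_quantile \<beta> = quantile std_normal_distribution (1 - \<beta>)"

definition beta_density :: "real \<Rightarrow> real \<Rightarrow> real \<Rightarrow> real" where
  "beta_density a b x =
     (if 0 < x \<and> x < 1 then x powr (a - 1) * (1 - x) powr (b - 1) / Beta a b else 0)"

definition beta_distribution :: "real \<Rightarrow> real \<Rightarrow> real measure" where
  "beta_distribution a b = density lborel (\<lambda>x. ennreal (beta_density a b x))"

definition beta_quantile :: "real \<Rightarrow> real \<Rightarrow> real \<Rightarrow> real" where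
  "beta_quantile \<gamma> a b = quantile (beta_distribution a b) \<gamma>"

text \<open>
  An interval is the pair of its lower and upper end point, given as a function of
  \<open>\<alpha>\<close> (the nominal level is \<open>1 - \<alpha>\<close>), the number \<open>n\<close> of trials and the observation \<open>X\<close>.
  End points are not truncated to the unit interval.
\<close>

type_synonym interval_method = "real \<Rightarrow> nat \<Rightarrow> nat \<Rightarrow> real \<times> real"

text \<open>
  For \<open>0 < X < n\<close> and \<open>0 < \<alpha> < 1\<close> the two tail sums are continuous and strictly monotone in
  the success probability and take the values 0 and 1 at the ends of the unit interval, so both
  equations have exactly one solution.
\<close>

definition clopper_pearson_interval :: interval_method where
  "clopper_pearson_interval \<alpha> n X =
     (if X = 0 then (0, 1 - (\<alpha> / 2) powr (1 / real n))
      else if X = n then ((\<alpha> / 2) powr (1 / real n), 1)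
      else
        (THE r. r \<in> {0..1} \<and> (\<Sum>k=X..n. real (n choose k) * r ^ k * (1 - r) ^ (n - k)) = \<alpha> / 2,
         THE r. r \<in> {0..1} \<and> (\<Sum>k=0..X. real (n choose k) * r ^ k * (1 - r) ^ (n - k)) = \<alpha> / 2))"

definition wald_interval :: interval_method where
  "wald_interval \<alpha> n X =
     (let z = upper_normal_quantile (\<alpha> / 2);
          p = real X / real n;
          q = 1 - p;
          h = z * sqrt (p * q / real n)
      in (p - h, p + h))"

definition wilson_interval :: interval_method where
  "wilson_interval \<alpha> n X =
     (let z = upper_normal_quantile (\<alpha> / 2);
          p = real X / real n;
          q = 1 - p;
          c = (real X + z\<^sup>2 / 2) / (real n + z\<^sup>2);
          h = z / (real n + z\<^sup>2) * sqrt (p * q * real n + z\<^sup>2 / 4)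
      in (c - h, c + h))"

definition agresti_coull_interval :: interval_method where
  "agresti_coull_interval \<alpha> n X =
     (let z = upper_normal_quantile (\<alpha> / 2);
          n' = real n + z\<^sup>2;
          X' = real X + z\<^sup>2 / 2;
          p = X' / n';
          q = 1 - p;
          h = z * sqrt (p * q / n')
      in (p - h, p + h))"

definition bayes_interval :: "real \<Rightarrow> real \<Rightarrow> interval_method" where
  "bayes_interval a b \<alpha> n X =
     (beta_quantile (\<alpha> / 2) (real X + a) (real n - real X + b),
      beta_quantile (1 - \<alpha> / 2) (real X + a) (real n - real X + b))"

definition jeffreys_interval :: interval_method where
  "jeffreys_interval = bayes_interval (1 / 2) (1 / 2)"

definition interval_length :: "real \<times> real \<Rightarrow> real" where
  "interval_length I = snd I - fst I"

definition expected_length :: "interval_method \<Rightarrow> real \<Rightarrow> real \<Rightarrow> nat \<Rightarrow> real" where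
  "expected_length I \<alpha> p n =
     measure_pmf.expectation (binomial_pmf n p) (\<lambda>X. interval_length (I \<alpha> n X))"

end

theory Submission
  imports Defs
begin

text \<open>
  All end points except those of the Wald, Wilson and Agresti-Coull intervals are beta quantiles.
  With \<open>\<mu>\<close> the mode, \<open>M = a + b - 2\<close>, \<open>\<epsilon> = 1 / sqrt M\<close> and \<open>\<sigma> = sqrt (\<mu> (1 - \<mu>))\<close>, the
  quantile of \<open>Beta(a, b)\<close> at level \<open>\<Phi>(z)\<close> is
  \<open>\<mu> + \<epsilon> \<sigma> z + \<epsilon>\<^sup>2 (1 - 2 \<mu>) (z\<^sup>2 + 2) / 3 + \<epsilon>\<^sup>3 c(\<mu>, z) + O(\<epsilon>\<^sup>4)\<close>, uniformly for \<open>\<mu>\<close> away from 0 and 1,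
  where \<open>c\<close> is odd in \<open>z\<close>. Indeed the substitution of this polynomial in \<open>z\<close> turns the beta
  density into a constant times the normal density up to a relative error \<open>O(\<epsilon>\<^sup>3)\<close> times a
  polynomial in \<open>z\<close>; the constant needs no Stirling formula, since it is determined by the total mass.

  Hence a Bayesian length is \<open>2 z \<sigma> / sqrt n + O(n powr (- 3 / 2))\<close>, as are the three explicit ones. The
  Clopper-Pearson and Jeffreys end points share the same \<open>M = n - 1\<close>, and the upper and lower
  Clopper-Pearson modes lie symmetrically at distance \<open>\<epsilon>\<^sup>2 / 2\<close> from the Jeffreys mode. By symmetry all
  terms in the difference of the lengths cancel up to \<open>O(\<epsilon>\<^sup>4)\<close>, except for the difference \<open>\<epsilon>\<^sup>2\<close> of
  the modes. Observations \<open>X\<close> with \<open>X / n\<close> near 0 or 1 are negligible by Hoeffding's inequality.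
\<close>

subsection \<open>Expansion of the log-density around the mode\<close>

text \<open>The lengths are averaged over \<open>X\<close>, so an expansion at one fixed proportion
  is too weak: constants must be uniform in the mode, which is why errors are handled by the classes
  \<open>poly_bounded\<close> and \<open>central_bigo\<close>. The required precision comes from the
  Jeffreys claim. The density has height of order 1 / \<epsilon> around its mode, so an error
  O(\<epsilon>^3) in the distribution function is an error O(\<epsilon>^4) = O(n^(-2)) in the
  quantile. The coefficient of \<epsilon>^3 is in general not zero and survives in each single
  length; it disappears only from the difference of two lengths whose modes are O(\<epsilon>^2)
  apart, because it is a Lipschitz function of the mode. For the other intervals this term has the
  order n^(-3/2) of the claimed error, so agreement of the leading terms is enough. The gap 1 / n is
  of larger order than n^(-3/2), hence the strict inequality for large n. Quantiles are trapped
  rather than computed: the polynomial at two nearby arguments gives a point below and a point above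
  the quantile.\<close>

lemma ln_one_plus_taylor:
  fixes x :: real
  assumes "\<bar>x\<bar> \<le> 1 / 2"
  shows ln_one_plus_taylor4: "\<bar>ln (1 + x) - (x - x^2/2 + x^3/3 - x^4/4)\<bar> \<le> 2 * \<bar>x\<bar>^5"
    and ln_one_plus_taylor2: "\<bar>ln (1 + x) - (x - x^2/2)\<bar> \<le> 2 * \<bar>x\<bar>^3"
proof -
  \<comment> \<open>The derivative of the remainder is the geometric remainder t^4 / (1 + t), at
    most 2 t^4 on this range. Order 4 serves the log-density, whose error is divided by
    \<epsilon>^2; order 2 serves the logarithm of the Jacobian.\<close>
  have "norm ((ln (1 + x) - (x - x^2/2 + x^3/3 - x^4/4)) - (ln (1 + 0) - (0 - 0^2/2 + 0^3/3 - 0^4/4)))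
        \<le> (2 * \<bar>x\<bar>^4) * norm (x - 0)"
  proof (rule field_differentiable_bound[where S="{-\<bar>x\<bar>..\<bar>x\<bar>}"])
    fix t assume t: "t \<in> {-\<bar>x\<bar>..\<bar>x\<bar>}"
    then have t2: "\<bar>t\<bar> \<le> \<bar>x\<bar>" "1 / 2 \<le> 1 + t" using assms by auto
    show "((\<lambda>t. ln (1 + t) - (t - t^2/2 + t^3/3 - t^4/4)) has_field_derivative t^4/(1+t))
             (at t within {-\<bar>x\<bar>..\<bar>x\<bar>})"
      using t2 by (auto intro!: derivative_eq_intros simp: divide_simps) (simp add: algebra_simps power_numeral_reduce)
    have "t^4 \<le> \<bar>x\<bar>^4" using power_mono[OF t2(1), of 4] by simp
    then have "t^4 * 1 \<le> (2 * \<bar>x\<bar>^4) * (1 + t)"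
      using t2 mult_left_mono[OF t2(2), of "2 * \<bar>x\<bar>^4"] by simp
    then show "norm (t^4/(1+t)) \<le> 2 * \<bar>x\<bar>^4"
      using t2 by (simp add: divide_simps)
  qed auto
  then show "\<bar>ln (1 + x) - (x - x^2/2 + x^3/3 - x^4/4)\<bar> \<le> 2 * \<bar>x\<bar>^5"
    by (simp add: power_numeral_reduce mult.commute mult.left_commute)
  have "norm ((ln (1 + x) - (x - x^2/2)) - (ln (1 + 0) - (0 - 0^2/2))) \<le> (2 * \<bar>x\<bar>^2) * norm (x - 0)"
  proof (rule field_differentiable_bound[where S="{-\<bar>x\<bar>..\<bar>x\<bar>}"])
    fix t assume t: "t \<in> {-\<bar>x\<bar>..\<bar>x\<bar>}"
    then have t2: "\<bar>t\<bar> \<le> \<bar>x\<bar>" "1 / 2 \<le> 1 + t" using assms by auto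
    show "((\<lambda>t. ln (1 + t) - (t - t^2/2)) has_field_derivative t^2/(1+t))
             (at t within {-\<bar>x\<bar>..\<bar>x\<bar>})"
      using t2 by (auto intro!: derivative_eq_intros simp: divide_simps) (simp add: algebra_simps power_numeral_reduce)
    have "t^2 \<le> \<bar>x\<bar>^2" using power_mono[OF t2(1), of 2] by simp
    then have "t^2 * 1 \<le> (2 * \<bar>x\<bar>^2) * (1 + t)"
      using t2 mult_left_mono[OF t2(2), of "2 * \<bar>x\<bar>^2"] by simp
    then show "norm (t^2/(1+t)) \<le> 2 * \<bar>x\<bar>^2"
      using t2 by (simp add: divide_simps)
  qed auto
  then show "\<bar>ln (1 + x) - (x - x^2/2)\<bar> \<le> 2 * \<bar>x\<bar>^3"
    by (simp add: power_numeral_reduce mult.commute mult.left_commute)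
qed

section \<open>Error terms of polynomial growth, uniform in the mode\<close>

text \<open>The constants come before \<mu>, \<epsilon> and \<open>w\<close>. The degree
  \<open>k\<close> stays unspecified: such terms are either integrated against a Gaussian or used
  for |w| up to a small power of 1 / \<epsilon>, and both absorb any degree. Closure under ring
  operations then replaces explicit constants.\<close>

definition poly_bounded :: "real \<Rightarrow> (real \<Rightarrow> real \<Rightarrow> real \<Rightarrow> real) \<Rightarrow> bool" where
  "poly_bounded \<delta> g \<longleftrightarrow> (\<exists>C k. \<forall>\<mu> \<epsilon> w. \<delta> \<le> \<mu> \<and> \<mu> \<le> 1 - \<delta> \<and> 0 < \<epsilon> \<and> \<epsilon> \<le> 1 \<longrightarrow>
     \<bar>g \<mu> \<epsilon> w\<bar> \<le> C * (1 + \<bar>w\<bar>) ^ k)"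

lemma poly_boundedI:
  assumes "\<And>\<mu> \<epsilon> w. \<delta> \<le> \<mu> \<Longrightarrow> \<mu> \<le> 1 - \<delta> \<Longrightarrow> 0 < \<epsilon> \<Longrightarrow> \<epsilon> \<le> 1 \<Longrightarrow> \<bar>g \<mu> \<epsilon> w\<bar> \<le> C * (1 + \<bar>w\<bar>) ^ k"
  shows "poly_bounded \<delta> g"
  using assms unfolding poly_bounded_def by blast

lemma poly_boundedE:
  assumes "poly_bounded \<delta> g"
  obtains C k where "C > 0"
    "\<And>\<mu> \<epsilon> w. \<delta> \<le> \<mu> \<Longrightarrow> \<mu> \<le> 1 - \<delta> \<Longrightarrow> 0 < \<epsilon> \<Longrightarrow> \<epsilon> \<le> 1 \<Longrightarrow> \<bar>g \<mu> \<epsilon> w\<bar> \<le> C * (1 + \<bar>w\<bar>) ^ k"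
proof -
  obtain C k where C: "\<And>\<mu> \<epsilon> w. \<delta> \<le> \<mu> \<Longrightarrow> \<mu> \<le> 1 - \<delta> \<Longrightarrow> 0 < \<epsilon> \<Longrightarrow> \<epsilon> \<le> 1 \<Longrightarrow> \<bar>g \<mu> \<epsilon> w\<bar> \<le> C * (1 + \<bar>w\<bar>) ^ k"
    using assms unfolding poly_bounded_def by metis
  have "\<bar>g \<mu> \<epsilon> w\<bar> \<le> (\<bar>C\<bar> + 1) * (1 + \<bar>w\<bar>) ^ k" if "\<delta> \<le> \<mu>" "\<mu> \<le> 1 - \<delta>" "0 < \<epsilon>" "\<epsilon> \<le> 1" for \<mu> \<epsilon> w
    by (rule order_trans[OF C[OF that] mult_right_mono]) auto
  then show ?thesis using that[of "\<bar>C\<bar> + 1" k] by auto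
qed

lemma poly_bounded_const: "poly_bounded \<delta> (\<lambda>\<mu> \<epsilon> w. c)"
  by (rule poly_boundedI[where C="\<bar>c\<bar>" and k=0]) auto

lemma poly_bounded_eps: "poly_bounded \<delta> (\<lambda>\<mu> \<epsilon> w. \<epsilon>)"
  by (rule poly_boundedI[where C=1 and k=0]) auto

lemma poly_bounded_w: "poly_bounded \<delta> (\<lambda>\<mu> \<epsilon> w. w)"
  by (rule poly_boundedI[where C=1 and k=1]) auto

lemma poly_bounded_add:
  assumes "poly_bounded \<delta> f" "poly_bounded \<delta> g"
  shows "poly_bounded \<delta> (\<lambda>\<mu> \<epsilon> w. f \<mu> \<epsilon> w + g \<mu> \<epsilon> w)"
proof -
  obtain C k where C: "C > 0" "\<And>\<mu> \<epsilon> w. \<delta> \<le> \<mu> \<Longrightarrow> \<mu> \<le> 1 - \<delta> \<Longrightarrow> 0 < \<epsilon> \<Longrightarrow> \<epsilon> \<le> 1 \<Longrightarrow> \<bar>f \<mu> \<epsilon> w\<bar> \<le> C * (1 + \<bar>w\<bar>) ^ k"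
    using poly_boundedE[OF assms(1)] by metis
  obtain D l where D: "D > 0" "\<And>\<mu> \<epsilon> w. \<delta> \<le> \<mu> \<Longrightarrow> \<mu> \<le> 1 - \<delta> \<Longrightarrow> 0 < \<epsilon> \<Longrightarrow> \<epsilon> \<le> 1 \<Longrightarrow> \<bar>g \<mu> \<epsilon> w\<bar> \<le> D * (1 + \<bar>w\<bar>) ^ l"
    using poly_boundedE[OF assms(2)] by metis
  show ?thesis
  proof (rule poly_boundedI[where C="C + D" and k="k + l"])
    fix \<mu> \<epsilon> w :: real assume a: "\<delta> \<le> \<mu>" "\<mu> \<le> 1 - \<delta>" "0 < \<epsilon>" "\<epsilon> \<le> 1"
    have "(1 + \<bar>w\<bar>) ^ k \<le> (1 + \<bar>w\<bar>) ^ (k + l)" "(1 + \<bar>w\<bar>) ^ l \<le> (1 + \<bar>w\<bar>) ^ (k + l)"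
      by (auto intro!: power_increasing)
    then have "C * (1 + \<bar>w\<bar>) ^ k + D * (1 + \<bar>w\<bar>) ^ l \<le> (C + D) * (1 + \<bar>w\<bar>) ^ (k + l)"
      using C(1) D(1) by (auto simp: distrib_right intro!: add_mono mult_left_mono)
    then show "\<bar>f \<mu> \<epsilon> w + g \<mu> \<epsilon> w\<bar> \<le> (C + D) * (1 + \<bar>w\<bar>) ^ (k + l)"
      using C(2)[OF a, of w] D(2)[OF a, of w] by linarith
  qed
qed

lemma poly_bounded_mult:
  assumes "poly_bounded \<delta> f" "poly_bounded \<delta> g"
  shows "poly_bounded \<delta> (\<lambda>\<mu> \<epsilon> w. f \<mu> \<epsilon> w * g \<mu> \<epsilon> w)"
proof -
  obtain C k where C: "C > 0" "\<And>\<mu> \<epsilon> w. \<delta> \<le> \<mu> \<Longrightarrow> \<mu> \<le> 1 - \<delta> \<Longrightarrow> 0 < \<epsilon> \<Longrightarrow> \<epsilon> \<le> 1 \<Longrightarrow> \<bar>f \<mu> \<epsilon> w\<bar> \<le> C * (1 + \<bar>w\<bar>) ^ k"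
    using poly_boundedE[OF assms(1)] by metis
  obtain D l where D: "D > 0" "\<And>\<mu> \<epsilon> w. \<delta> \<le> \<mu> \<Longrightarrow> \<mu> \<le> 1 - \<delta> \<Longrightarrow> 0 < \<epsilon> \<Longrightarrow> \<epsilon> \<le> 1 \<Longrightarrow> \<bar>g \<mu> \<epsilon> w\<bar> \<le> D * (1 + \<bar>w\<bar>) ^ l"
    using poly_boundedE[OF assms(2)] by metis
  show ?thesis
  proof (rule poly_boundedI[where C="C * D" and k="k + l"])
    fix \<mu> \<epsilon> w :: real assume a: "\<delta> \<le> \<mu>" "\<mu> \<le> 1 - \<delta>" "0 < \<epsilon>" "\<epsilon> \<le> 1"
    have "\<bar>f \<mu> \<epsilon> w * g \<mu> \<epsilon> w\<bar> \<le> (C * (1 + \<bar>w\<bar>) ^ k) * (D * (1 + \<bar>w\<bar>) ^ l)"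
      unfolding abs_mult using C(2)[OF a, of w] D(2)[OF a, of w] C(1)
      by (intro mult_mono) (auto intro!: mult_nonneg_nonneg zero_le_power)
    then show "\<bar>f \<mu> \<epsilon> w * g \<mu> \<epsilon> w\<bar> \<le> (C * D) * (1 + \<bar>w\<bar>) ^ (k + l)"
      by (simp add: power_add mult_ac)
  qed
qed

lemma poly_bounded_minus:
  "poly_bounded \<delta> f \<Longrightarrow> poly_bounded \<delta> (\<lambda>\<mu> \<epsilon> w. - f \<mu> \<epsilon> w)"
  unfolding poly_bounded_def by simp

lemma poly_bounded_abs:
  "poly_bounded \<delta> f \<Longrightarrow> poly_bounded \<delta> (\<lambda>\<mu> \<epsilon> w. \<bar>f \<mu> \<epsilon> w\<bar>)"
  unfolding poly_bounded_def by simp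

lemma poly_bounded_diff:
  "poly_bounded \<delta> f \<Longrightarrow> poly_bounded \<delta> g \<Longrightarrow> poly_bounded \<delta> (\<lambda>\<mu> \<epsilon> w. f \<mu> \<epsilon> w - g \<mu> \<epsilon> w)"
  using poly_bounded_add[OF _ poly_bounded_minus, of \<delta> f g] by simp

lemma poly_bounded_power:
  "poly_bounded \<delta> f \<Longrightarrow> poly_bounded \<delta> (\<lambda>\<mu> \<epsilon> w. f \<mu> \<epsilon> w ^ n)"
  by (induction n) (auto intro: poly_bounded_const poly_bounded_mult)

lemma poly_bounded_divide_const:
  "poly_bounded \<delta> f \<Longrightarrow> poly_bounded \<delta> (\<lambda>\<mu> \<epsilon> w. f \<mu> \<epsilon> w / c)"
  using poly_bounded_mult[OF _ poly_bounded_const[of \<delta> "inverse c"], of f] by (simp add: field_simps)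

section \<open>The coefficients of the expansion\<close>

definition sd :: "real \<Rightarrow> real" where "sd \<mu> = sqrt (\<mu> * (1 - \<mu>))"

text \<open>
  With \<open>y = \<mu> + sd \<mu> * \<epsilon> * v\<close> the log-density is a constant plus
  \<open>- v\<^sup>2 / 2 + \<epsilon> k3 v ^ 3 - \<epsilon>\<^sup>2 k4 v ^ 4 + O(\<epsilon> ^ 3)\<close>. The coefficients \<open>cub\<close> and \<open>lin\<close> are
  determined by requiring that the exponent of \<open>w\<close>, including the logarithm of the Jacobian
  \<open>cf_scaled_deriv\<close>, is \<open>- w\<^sup>2 / 2\<close> plus a constant up to \<open>O(\<epsilon> ^ 3)\<close>.
\<close>

definition k3 :: "real \<Rightarrow> real" where "k3 \<mu> = (1 - 2 * \<mu>) / (3 * sd \<mu>)"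

definition k4 :: "real \<Rightarrow> real" where "k4 \<mu> = (1 - 3 * (sd \<mu>)^2) / (4 * (sd \<mu>)^2)"

definition cub :: "real \<Rightarrow> real" where "cub \<mu> = 5 / 2 * (k3 \<mu>)^2 - k4 \<mu>"

definition lin :: "real \<Rightarrow> real" where "lin \<mu> = 3 * cub \<mu> + 2 * (k3 \<mu>)^2"

text \<open>At order \<epsilon> a first correction a(w) changes the exponent by - w a + k3 w^3 + a',
  and a = k3 (w^2 + 2) makes this vanish. The classical Cornish-Fisher term has w^2 - 1; the
  difference of 3 comes from expanding about the mode instead of the mean.\<close>

definition cf_scaled :: "real \<Rightarrow> real \<Rightarrow> real \<Rightarrow> real" where
  "cf_scaled \<mu> \<epsilon> w = w + \<epsilon> * (k3 \<mu> * (w^2 + 2) + \<epsilon> * (cub \<mu> * w^3 + lin \<mu> * w))"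

definition cf_scaled_deriv :: "real \<Rightarrow> real \<Rightarrow> real \<Rightarrow> real" where
  "cf_scaled_deriv \<mu> \<epsilon> w = 1 + \<epsilon> * (k3 \<mu> * (2 * w) + \<epsilon> * (cub \<mu> * (3 * w^2) + lin \<mu>))"

definition cf_quantile :: "real \<Rightarrow> real \<Rightarrow> real \<Rightarrow> real" where
  "cf_quantile \<mu> \<epsilon> w = \<mu> + sd \<mu> * \<epsilon> * cf_scaled \<mu> \<epsilon> w"

lemma sd_bounds:
  assumes "0 < \<delta>" "\<delta> \<le> \<mu>" "\<mu> \<le> 1 - \<delta>"
  shows "\<delta> \<le> sd \<mu>" "sd \<mu> \<le> 1" "0 < sd \<mu>" "(sd \<mu>)^2 = \<mu> * (1 - \<mu>)" "0 < \<mu>" "\<mu> < 1"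
proof -
  have "\<delta> * \<delta> \<le> \<mu> * (1 - \<mu>)" using assms by (intro mult_mono) auto
  then show 1: "\<delta> \<le> sd \<mu>" unfolding sd_def using assms by (intro real_le_rsqrt) (simp add: power2_eq_square)
  have "\<mu> * (1 - \<mu>) \<le> 1" using assms mult_mono[of \<mu> 1 "1 - \<mu>" 1] by auto
  then show "sd \<mu> \<le> 1" unfolding sd_def by simp
  show "0 < sd \<mu>" using 1 assms by simp
  show "(sd \<mu>)^2 = \<mu> * (1 - \<mu>)" using assms unfolding sd_def by simp
qed (use assms in auto)

lemma poly_bounded_sd: "0 < \<delta> \<Longrightarrow> poly_bounded \<delta> (\<lambda>\<mu> \<epsilon> w. sd \<mu>)"
proof (intro poly_boundedI[where C=1 and k=0])
  fix \<mu> :: real assume "0 < \<delta>" "\<delta> \<le> \<mu>" "\<mu> \<le> 1 - \<delta>"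
  from sd_bounds(2,3)[OF this] show "\<bar>sd \<mu>\<bar> \<le> 1 * (1 + \<bar>w\<bar>) ^ 0" for w :: real by simp
qed

lemma poly_bounded_inverse_sd: "0 < \<delta> \<Longrightarrow> poly_bounded \<delta> (\<lambda>\<mu> \<epsilon> w. inverse (sd \<mu>))"
proof (intro poly_boundedI[where C="inverse \<delta>" and k=0])
  fix \<mu> :: real assume "0 < \<delta>" "\<delta> \<le> \<mu>" "\<mu> \<le> 1 - \<delta>"
  then show "\<bar>inverse (sd \<mu>)\<bar> \<le> inverse \<delta> * (1 + \<bar>w\<bar>) ^ 0" for w :: real
    using sd_bounds[of \<delta> \<mu>] by (simp add: le_imp_inverse_le)
qed

lemma poly_bounded_mu: "0 < \<delta> \<Longrightarrow> poly_bounded \<delta> (\<lambda>\<mu> \<epsilon> w. \<mu>)"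
  by (intro poly_boundedI[where C=1 and k=0]) auto

lemmas poly_bounded_intros = poly_bounded_const poly_bounded_eps poly_bounded_w poly_bounded_mu
  poly_bounded_sd poly_bounded_inverse_sd poly_bounded_add poly_bounded_diff poly_bounded_mult
  poly_bounded_minus poly_bounded_power poly_bounded_abs poly_bounded_divide_const

lemma poly_bounded_k3: "0 < \<delta> \<Longrightarrow> poly_bounded \<delta> (\<lambda>\<mu> \<epsilon> w. k3 \<mu>)"
proof -
  assume "0 < \<delta>"
  have "k3 \<mu> = (1 - 2 * \<mu>) * inverse (sd \<mu>) / 3" for \<mu> unfolding k3_def by (simp add: field_simps)
  then show ?thesis using \<open>0 < \<delta>\<close> by (simp only:) (intro poly_bounded_intros)
qed

lemma poly_bounded_k4: "0 < \<delta> \<Longrightarrow> poly_bounded \<delta> (\<lambda>\<mu> \<epsilon> w. k4 \<mu>)"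
proof -
  assume "0 < \<delta>"
  have "k4 \<mu> = (1 - 3 * (sd \<mu>)^2) * inverse (sd \<mu>)^2 / 4" for \<mu> unfolding k4_def by (simp add: field_simps)
  then show ?thesis using \<open>0 < \<delta>\<close> by (simp only:) (intro poly_bounded_intros)
qed

lemma poly_bounded_cub: "0 < \<delta> \<Longrightarrow> poly_bounded \<delta> (\<lambda>\<mu> \<epsilon> w. cub \<mu>)"
  unfolding cub_def by (auto intro!: poly_bounded_intros poly_bounded_k3 poly_bounded_k4)

lemma poly_bounded_lin: "0 < \<delta> \<Longrightarrow> poly_bounded \<delta> (\<lambda>\<mu> \<epsilon> w. lin \<mu>)"
  unfolding lin_def by (auto intro!: poly_bounded_intros poly_bounded_k3 poly_bounded_cub)

lemmas poly_bounded_coeffs = poly_bounded_k3 poly_bounded_k4 poly_bounded_cub poly_bounded_lin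

text \<open>At order \<epsilon>^2 the coefficient of w^4 is 5/2 c3^2 - c4 - al and that of w^2 is 3
  al + 2 c3^2 - be, so the two assumptions remove both and leave the constant be - 2 c3^2. The
  right-hand side displays the factor \<epsilon>^3 explicitly, with a polynomial cofactor.\<close>

lemma cf_exponent_identity:
  fixes w \<epsilon> c3 c4 al be :: real
  assumes al: "al = 5 / 2 * c3^2 - c4" and be: "be = 3 * al + 2 * c3^2"
  defines "a1 \<equiv> c3 * (w^2 + 2)" and "a2 \<equiv> al * w^3 + be * w"
    and "b1 \<equiv> c3 * (2 * w)" and "b2 \<equiv> al * (3 * w^2) + be"
  defines "d \<equiv> a1 + \<epsilon> * a2"
  defines "v \<equiv> w + \<epsilon> * d" and "x \<equiv> \<epsilon> * (b1 + \<epsilon> * b2)"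
  shows "- (v^2)/2 + \<epsilon> * c3 * v^3 - \<epsilon>^2 * c4 * v^4 + (x - x^2/2) - (- (w^2)/2 + \<epsilon>^2 * (be - 2 * c3^2))
    = \<epsilon>^3 * (- (a1 * a2 + \<epsilon> * a2^2/2) + 3*c3*w^2*a2 + 3*c3*w*d^2 + \<epsilon>*c3*d^3
        - c4 * (4*w^3*d + 6*\<epsilon>*w^2*d^2 + 4*\<epsilon>^2*w*d^3 + \<epsilon>^3*d^4) - (b1*b2 + \<epsilon>*b2^2/2))"
  unfolding v_def x_def d_def a1_def a2_def b1_def b2_def be al by algebra

text \<open>The two smallness conditions put the arguments of all three logarithms into the range of
  \<open>ln_one_plus_taylor\<close>. The log-density has a Taylor error of order \<epsilon>^5, which
  the division by \<epsilon>^2 turns into \<epsilon>^3.\<close>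

lemma cf_exponent:
  assumes \<delta>: "0 < \<delta>"
  obtains C k where "C > 0"
    "\<And>\<mu> \<epsilon> w. \<delta> \<le> \<mu> \<Longrightarrow> \<mu> \<le> 1 - \<delta> \<Longrightarrow> 0 < \<epsilon> \<Longrightarrow> \<epsilon> \<le> 1 \<Longrightarrow>
       \<bar>cf_quantile \<mu> \<epsilon> w - \<mu>\<bar> \<le> \<delta> / 2 \<Longrightarrow> \<bar>cf_scaled_deriv \<mu> \<epsilon> w - 1\<bar> \<le> 1 / 2 \<Longrightarrow>
       \<bar>(\<mu> * ln (cf_quantile \<mu> \<epsilon> w / \<mu>) + (1 - \<mu>) * ln ((1 - cf_quantile \<mu> \<epsilon> w) / (1 - \<mu>))) / \<epsilon>^2
          + ln (cf_scaled_deriv \<mu> \<epsilon> w) - (- (w^2)/2 + \<epsilon>^2 * (lin \<mu> - 2 * (k3 \<mu>)^2))\<bar>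
        \<le> \<epsilon>^3 * (C * (1 + \<bar>w\<bar>)^k)"
proof -
  define a1 where "a1 = (\<lambda>\<mu> w. k3 \<mu> * (w^2 + 2))"
  define a2 where "a2 = (\<lambda>\<mu> w. cub \<mu> * w^3 + lin \<mu> * w)"
  define b1 where "b1 = (\<lambda>\<mu> w. k3 \<mu> * (2 * w))"
  define b2 where "b2 = (\<lambda>\<mu> w. cub \<mu> * (3 * w^2) + lin \<mu>)"
  define d where "d = (\<lambda>\<mu> \<epsilon> w. a1 \<mu> w + \<epsilon> * a2 \<mu> w)"
  define Q where "Q = (\<lambda>\<mu> \<epsilon> w. - (a1 \<mu> w * a2 \<mu> w + \<epsilon> * (a2 \<mu> w)^2/2) + 3*k3 \<mu>*w^2*a2 \<mu> w
        + 3*k3 \<mu>*w*(d \<mu> \<epsilon> w)^2 + \<epsilon>*k3 \<mu>*(d \<mu> \<epsilon> w)^3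
        - k4 \<mu> * (4*w^3*d \<mu> \<epsilon> w + 6*\<epsilon>*w^2*(d \<mu> \<epsilon> w)^2 + 4*\<epsilon>^2*w*(d \<mu> \<epsilon> w)^3 + \<epsilon>^3*(d \<mu> \<epsilon> w)^4)
        - (b1 \<mu> w*b2 \<mu> w + \<epsilon>*(b2 \<mu> w)^2/2))"
  \<comment> \<open>One summand for each source of error: the polynomial identity, the logarithm of
    the Jacobian and the logarithms in the density.\<close>
  define E where "E = (\<lambda>\<mu> \<epsilon> w. \<bar>Q \<mu> \<epsilon> w\<bar> + 2 * \<bar>b1 \<mu> w + \<epsilon> * b2 \<mu> w\<bar>^3
        + (4 / \<delta>^5) * \<bar>cf_scaled \<mu> \<epsilon> w\<bar>^5)"
  have pbE: "poly_bounded \<delta> E"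
  proof -
    note pb = poly_bounded_intros poly_bounded_coeffs \<delta>
    have a1: "poly_bounded \<delta> (\<lambda>\<mu> \<epsilon> w. a1 \<mu> w)" unfolding a1_def by (intro pb)
    have a2: "poly_bounded \<delta> (\<lambda>\<mu> \<epsilon> w. a2 \<mu> w)" unfolding a2_def by (intro pb)
    have b1: "poly_bounded \<delta> (\<lambda>\<mu> \<epsilon> w. b1 \<mu> w)" unfolding b1_def by (intro pb)
    have b2: "poly_bounded \<delta> (\<lambda>\<mu> \<epsilon> w. b2 \<mu> w)" unfolding b2_def by (intro pb)
    have d: "poly_bounded \<delta> (\<lambda>\<mu> \<epsilon> w. d \<mu> \<epsilon> w)" unfolding d_def by (intro pb a1 a2)
    have Q: "poly_bounded \<delta> (\<lambda>\<mu> \<epsilon> w. Q \<mu> \<epsilon> w)" unfolding Q_def by (intro pb a1 a2 b1 b2 d)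
    have v: "poly_bounded \<delta> (\<lambda>\<mu> \<epsilon> w. cf_scaled \<mu> \<epsilon> w)" unfolding cf_scaled_def by (intro pb)
    show ?thesis unfolding E_def by (intro pb Q b1 b2 v)
  qed
  obtain C k where C: "C > 0" "\<And>\<mu> \<epsilon> w. \<delta> \<le> \<mu> \<Longrightarrow> \<mu> \<le> 1 - \<delta> \<Longrightarrow> 0 < \<epsilon> \<Longrightarrow> \<epsilon> \<le> 1 \<Longrightarrow> \<bar>E \<mu> \<epsilon> w\<bar> \<le> C * (1 + \<bar>w\<bar>) ^ k"
    using poly_boundedE[OF pbE] by metis
  show ?thesis
  proof (rule that[of C k, OF C(1)])
    fix \<mu> \<epsilon> w :: real
    assume a: "\<delta> \<le> \<mu>" "\<mu> \<le> 1 - \<delta>" "0 < \<epsilon>" "\<epsilon> \<le> 1"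
      and s: "\<bar>cf_quantile \<mu> \<epsilon> w - \<mu>\<bar> \<le> \<delta> / 2" and x: "\<bar>cf_scaled_deriv \<mu> \<epsilon> w - 1\<bar> \<le> 1 / 2"
    note sdb = sd_bounds[OF \<delta> a(1,2)]
    define \<nu> where "\<nu> = 1 - \<mu>"
    have \<nu>: "\<delta> \<le> \<nu>" "0 < \<nu>" "\<nu> \<le> 1" using a \<delta> unfolding \<nu>_def by auto
    define v where "v = cf_scaled \<mu> \<epsilon> w"
    define s where "s = sd \<mu> * \<epsilon> * v"
    have qs: "cf_quantile \<mu> \<epsilon> w = \<mu> + s" unfolding cf_quantile_def s_def v_def ..
    have sb: "\<bar>s\<bar> \<le> \<delta> / 2" using s qs by simp
    define X where "X = \<epsilon> * (b1 \<mu> w + \<epsilon> * b2 \<mu> w)"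
    have dX: "cf_scaled_deriv \<mu> \<epsilon> w = 1 + X"
      unfolding cf_scaled_deriv_def X_def b1_def b2_def ..
    have R3: "\<bar>ln (1 + X) - (X - X^2/2)\<bar> \<le> \<epsilon>^3 * (2 * \<bar>b1 \<mu> w + \<epsilon> * b2 \<mu> w\<bar>^3)"
    proof -
      have "\<bar>ln (1 + X) - (X - X^2/2)\<bar> \<le> 2 * \<bar>X\<bar>^3"
        using x dX by (intro ln_one_plus_taylor2) simp
      also have "\<bar>X\<bar> = \<epsilon> * \<bar>b1 \<mu> w + \<epsilon> * b2 \<mu> w\<bar>" unfolding X_def using a by (simp add: abs_mult)
      finally show ?thesis by (simp add: power_mult_distrib mult_ac)
    qed
    \<comment> \<open>Used with c = \<mu>, t = s and with c = 1 - \<mu>, t = - s.\<close>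
    have tay: "\<bar>c * ln (1 + t/c) - (t - t^2/(2*c) + t^3/(3*c^2) - t^4/(4*c^3))\<bar> \<le> 2 * \<bar>t\<bar>^5 / \<delta>^5"
      if "\<delta> \<le> c" "c \<le> 1" "\<bar>t\<bar> \<le> \<delta> / 2" for c t :: real
    proof -
      have c0: "0 < c" using that \<delta> by simp
      have "\<bar>t\<bar> \<le> c / 2" using that by simp
      then have "\<bar>t/c\<bar> \<le> 1/2" using c0 by (simp add: field_simps)
      then have T: "\<bar>ln (1 + t/c) - (t/c - (t/c)^2/2 + (t/c)^3/3 - (t/c)^4/4)\<bar> \<le> 2 * \<bar>t/c\<bar>^5"
        by (rule ln_one_plus_taylor4)
      define p where "p = t/c - (t/c)^2/2 + (t/c)^3/3 - (t/c)^4/4"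
      define P where "P = t - t^2/(2*c) + t^3/(3*c^2) - t^4/(4*c^3)"
      have c2: "c * (t/c) = t" "c * ((t/c)^2/2) = t^2/(2*c)" "c * ((t/c)^3/3) = t^3/(3*c^2)"
        "c * ((t/c)^4/4) = t^4/(4*c^3)"
        using c0 by (simp_all add: power_divide power_numeral_reduce)
      have "c * p = c * (t/c) - c * ((t/c)^2/2) + c * ((t/c)^3/3) - c * ((t/c)^4/4)"
        unfolding p_def by (simp only: right_diff_distrib distrib_left)
      then have P: "P = c * p" unfolding P_def c2 by simp
      have "c * ln (1 + t/c) - P = c * (ln (1 + t/c) - p)"
        unfolding P by (simp only: right_diff_distrib)
      then have "\<bar>c * ln (1 + t/c) - P\<bar> = c * \<bar>ln (1 + t/c) - p\<bar>"
        using c0 by (simp add: abs_mult)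
      also have "\<dots> \<le> 1 * (2 * \<bar>t/c\<bar>^5)" using T that c0 unfolding p_def by (intro mult_mono) auto
      also have "\<bar>t/c\<bar>^5 \<le> (\<bar>t\<bar>/\<delta>)^5"
        using that \<delta> c0 by (intro power_mono) (simp_all add: abs_divide frac_le)
      finally show ?thesis unfolding P_def by (simp add: power_divide)
    qed
    have e1: "cf_quantile \<mu> \<epsilon> w / \<mu> = 1 + s/\<mu>" using qs sdb by (simp add: field_simps)
    have e2: "(1 - cf_quantile \<mu> \<epsilon> w) / (1 - \<mu>) = 1 + (- s)/\<nu>" using qs \<nu> by (simp add: \<nu>_def field_simps)
    \<comment> \<open>The linear terms s and - s cancel since \<mu> is the mode. The quadratic ones
      add up to - s^2 / 2 times 1 / (\<mu> (1 - \<mu>)), which is why \<open>sd \<mu>\<close> is the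
      right scale for s.\<close>
    define T where "T = (s - s^2/(2*\<mu>) + s^3/(3*\<mu>^2) - s^4/(4*\<mu>^3)) + ((- s) - (- s)^2/(2*\<nu>) + (- s)^3/(3*\<nu>^2) - (- s)^4/(4*\<nu>^3))"
    have "\<bar>\<mu> * ln (cf_quantile \<mu> \<epsilon> w / \<mu>) + (1 - \<mu>) * ln ((1 - cf_quantile \<mu> \<epsilon> w) / (1 - \<mu>)) - T\<bar>
        \<le> 2 * \<bar>s\<bar>^5 / \<delta>^5 + 2 * \<bar>-s\<bar>^5 / \<delta>^5"
      unfolding e1 e2 T_def unfolding \<nu>_def[symmetric]
      using tay[of \<mu> s] tay[of \<nu> "-s"] a(1) sdb(6) sb \<nu> by linarith
    also have "\<dots> = (4 / \<delta>^5) * \<bar>s\<bar>^5" by simp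
    also have "\<dots> \<le> (4 / \<delta>^5) * (\<epsilon> * \<bar>v\<bar>)^5"
    proof (intro mult_left_mono power_mono)
      have "sd \<mu> * (\<epsilon> * \<bar>v\<bar>) \<le> 1 * (\<epsilon> * \<bar>v\<bar>)" using sdb a by (intro mult_right_mono) auto
      then show "\<bar>s\<bar> \<le> \<epsilon> * \<bar>v\<bar>" unfolding s_def using sdb a by (simp add: abs_mult mult_ac)
    qed (use \<delta> in auto)
    also have "\<dots> = \<epsilon>^5 * ((4 / \<delta>^5) * \<bar>v\<bar>^5)" by (simp add: power_mult_distrib)
    finally have L: "\<bar>\<mu> * ln (cf_quantile \<mu> \<epsilon> w / \<mu>) + (1 - \<mu>) * ln ((1 - cf_quantile \<mu> \<epsilon> w) / (1 - \<mu>)) - T\<bar>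
        \<le> \<epsilon>^5 * ((4 / \<delta>^5) * \<bar>v\<bar>^5)" .
    have T2: "T = \<epsilon>^2 * (- (v^2)/2 + \<epsilon> * k3 \<mu> * v^3 - \<epsilon>^2 * k4 \<mu> * v^4)"
    proof -
      have mn: "\<mu> + \<nu> = 1" "0 < \<mu>" "0 < \<nu>" using \<nu> sdb unfolding \<nu>_def by auto
      have S: "(sd \<mu>)^2 = \<mu> * \<nu>" using sdb unfolding \<nu>_def by simp
      have nz: "sd \<mu> \<noteq> 0" "\<mu> \<noteq> 0" "\<nu> \<noteq> 0" using sdb mn by auto
      have p1: "1/\<mu> + 1/\<nu> = 1/(\<mu>*\<nu>)" using mn by (simp add: field_simps)
      have "1/\<mu>^2 - 1/\<nu>^2 = (\<nu> - \<mu>) * (\<mu> + \<nu>) / (\<mu>*\<nu>)^2" 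
      proof -
        have "\<nu>^2 - \<mu>^2 = (\<nu> - \<mu>) * (\<mu> + \<nu>)" by algebra
        moreover have "1/\<mu>^2 - 1/\<nu>^2 = (\<nu>^2 - \<mu>^2) / (\<mu>*\<nu>)^2"
          using nz by (simp add: diff_divide_distrib power_mult_distrib)
        ultimately show ?thesis by simp
      qed
      then have p2: "1/\<mu>^2 - 1/\<nu>^2 = (\<nu> - \<mu>) / (\<mu>*\<nu>)^2" using mn by simp
      have "1/\<mu>^3 + 1/\<nu>^3 = (\<mu> + \<nu>) * ((\<mu> + \<nu>)^2 - 3 * (\<mu> * \<nu>)) / (\<mu>*\<nu>)^3"
      proof -
        have "\<mu>^3 + \<nu>^3 = (\<mu> + \<nu>) * ((\<mu> + \<nu>)^2 - 3 * (\<mu> * \<nu>))" by algebra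
        moreover have "1/\<mu>^3 + 1/\<nu>^3 = (\<mu>^3 + \<nu>^3) / (\<mu>*\<nu>)^3"
          using nz by (simp add: add_divide_distrib power_mult_distrib add.commute)
        ultimately show ?thesis by simp
      qed
      then have p3: "1/\<mu>^3 + 1/\<nu>^3 = (1 - 3 * (\<mu> * \<nu>)) / (\<mu>*\<nu>)^3" using mn by simp
      have "T = - (s^2)/2 * (1/\<mu> + 1/\<nu>) + s^3/3 * (1/\<mu>^2 - 1/\<nu>^2) - s^4/4 * (1/\<mu>^3 + 1/\<nu>^3)"
        unfolding T_def by (simp add: right_diff_distrib distrib_left)
      also have "\<dots> = - (s^2)/2 * (1/(sd \<mu>)^2) + s^3/3 * ((1 - 2*\<mu>) / (sd \<mu>)^4) - s^4/4 * ((1 - 3 * (sd \<mu>)^2) / (sd \<mu>)^6)"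
      proof -
        have "\<nu> - \<mu> = 1 - 2*\<mu>" unfolding \<nu>_def by simp
        then show ?thesis unfolding p1 p2 p3 S[symmetric] by (simp flip: power_mult)
      qed
      also have "\<dots> = \<epsilon>^2 * (- (v^2)/2 + \<epsilon> * k3 \<mu> * v^3 - \<epsilon>^2 * k4 \<mu> * v^4)"
      proof -
        define S where "S = sd \<mu>"
        have S0: "S \<noteq> 0" using nz unfolding S_def by simp
        have t: "s^2 = \<epsilon>^2 * v^2 * S^2" "s^3 = \<epsilon>^3 * v^3 * S^3" "s^4 = \<epsilon>^4 * v^4 * S^4"
          unfolding s_def S_def by (simp_all add: power_mult_distrib)
        have k: "k3 \<mu> = (1 - 2*\<mu>) / (3 * S)" "k4 \<mu> = (1 - 3 * S^2) / (4 * S^2)"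
          unfolding k3_def k4_def S_def by auto
        have 1: "- (s^2)/2 * (1/S^2) = - (\<epsilon>^2 * v^2) / 2" unfolding t using S0 by simp
        have 2: "s^3/3 * ((1 - 2*\<mu>) / S^4) = \<epsilon>^3 * v^3 * k3 \<mu>"
          unfolding t k using S0 by (simp add: power3_eq_cube power4_eq_xxxx)
        have S6: "S^6 = S^4 * S^2" by algebra
        have 3: "s^4/4 * ((1 - 3 * S^2) / S^6) = \<epsilon>^4 * v^4 * k4 \<mu>"
          unfolding t k S6 using S0 by (simp add: divide_simps del: power_add_numeral power_add_numeral2)
        have "\<epsilon>^2 * (- (v^2)/2 + \<epsilon> * c * v^3 - \<epsilon>^2 * c' * v^4)
          = - (\<epsilon>^2 * v^2) / 2 + \<epsilon>^3 * v^3 * c - \<epsilon>^4 * v^4 * c'" for c c' :: real by algebra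
        then show ?thesis unfolding S_def[symmetric] 1 2 3 by (rule sym)
      qed
      finally show ?thesis .
    qed
    have vd: "v = w + \<epsilon> * (a1 \<mu> w + \<epsilon> * a2 \<mu> w)"
      unfolding v_def cf_scaled_def a1_def a2_def ..
    have id: "- (v^2)/2 + \<epsilon> * k3 \<mu> * v^3 - \<epsilon>^2 * k4 \<mu> * v^4 + (X - X^2/2) - (- (w^2)/2 + \<epsilon>^2 * (lin \<mu> - 2 * (k3 \<mu>)^2))
        = \<epsilon>^3 * Q \<mu> \<epsilon> w"
      unfolding vd X_def Q_def d_def a1_def a2_def b1_def b2_def
      by (rule cf_exponent_identity[OF cub_def lin_def])
    define Lg where "Lg = \<mu> * ln (cf_quantile \<mu> \<epsilon> w / \<mu>) + (1 - \<mu>) * ln ((1 - cf_quantile \<mu> \<epsilon> w) / (1 - \<mu>))"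
    have L2: "\<bar>Lg / \<epsilon>^2 - T / \<epsilon>^2\<bar> \<le> \<epsilon>^3 * ((4 / \<delta>^5) * \<bar>v\<bar>^5)"
    proof -
      have "\<bar>Lg / \<epsilon>^2 - T / \<epsilon>^2\<bar> = \<bar>Lg - T\<bar> / \<epsilon>^2" by (simp flip: diff_divide_distrib)
      also have "\<dots> \<le> \<epsilon>^5 * ((4 / \<delta>^5) * \<bar>v\<bar>^5) / \<epsilon>^2"
        using L unfolding Lg_def by (intro divide_right_mono) auto
      also have "\<dots> = \<epsilon>^3 * ((4 / \<delta>^5) * \<bar>v\<bar>^5)" using a(3) by (simp add: power_numeral_reduce)
      finally show ?thesis .
    qed
    have T3: "T / \<epsilon>^2 = - (v^2)/2 + \<epsilon> * k3 \<mu> * v^3 - \<epsilon>^2 * k4 \<mu> * v^4" unfolding T2 using a(3) by simp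
    have "\<bar>Lg / \<epsilon>^2 + ln (1 + X) - (- (w^2)/2 + \<epsilon>^2 * (lin \<mu> - 2 * (k3 \<mu>)^2))\<bar>
        \<le> \<bar>\<epsilon>^3 * Q \<mu> \<epsilon> w\<bar> + \<epsilon>^3 * (2 * \<bar>b1 \<mu> w + \<epsilon> * b2 \<mu> w\<bar>^3) + \<epsilon>^3 * ((4 / \<delta>^5) * \<bar>v\<bar>^5)"
      using R3 L2 id[symmetric] unfolding T3 by linarith
    also have "\<dots> = \<epsilon>^3 * E \<mu> \<epsilon> w" unfolding E_def v_def using a(3) by (simp add: abs_mult algebra_simps)
    also have "\<dots> \<le> \<epsilon>^3 * (C * (1 + \<bar>w\<bar>) ^ k)" using C(2)[OF a, of w] a(3) by (intro mult_left_mono) auto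
    finally show "\<bar>(\<mu> * ln (cf_quantile \<mu> \<epsilon> w / \<mu>) + (1 - \<mu>) * ln ((1 - cf_quantile \<mu> \<epsilon> w) / (1 - \<mu>))) / \<epsilon>^2
          + ln (cf_scaled_deriv \<mu> \<epsilon> w) - (- (w^2)/2 + \<epsilon>^2 * (lin \<mu> - 2 * (k3 \<mu>)^2))\<bar>
        \<le> \<epsilon>^3 * (C * (1 + \<bar>w\<bar>)^k)" unfolding dX Lg_def .
  qed
qed

subsection \<open>Gaussian estimates and tails of the beta kernel\<close>

text \<open>A single term (c x)^n / n! of the exponential series is at most exp (c x).\<close>

lemma power_exp_bounded:
  fixes c :: real
  assumes "0 < c" "0 \<le> x"
  shows "x ^ n * exp (- (c * x)) \<le> fact n / c ^ n"
proof -
  have "(c * x) ^ n / fact n \<le> exp (c * x)"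
  proof -
    have "(\<Sum>k\<in>{n}. (c * x) ^ k /\<^sub>R fact k) \<le> (\<Sum>k. (c * x) ^ k /\<^sub>R fact k)"
      using assms by (intro sum_le_suminf summable_exp_generic) auto
    then show ?thesis by (simp add: exp_def divide_inverse mult.commute)
  qed
  then have "(c * x) ^ n \<le> fact n * exp (c * x)" by (simp add: field_simps)
  then have "x ^ n * c ^ n * exp (- (c * x)) \<le> fact n"
    by (simp add: power_mult_distrib exp_minus field_simps)
  then show ?thesis using assms by (simp add: field_simps)
qed

text \<open>The majorant C / (1 + w^2) has the primitive C arctan w, so integrals over all
  intervals, of whatever length, are bounded by C pi.\<close>

lemma gaussian_moment_decay:
  obtains C :: real where "C > 0" "\<And>w::real. (1 + \<bar>w\<bar>) ^ k * exp (- (w^2) / 2) \<le> C / (1 + w^2)"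
proof -
  define C where "C = exp (3 / 2) * (fact (k + 2) :: real)"
  have "(1 + \<bar>w\<bar>) ^ k * exp (- (w^2) / 2) \<le> C / (1 + w^2)" for w :: real
  proof -
    \<comment> \<open>Completing the square trades the Gaussian for an exponential in 1 + |w|, to
      which \<open>power_exp_bounded\<close> applies.\<close>
    have "0 \<le> (\<bar>w\<bar> - 1)^2" by simp
    then have "- (w^2) / 2 \<le> 3 / 2 + - (1 + \<bar>w\<bar>)" by (simp add: power2_diff)
    then have e: "exp (- (w^2) / 2) \<le> exp (3 / 2) * exp (- (1 + \<bar>w\<bar>))"
      by (simp add: exp_add[symmetric] del: exp_add)
    have "(1 + w^2) \<le> (1 + \<bar>w\<bar>)^2" by (simp add: power2_sum)
    then have "(1 + \<bar>w\<bar>) ^ k * exp (- (w^2) / 2) * (1 + w^2)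
      \<le> (1 + \<bar>w\<bar>) ^ k * (exp (3 / 2) * exp (- (1 + \<bar>w\<bar>))) * (1 + \<bar>w\<bar>)^2"
      using e by (intro mult_mono) auto
    also have "\<dots> = exp (3 / 2) * ((1 + \<bar>w\<bar>) ^ (k + 2) * exp (- (1 * (1 + \<bar>w\<bar>))))"
      by (simp add: power_add power2_eq_square)
    also have "\<dots> \<le> exp (3 / 2) * (fact (k + 2) / 1 ^ (k + 2))"
      by (intro mult_left_mono power_exp_bounded) auto
    finally have "(1 + \<bar>w\<bar>) ^ k * exp (- (w^2) / 2) * (1 + w^2) \<le> C" unfolding C_def by simp
    moreover have "0 < 1 + w^2" by (simp add: add_pos_nonneg)
    ultimately show ?thesis by (simp add: pos_le_divide_eq)
  qed
  moreover have "C > 0" unfolding C_def by simp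
  ultimately show ?thesis using that by blast
qed

lemma has_integral_inverse_one_plus_square:
  assumes "a \<le> b"
  shows "((\<lambda>w::real. c / (1 + w^2)) has_integral c * (arctan b - arctan a)) {a..b}"
proof -
  have "((\<lambda>w. c / (1 + w^2)) has_integral (c * arctan b - c * arctan a)) {a..b}"
  proof (rule fundamental_theorem_of_calculus[OF assms])
    fix x :: real
    have "1 + x^2 \<noteq> 0" by (simp add: add_nonneg_eq_0_iff)
    then show "((\<lambda>w. c * arctan w) has_vector_derivative c / (1 + x^2)) (at x within {a..b})"
      unfolding has_real_derivative_iff_has_vector_derivative[symmetric]
      by (auto intro!: derivative_eq_intros simp: field_simps)
  qed
  then show ?thesis by (simp add: right_diff_distrib)
qed

lemma integral_abs_le_of_decay:
  fixes f :: "real \<Rightarrow> real"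
  assumes "a \<le> b" "0 \<le> c" "f integrable_on {a..b}" "\<And>w. w \<in> {a..b} \<Longrightarrow> \<bar>f w\<bar> \<le> c / (1 + w^2)"
  shows "\<bar>integral {a..b} f\<bar> \<le> c * pi"
proof -
  note I = has_integral_inverse_one_plus_square[OF assms(1), of c]
  have "norm (integral {a..b} f) \<le> integral {a..b} (\<lambda>w. c / (1 + w^2))"
    using I assms by (intro integral_norm_bound_integral) auto
  also have "\<dots> = c * (arctan b - arctan a)" using I by (rule integral_unique)
  also have "\<dots> \<le> c * pi" using arctan_bounded[of a] arctan_bounded[of b] assms(2)
    by (intro mult_left_mono) auto
  finally show ?thesis by simp
qed

text \<open>The calculations use gauge integrals, for which substitution and the fundamental theorem
  are at hand; this transfers them to the measures behind the quantiles.\<close>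

lemma measure_density_eq_integral:
  fixes g :: "real \<Rightarrow> real"
  assumes [measurable]: "g \<in> borel_measurable borel" "S \<in> sets borel"
    and "\<And>x. 0 \<le> g x" "(g has_integral J) S"
  shows "measure (density lborel (\<lambda>x. ennreal (g x))) S = J" "0 \<le> J"
    "emeasure (density lborel (\<lambda>x. ennreal (g x))) S = ennreal J"
proof -
  show J: "0 \<le> J" using assms by (intro has_integral_nonneg[of g J S]) auto
  have I: "((\<lambda>x. indicator S x * g x) has_integral J) UNIV"
  proof -
    have "(\<lambda>x. indicator S x * g x) = (\<lambda>x. if x \<in> S then g x else 0)" by (auto simp: indicator_def)
    then show ?thesis using assms(4) by (simp add: has_integral_restrict_UNIV)
  qed
  have "emeasure (density lborel (\<lambda>x. ennreal (g x))) S = (\<integral>\<^sup>+x. ennreal (g x) * indicator S x \<partial>lborel)"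
    by (rule emeasure_density) auto
  also have "\<dots> = (\<integral>\<^sup>+x. ennreal (indicator S x * g x) \<partial>lborel)"
    by (intro nn_integral_cong) (auto simp: indicator_def)
  also have "\<dots> = ennreal J"
    by (rule nn_integral_has_integral_lborel[OF _ _ I]) (auto simp: assms)
  finally show e: "emeasure (density lborel (\<lambda>x. ennreal (g x))) S = ennreal J" .
  then show "measure (density lborel (\<lambda>x. ennreal (g x))) S = J" using J by (simp add: measure_def)
qed

section \<open>The standard normal distribution function\<close>

abbreviation Phi :: "real \<Rightarrow> real" where "Phi \<equiv> cdf std_normal_distribution"

interpretation std_normal: real_distribution std_normal_distribution
  by (rule real_dist_normal_dist)

lemma has_integral_std_normal_density:
  assumes "a \<le> b"
  shows "(std_normal_density has_integral Phi b - Phi a) {a..b}"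
proof (cases "a = b")
  case False
  have "continuous_on {a..b} std_normal_density"
    unfolding std_normal_density_def by (intro continuous_intros) auto
  then have I: "(std_normal_density has_integral integral {a..b} std_normal_density) {a..b}"
    by (intro integrable_integral integrable_continuous_real)
  have "(std_normal_density has_integral integral {a..b} std_normal_density) {a<..b}"
    by (rule has_integral_spike_set_eq[THEN iffD1, OF _ _ I]) (auto intro: negligible_subset[of "{a}"])
  from measure_density_eq_integral(1)[OF _ _ _ this]
  have "measure std_normal_distribution {a<..b} = integral {a..b} std_normal_density" by simp
  then show ?thesis using I False assms std_normal.cdf_diff_eq[of a b] by simp
qed (simp add: has_integral_refl)

lemma Phi_diff_le:
  assumes "a \<le> b"
  shows "Phi b - Phi a \<le> b - a"
proof -
  have "std_normal_density w \<le> 1" for w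
  proof -
    have "exp (- (w^2) / 2) \<le> 1" by simp
    moreover have "1 \<le> sqrt (2 * pi)" using pi_gt3 by (simp add: real_le_rsqrt)
    ultimately have "1 / sqrt (2 * pi) * exp (- (w^2) / 2) \<le> 1 * 1"
      by (intro mult_mono) (auto simp: divide_simps)
    then show ?thesis unfolding std_normal_density_def by simp
  qed
  then have "Phi b - Phi a \<le> 1 * (b - a)"
    using has_integral_le[OF has_integral_std_normal_density[OF assms] has_integral_const_real[of 1 a b]] assms
    by (simp add: mult.commute)
  then show ?thesis by simp
qed

text \<open>This lower bound converts an error in probability into an error in the normal
  argument.\<close>

lemma Phi_diff_ge:
  assumes "a \<le> b" "\<bar>a\<bar> \<le> Z" "\<bar>b\<bar> \<le> Z"
  shows "std_normal_density Z * (b - a) \<le> Phi b - Phi a"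
proof -
  have "std_normal_density Z \<le> std_normal_density w" if "w \<in> {a..b}" for w
  proof -
    have "\<bar>w\<bar> \<le> \<bar>Z\<bar>" using assms that by auto
    then have "w^2 \<le> Z^2" by (simp add: abs_le_square_iff)
    then show ?thesis unfolding std_normal_density_def by (simp add: divide_right_mono)
  qed
  then show ?thesis
    using has_integral_le[OF has_integral_const_real[of "std_normal_density Z" a b] has_integral_std_normal_density[OF assms(1)]] assms
    by (simp add: mult.commute)
qed

lemma Phi_strict_mono: "a < b \<Longrightarrow> Phi a < Phi b"
  using Phi_diff_ge[of a b "max \<bar>a\<bar> \<bar>b\<bar>"] normal_density_pos[of 1 0 "max \<bar>a\<bar> \<bar>b\<bar>"]
  by (smt (verit, best) mult_pos_pos)

lemma Phi_minus: "Phi (- x) = 1 - Phi x"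
proof -
  have eq: "Phi n - Phi x = Phi (- x) - Phi (- n)" if "x \<le> n" for n
  proof -
    have "((\<lambda>w. std_normal_density (- w)) has_integral Phi n - Phi x) {- n..- x}"
      using has_integral_reflect_real[THEN iffD2, OF has_integral_std_normal_density[OF that]] by simp
    moreover have "(\<lambda>w. std_normal_density (- w)) = std_normal_density"
      by (simp add: std_normal_density_def fun_eq_iff)
    ultimately have "(std_normal_density has_integral Phi n - Phi x) {- n..- x}" by metis
    then show ?thesis
      using has_integral_unique has_integral_std_normal_density[of "- n" "- x"] that by auto
  qed
  have A: "(\<lambda>n. Phi (real n) - Phi x) \<longlonglongrightarrow> 1 - Phi x"
    by (intro tendsto_intros std_normal.cdf_lim_infty_prob)
  have B: "(\<lambda>n. Phi (- x) - Phi (- real n)) \<longlonglongrightarrow> Phi (- x) - 0"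
    by (intro tendsto_intros std_normal.cdf_lim_neg_infty)
  have E: "\<forall>\<^sub>F n in sequentially. Phi (real n) - Phi x = Phi (- x) - Phi (- real n)"
    using eventually_ge_at_top[of "nat \<lceil>x\<rceil>"] by eventually_elim (intro eq, linarith)
  show ?thesis using LIMSEQ_unique[OF Lim_transform_eventually[OF A E] B] by simp
qed

text \<open>The factor (1 + R)^n may be moved under the integral, because 1 + R is at most 1 + |w|
  for w below - R; a Gaussian moment bound then finishes.\<close>

lemma Phi_tail:
  obtains C :: real where "C > 0" "\<And>R. 0 \<le> R \<Longrightarrow> (1 + R) ^ n * Phi (- R) \<le> C"
proof -
  obtain C where C: "C > 0" "\<And>w::real. (1 + \<bar>w\<bar>) ^ n * exp (- (w^2) / 2) \<le> C / (1 + w^2)"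
    using gaussian_moment_decay by metis
  have "(1 + R) ^ n * Phi (- R) \<le> C * pi" if R: "0 \<le> R" for R
  proof -
    have "(1 + R) ^ n * (Phi (- R) - Phi (- real m)) \<le> C * pi" if m: "R \<le> m" for m
    proof -
      have I: "((\<lambda>w. (1 + R) ^ n * std_normal_density w) has_integral (1 + R) ^ n * (Phi (- R) - Phi (- real m))) {- real m..- R}"
        using m by (intro has_integral_mult_right has_integral_std_normal_density) simp
      have "\<bar>(1 + R) ^ n * std_normal_density w\<bar> \<le> C / (1 + w^2)" if w: "w \<in> {- real m..- R}" for w
      proof -
        have "1 \<le> sqrt (2 * pi)" using pi_gt3 by (simp add: real_le_rsqrt)
        then have "std_normal_density w \<le> exp (- (w^2) / 2)"
          unfolding std_normal_density_def by (simp add: divide_simps)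
        moreover have "(1 + R) ^ n \<le> (1 + \<bar>w\<bar>) ^ n" using w R by (intro power_mono) auto
        ultimately have "(1 + R) ^ n * std_normal_density w \<le> (1 + \<bar>w\<bar>) ^ n * exp (- (w^2) / 2)"
          by (intro mult_mono) auto
        then show ?thesis using C(2)[of w] R by (simp add: abs_mult)
      qed
      then have "\<bar>integral {- real m..- R} (\<lambda>w. (1 + R) ^ n * std_normal_density w)\<bar> \<le> C * pi"
        using C(1) m I by (intro integral_abs_le_of_decay) auto
      then show ?thesis unfolding integral_unique[OF I] by linarith
    qed
    then have "\<forall>\<^sub>F m in sequentially. (1 + R) ^ n * (Phi (- R) - Phi (- real m)) \<le> C * pi"
      using eventually_ge_at_top[of "nat \<lceil>R\<rceil>"] by (auto elim!: eventually_mono)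
    moreover have "(\<lambda>m. (1 + R) ^ n * (Phi (- R) - Phi (- real m))) \<longlonglongrightarrow> (1 + R) ^ n * (Phi (- R) - 0)"
      by (intro tendsto_intros std_normal.cdf_lim_neg_infty)
    ultimately show ?thesis using tendsto_upperbound by fastforce
  qed
  then show ?thesis using that[of "C * pi"] C(1) by simp
qed

section \<open>The unnormalised beta density\<close>

text \<open>The arguments are the exponents rather than the beta parameters, so
  \<open>M * \<mu>\<close> and \<open>M * (1 - \<mu>)\<close> belong to the parameters M \<mu> + 1
  and M (1 - \<mu>) + 1 and put the mode at \<mu>.\<close>

definition beta_kernel :: "real \<Rightarrow> real \<Rightarrow> real \<Rightarrow> real" where
  "beta_kernel A B y = y powr A * (1 - y) powr B"

lemma beta_kernel_nonneg: "0 \<le> beta_kernel A B y"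
  unfolding beta_kernel_def by simp

lemma beta_kernel_exp:
  assumes "0 < y" "y < 1"
  shows "beta_kernel A B y = exp (A * ln y + B * ln (1 - y))"
  using assms unfolding beta_kernel_def powr_def by (simp add: exp_add)

lemma continuous_on_beta_kernel:
  assumes "0 < A" "0 < B"
  shows "continuous_on {0..1} (beta_kernel A B)"
proof -
  have "continuous_on {0..1} (\<lambda>y. y powr A * (1 - y) powr B)"
    using assms by (intro continuous_on_mult continuous_on_powr' continuous_intros) auto
  then show ?thesis by (simp add: beta_kernel_def[abs_def])
qed

text \<open>After adding (y - \<mu>)^2 / 2 the function still increases up to \<mu> and decreases
  beyond it: its derivative is \<mu> - x times 1 / (x (1 - x)) - 1, and x (1 - x) is at most 1. This
  Gaussian majorant is global, whereas the expansion is only local.\<close>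

lemma log_beta_kernel_le:
  fixes \<mu> y :: real
  assumes "0 < \<mu>" "\<mu> < 1" "0 < y" "y < 1"
  shows "\<mu> * ln y + (1 - \<mu>) * ln (1 - y) + (y - \<mu>)^2 / 2 \<le> \<mu> * ln \<mu> + (1 - \<mu>) * ln (1 - \<mu>)"
proof -
  define g where "g = (\<lambda>y. \<mu> * ln y + (1 - \<mu>) * ln (1 - y) + (y - \<mu>)^2 / 2)"
  have d: "(g has_real_derivative (\<mu> - x) * (1 / (x * (1 - x)) - 1)) (at x)" if "0 < x" "x < 1" for x
    unfolding g_def using that
    by (auto intro!: derivative_eq_intros) (simp add: field_simps)
  have p: "0 \<le> 1 / (x * (1 - x)) - 1" if "0 < x" "x < 1" for x :: real
  proof -
    have "x * (1 - x) \<le> 1 * 1" using that by (intro mult_mono) auto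
    then show ?thesis using that by (simp add: field_simps)
  qed
  have "g y \<le> g \<mu>"
  proof (cases "y \<le> \<mu>")
    case True
    show ?thesis
    proof (rule DERIV_nonneg_imp_nondecreasing[OF True])
      fix x assume "y \<le> x" "x \<le> \<mu>"
      then show "\<exists>z. (g has_real_derivative z) (at x) \<and> 0 \<le> z"
        using d[of x] p[of x] assms by (intro exI[of _ "(\<mu> - x) * (1 / (x * (1 - x)) - 1)"] conjI mult_nonneg_nonneg) auto
    qed
  next
    case False
    show ?thesis
    proof (rule DERIV_nonpos_imp_nonincreasing[of \<mu> y g])
      fix x assume "\<mu> \<le> x" "x \<le> y"
      then show "\<exists>z. (g has_real_derivative z) (at x) \<and> z \<le> 0"
        using d[of x] p[of x] assms by (intro exI[of _ "(\<mu> - x) * (1 / (x * (1 - x)) - 1)"] conjI mult_nonpos_nonneg) auto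
    qed (use False in auto)
  qed
  then show ?thesis unfolding g_def by simp
qed

lemma beta_kernel_le:
  assumes "0 < \<mu>" "\<mu> < 1" "0 \<le> M" "0 \<le> y" "y \<le> 1"
  shows "beta_kernel (M * \<mu>) (M * (1 - \<mu>)) y
    \<le> beta_kernel (M * \<mu>) (M * (1 - \<mu>)) \<mu> * exp (- (M * ((y - \<mu>)^2 / 2)))"
proof (cases "0 < y \<and> y < 1")
  case True
  have "M * (\<mu> * ln y + (1 - \<mu>) * ln (1 - y) + (y - \<mu>)^2 / 2) \<le> M * (\<mu> * ln \<mu> + (1 - \<mu>) * ln (1 - \<mu>))"
    using assms True by (intro mult_left_mono log_beta_kernel_le) auto
  then show ?thesis using True assms
    by (simp add: beta_kernel_exp exp_add[symmetric] algebra_simps del: exp_add)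
next
  \<comment> \<open>At the two end points the kernel vanishes, because \<open>0 powr x = 0\<close>
    for every exponent.\<close>
  case False
  then have "y = 0 \<or> y = 1" using assms by auto
  then have "beta_kernel (M * \<mu>) (M * (1 - \<mu>)) y = 0" unfolding beta_kernel_def by auto
  then show ?thesis by (simp add: beta_kernel_nonneg)
qed

subsection \<open>Cornish-Fisher expansion of the incomplete beta integral\<close>

lemma abs_exp_minus_one_le:
  fixes r :: real
  assumes "\<bar>r\<bar> \<le> 1"
  shows "\<bar>exp r - 1\<bar> \<le> 2 * \<bar>r\<bar>"
proof (cases "0 \<le> r")
  case True
  have "r^2 \<le> r" using True assms by (simp add: power2_eq_square mult_left_le)
  then show ?thesis using exp_bound[of r] True assms by simp
next
  case False
  then have "exp r \<le> 1" by simp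
  then show ?thesis using exp_ge_add_one_self[of r] False by linarith
qed

text \<open>With \<epsilon> = \<rho>^(-m) and m above the degree, (1 + |w|)^k is at most \<rho>^(m -
  1), so one factor \<epsilon> absorbs the growth and a factor 1 / \<rho> is left over.\<close>

lemma poly_bounded_scaled:
  assumes "poly_bounded \<delta> g"
  obtains C k where "C > 0"
    "\<And>\<mu> \<epsilon> w \<rho> m. \<delta> \<le> \<mu> \<Longrightarrow> \<mu> \<le> 1 - \<delta> \<Longrightarrow> 0 < \<epsilon> \<Longrightarrow> \<epsilon> \<le> 1 \<Longrightarrow> 1 \<le> \<rho> \<Longrightarrow>
       \<rho> ^ m * \<epsilon> = 1 \<Longrightarrow> k < m \<Longrightarrow> \<bar>w\<bar> \<le> \<rho> - 1 \<Longrightarrow> \<epsilon> * \<bar>g \<mu> \<epsilon> w\<bar> \<le> C / \<rho>"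
proof -
  obtain C k where C: "C > 0" "\<And>\<mu> \<epsilon> w. \<delta> \<le> \<mu> \<Longrightarrow> \<mu> \<le> 1 - \<delta> \<Longrightarrow> 0 < \<epsilon> \<Longrightarrow> \<epsilon> \<le> 1 \<Longrightarrow> \<bar>g \<mu> \<epsilon> w\<bar> \<le> C * (1 + \<bar>w\<bar>) ^ k"
    using poly_boundedE[OF assms] by metis
  show ?thesis
  proof (rule that[of C k, OF C(1)])
    fix \<mu> \<epsilon> w \<rho> :: real and m :: nat
    assume a: "\<delta> \<le> \<mu>" "\<mu> \<le> 1 - \<delta>" "0 < \<epsilon>" "\<epsilon> \<le> 1" and r: "1 \<le> \<rho>" "\<rho> ^ m * \<epsilon> = 1" "k < m" "\<bar>w\<bar> \<le> \<rho> - 1"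
    have "(1 + \<bar>w\<bar>) ^ k \<le> \<rho> ^ k" using r by (intro power_mono) auto
    also have "\<dots> \<le> \<rho> ^ (m - 1)" using r by (intro power_increasing) auto
    finally have "\<rho> * (1 + \<bar>w\<bar>) ^ k \<le> \<rho> ^ m" using r
      by (cases m) (auto intro: mult_left_mono)
    then have "\<epsilon> * (\<rho> * (1 + \<bar>w\<bar>) ^ k) \<le> 1" using a r(2) mult_left_mono[of "\<rho> * (1 + \<bar>w\<bar>) ^ k" "\<rho> ^ m" \<epsilon>]
      by (simp add: mult.commute)
    then have "C * (\<epsilon> * (\<rho> * (1 + \<bar>w\<bar>) ^ k)) \<le> C * 1" using C(1) by (intro mult_left_mono) auto
    then have "\<epsilon> * (C * (1 + \<bar>w\<bar>) ^ k) \<le> C / \<rho>" using r(1) by (simp add: field_simps)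
    moreover have "\<epsilon> * \<bar>g \<mu> \<epsilon> w\<bar> \<le> \<epsilon> * (C * (1 + \<bar>w\<bar>) ^ k)" using C(2)[OF a] a by (intro mult_left_mono) auto
    ultimately show "\<epsilon> * \<bar>g \<mu> \<epsilon> w\<bar> \<le> C / \<rho>" by linarith
  qed
qed

lemma has_real_derivative_cf_quantile:
  "(cf_quantile \<mu> \<epsilon> has_real_derivative sd \<mu> * \<epsilon> * cf_scaled_deriv \<mu> \<epsilon> w) (at w within S)"
  unfolding cf_quantile_def[abs_def] cf_scaled_def cf_scaled_deriv_def
  by (auto intro!: derivative_eq_intros simp: algebra_simps power2_eq_square)

text \<open>The window \<open>1 + \<bar>w\<bar> \<le> \<rho> = \<epsilon> powr (- 1 / m)\<close> is small enough for the expansion and large enough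
  for all tails outside of it to be \<open>O(\<epsilon>\<^sup>3)\<close>.\<close>

lemma cf_scaled_window:
  fixes \<delta> Z :: real and k :: nat
  assumes \<delta>: "0 < \<delta>" and "0 < C"
  obtains m \<epsilon>0 where "0 < m" "0 < \<epsilon>0" "\<epsilon>0 \<le> 1"
    "\<And>\<epsilon>. 0 < \<epsilon> \<Longrightarrow> \<epsilon> \<le> \<epsilon>0 \<Longrightarrow> \<exists>\<rho>\<ge>3 + \<bar>Z\<bar>. \<rho> ^ m * \<epsilon> = 1 \<and>
       (\<forall>\<mu> w. \<delta> \<le> \<mu> \<and> \<mu> \<le> 1 - \<delta> \<and> \<bar>w\<bar> \<le> \<rho> - 1 \<longrightarrow>
          \<bar>cf_scaled_deriv \<mu> \<epsilon> w - 1\<bar> \<le> 1 / 2 \<and> \<bar>cf_quantile \<mu> \<epsilon> w - \<mu>\<bar> \<le> \<delta> / 2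
          \<and> \<bar>cf_scaled \<mu> \<epsilon> w - w\<bar> \<le> 1 \<and> \<epsilon>^3 * (C * (1 + \<bar>w\<bar>) ^ k) \<le> 1)"
proof -
  note pb = poly_bounded_intros poly_bounded_coeffs \<delta>
  have "poly_bounded \<delta> (\<lambda>\<mu> \<epsilon> w. k3 \<mu> * (2 * w) + \<epsilon> * (cub \<mu> * (3 * w^2) + lin \<mu>))" by (intro pb)
  then obtain C1 k1 where 1: "C1 > 0"
    "\<And>\<mu> \<epsilon> w \<rho> m. \<delta> \<le> \<mu> \<Longrightarrow> \<mu> \<le> 1 - \<delta> \<Longrightarrow> 0 < \<epsilon> \<Longrightarrow> \<epsilon> \<le> 1 \<Longrightarrow> 1 \<le> \<rho> \<Longrightarrow>
       \<rho> ^ m * \<epsilon> = 1 \<Longrightarrow> k1 < m \<Longrightarrow> \<bar>w\<bar> \<le> \<rho> - 1 \<Longrightarrow> \<epsilon> * \<bar>k3 \<mu> * (2 * w) + \<epsilon> * (cub \<mu> * (3 * w^2) + lin \<mu>)\<bar> \<le> C1 / \<rho>"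
    by (rule poly_bounded_scaled) blast
  have "poly_bounded \<delta> (\<lambda>\<mu> \<epsilon> w. sd \<mu> * cf_scaled \<mu> \<epsilon> w)" unfolding cf_scaled_def by (intro pb)
  then obtain C2 k2 where 2: "C2 > 0"
    "\<And>\<mu> \<epsilon> w \<rho> m. \<delta> \<le> \<mu> \<Longrightarrow> \<mu> \<le> 1 - \<delta> \<Longrightarrow> 0 < \<epsilon> \<Longrightarrow> \<epsilon> \<le> 1 \<Longrightarrow> 1 \<le> \<rho> \<Longrightarrow>
       \<rho> ^ m * \<epsilon> = 1 \<Longrightarrow> k2 < m \<Longrightarrow> \<bar>w\<bar> \<le> \<rho> - 1 \<Longrightarrow> \<epsilon> * \<bar>sd \<mu> * cf_scaled \<mu> \<epsilon> w\<bar> \<le> C2 / \<rho>"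
    by (rule poly_bounded_scaled) blast
  have "poly_bounded \<delta> (\<lambda>\<mu> \<epsilon> w. k3 \<mu> * (w^2 + 2) + \<epsilon> * (cub \<mu> * w^3 + lin \<mu> * w))" by (intro pb)
  then obtain C3 k3' where 3: "C3 > 0"
    "\<And>\<mu> \<epsilon> w \<rho> m. \<delta> \<le> \<mu> \<Longrightarrow> \<mu> \<le> 1 - \<delta> \<Longrightarrow> 0 < \<epsilon> \<Longrightarrow> \<epsilon> \<le> 1 \<Longrightarrow> 1 \<le> \<rho> \<Longrightarrow>
       \<rho> ^ m * \<epsilon> = 1 \<Longrightarrow> k3' < m \<Longrightarrow> \<bar>w\<bar> \<le> \<rho> - 1 \<Longrightarrow> \<epsilon> * \<bar>k3 \<mu> * (w^2 + 2) + \<epsilon> * (cub \<mu> * w^3 + lin \<mu> * w)\<bar> \<le> C3 / \<rho>"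
    by (rule poly_bounded_scaled) blast
  have "poly_bounded \<delta> (\<lambda>\<mu> \<epsilon> w. C * (1 + \<bar>w\<bar>) ^ k)" by (intro pb)
  then obtain C4 k4' where 4: "C4 > 0"
    "\<And>\<mu> \<epsilon> w \<rho> m. \<delta> \<le> \<mu> \<Longrightarrow> \<mu> \<le> 1 - \<delta> \<Longrightarrow> 0 < \<epsilon> \<Longrightarrow> \<epsilon> \<le> 1 \<Longrightarrow> 1 \<le> \<rho> \<Longrightarrow>
       \<rho> ^ m * \<epsilon> = 1 \<Longrightarrow> k4' < m \<Longrightarrow> \<bar>w\<bar> \<le> \<rho> - 1 \<Longrightarrow> \<epsilon> * \<bar>C * (1 + \<bar>w\<bar>) ^ k\<bar> \<le> C4 / \<rho>"
    by (rule poly_bounded_scaled) blast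
  \<comment> \<open>Larger than all four degrees, so that one and the same \<rho> serves all four
    polynomials.\<close>
  define m where "m = k1 + k2 + k3' + k4' + 1"
  have m: "0 < m" "k1 < m" "k2 < m" "k3' < m" "k4' < m" unfolding m_def by auto
  \<comment> \<open>The last four summands turn the bounds C1 / \<rho>, C2 / \<rho>, C3 / \<rho> and
    C4 / \<rho> into 1/2, \<delta>/2, 1 and 1; the first two keep \<zeta> well inside the
    window.\<close>
  define \<rho>0 where "\<rho>0 = 3 + \<bar>Z\<bar> + 2 * C1 + 2 * C2 / \<delta> + C3 + C4"
  have nn: "0 \<le> 2 * C2 / \<delta>" using 2(1) \<delta> by simp
  have \<rho>0: "3 + \<bar>Z\<bar> \<le> \<rho>0" "2 * C1 \<le> \<rho>0" "2 * C2 / \<delta> \<le> \<rho>0" "C3 \<le> \<rho>0" "C4 \<le> \<rho>0"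
    unfolding \<rho>0_def using nn 1(1) 2(1) 3(1) 4(1) by linarith+
  have \<rho>1: "1 \<le> \<rho>0" using \<rho>0(1) by linarith
  show ?thesis
  proof (rule that[of m "1 / \<rho>0 ^ m"])
    show "0 < 1 / \<rho>0 ^ m" "1 / \<rho>0 ^ m \<le> 1" using \<rho>1 by (auto simp: one_le_power)
    fix \<epsilon> :: real assume \<epsilon>: "0 < \<epsilon>" "\<epsilon> \<le> 1 / \<rho>0 ^ m"
    have \<epsilon>1: "\<epsilon> \<le> 1" using \<epsilon>(2) \<open>1 / \<rho>0 ^ m \<le> 1\<close> by linarith
    define \<rho> where "\<rho> = root m (1 / \<epsilon>)"
    have \<rho>m: "\<rho> ^ m = 1 / \<epsilon>" unfolding \<rho>_def using \<epsilon>(1) m(1) by (intro real_root_pow_pos2) auto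
    then have \<rho>\<epsilon>: "\<rho> ^ m * \<epsilon> = 1" using \<epsilon> by simp
    have "\<rho>0 ^ m \<le> 1 / \<epsilon>" using \<epsilon> \<rho>1 by (simp add: field_simps)
    then have "root m (\<rho>0 ^ m) \<le> \<rho>" unfolding \<rho>_def using m(1) by (intro real_root_le_mono)
    then have \<rho>: "\<rho>0 \<le> \<rho>" using m(1) \<rho>1 by (simp add: real_root_power_cancel)
    have \<rho>p: "1 \<le> \<rho>" "0 < \<rho>" using \<rho> \<rho>1 by linarith+
    have *: "c / \<rho> \<le> b" if "c / b \<le> \<rho>0" "0 < b" for b c :: real
    proof -
      have "c / b \<le> \<rho>" using that(1) \<rho> by linarith
      then show ?thesis using that(2) \<rho>p by (simp add: field_simps)
    qed
    show "\<exists>\<rho>\<ge>3 + \<bar>Z\<bar>. \<rho> ^ m * \<epsilon> = 1 \<and>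
       (\<forall>\<mu> w. \<delta> \<le> \<mu> \<and> \<mu> \<le> 1 - \<delta> \<and> \<bar>w\<bar> \<le> \<rho> - 1 \<longrightarrow>
          \<bar>cf_scaled_deriv \<mu> \<epsilon> w - 1\<bar> \<le> 1 / 2 \<and> \<bar>cf_quantile \<mu> \<epsilon> w - \<mu>\<bar> \<le> \<delta> / 2
          \<and> \<bar>cf_scaled \<mu> \<epsilon> w - w\<bar> \<le> 1 \<and> \<epsilon>^3 * (C * (1 + \<bar>w\<bar>) ^ k) \<le> 1)"
    proof (intro exI[of _ \<rho>] conjI allI impI; (elim conjE)?)
      show "3 + \<bar>Z\<bar> \<le> \<rho>" using \<rho> \<rho>0(1) by linarith
      show "\<rho> ^ m * \<epsilon> = 1" by (rule \<rho>\<epsilon>)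
      fix \<mu> w :: real assume a: "\<delta> \<le> \<mu>" "\<mu> \<le> 1 - \<delta>" and w: "\<bar>w\<bar> \<le> \<rho> - 1"
      note hyp = a \<epsilon>(1) \<epsilon>1 \<rho>p(1) \<rho>\<epsilon>
      have "\<epsilon> * \<bar>k3 \<mu> * (2 * w) + \<epsilon> * (cub \<mu> * (3 * w^2) + lin \<mu>)\<bar> \<le> 1 / 2"
      proof -
        have "C1 / \<rho> \<le> 1 / 2" using \<rho>0(2) by (intro *) auto
        then show ?thesis using 1(2)[OF hyp m(2) w] by linarith
      qed
      then show "\<bar>cf_scaled_deriv \<mu> \<epsilon> w - 1\<bar> \<le> 1 / 2"
        unfolding cf_scaled_deriv_def using \<epsilon>(1) by (simp add: abs_mult)
      have "\<epsilon> * \<bar>sd \<mu> * cf_scaled \<mu> \<epsilon> w\<bar> \<le> \<delta> / 2"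
      proof -
        have "C2 / \<rho> \<le> \<delta> / 2" using \<rho>0(3) \<delta> by (intro *) (auto simp: mult.commute)
        then show ?thesis using 2(2)[OF hyp m(3) w] by linarith
      qed
      then show "\<bar>cf_quantile \<mu> \<epsilon> w - \<mu>\<bar> \<le> \<delta> / 2"
        unfolding cf_quantile_def using \<epsilon>(1) by (simp add: abs_mult mult_ac)
      have "\<epsilon> * \<bar>k3 \<mu> * (w^2 + 2) + \<epsilon> * (cub \<mu> * w^3 + lin \<mu> * w)\<bar> \<le> 1"
        using 3(2)[OF hyp m(4) w] *[of C3 1] \<rho>0(4) by simp
      then show "\<bar>cf_scaled \<mu> \<epsilon> w - w\<bar> \<le> 1"
        unfolding cf_scaled_def using \<epsilon>(1) by (simp add: abs_mult)
      have "\<epsilon> * \<bar>C * (1 + \<bar>w\<bar>) ^ k\<bar> \<le> 1"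
        using 4(2)[OF hyp m(5) w] *[of C4 1] \<rho>0(5) by simp
      then have "\<epsilon> * (C * (1 + \<bar>w\<bar>) ^ k) \<le> 1" using \<open>0 < C\<close> by simp
      moreover have "\<epsilon>^3 \<le> \<epsilon>" using \<epsilon>(1) \<epsilon>1 power_decreasing[of 1 3 \<epsilon>] by simp
      then have "\<epsilon>^3 * (C * (1 + \<bar>w\<bar>) ^ k) \<le> \<epsilon> * (C * (1 + \<bar>w\<bar>) ^ k)"
        using \<open>0 < C\<close> by (intro mult_right_mono) auto
      ultimately show "\<epsilon>^3 * (C * (1 + \<bar>w\<bar>) ^ k) \<le> 1" by linarith
    qed
  qed (use m in auto)
qed

text \<open>Inside the window the substitution y = \<open>cf_quantile \<mu> \<epsilon> w\<close>
  reduces the integral to a normal one; the kernel and the normal density both have tails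
  O(\<epsilon>^3) outside. The error is stated relative to the integral over the unit interval, so
  that division by it yields distribution functions.\<close>

lemma beta_cdf_expansion:
  fixes \<delta> Z :: real
  assumes \<delta>: "0 < \<delta>"
  obtains C \<epsilon>0 where "0 < C" "0 < \<epsilon>0" "\<epsilon>0 \<le> 1"
    "\<And>\<mu> \<epsilon> \<zeta>. \<delta> \<le> \<mu> \<Longrightarrow> \<mu> \<le> 1 - \<delta> \<Longrightarrow> 0 < \<epsilon> \<Longrightarrow> \<epsilon> \<le> \<epsilon>0 \<Longrightarrow> \<bar>\<zeta>\<bar> \<le> Z \<Longrightarrow>
       0 < cf_quantile \<mu> \<epsilon> \<zeta> \<and> cf_quantile \<mu> \<epsilon> \<zeta> < 1 \<and>
       0 < integral {0..1} (beta_kernel (1 / \<epsilon>^2 * \<mu>) (1 / \<epsilon>^2 * (1 - \<mu>))) \<and>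
       \<bar>integral {0..cf_quantile \<mu> \<epsilon> \<zeta>} (beta_kernel (1 / \<epsilon>^2 * \<mu>) (1 / \<epsilon>^2 * (1 - \<mu>)))
         - Phi \<zeta> * integral {0..1} (beta_kernel (1 / \<epsilon>^2 * \<mu>) (1 / \<epsilon>^2 * (1 - \<mu>)))\<bar>
       \<le> C * \<epsilon>^3 * integral {0..1} (beta_kernel (1 / \<epsilon>^2 * \<mu>) (1 / \<epsilon>^2 * (1 - \<mu>)))"
proof -
  obtain Ce k where Ce: "Ce > 0" "\<And>\<mu> \<epsilon> w. \<delta> \<le> \<mu> \<Longrightarrow> \<mu> \<le> 1 - \<delta> \<Longrightarrow> 0 < \<epsilon> \<Longrightarrow> \<epsilon> \<le> 1 \<Longrightarrow>
       \<bar>cf_quantile \<mu> \<epsilon> w - \<mu>\<bar> \<le> \<delta> / 2 \<Longrightarrow> \<bar>cf_scaled_deriv \<mu> \<epsilon> w - 1\<bar> \<le> 1 / 2 \<Longrightarrow>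
       \<bar>(\<mu> * ln (cf_quantile \<mu> \<epsilon> w / \<mu>) + (1 - \<mu>) * ln ((1 - cf_quantile \<mu> \<epsilon> w) / (1 - \<mu>))) / \<epsilon>^2
          + ln (cf_scaled_deriv \<mu> \<epsilon> w) - (- (w^2)/2 + \<epsilon>^2 * (lin \<mu> - 2 * (k3 \<mu>)^2))\<bar>
        \<le> \<epsilon>^3 * (Ce * (1 + \<bar>w\<bar>)^k)"
    using cf_exponent[OF \<delta>] by metis
  obtain m \<epsilon>1 where m: "0 < m" and \<epsilon>1: "0 < \<epsilon>1" "\<epsilon>1 \<le> 1" and
    win: "\<And>\<epsilon>. 0 < \<epsilon> \<Longrightarrow> \<epsilon> \<le> \<epsilon>1 \<Longrightarrow> \<exists>\<rho>\<ge>3 + \<bar>Z\<bar>. \<rho> ^ m * \<epsilon> = 1 \<and>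
       (\<forall>\<mu> w. \<delta> \<le> \<mu> \<and> \<mu> \<le> 1 - \<delta> \<and> \<bar>w\<bar> \<le> \<rho> - 1 \<longrightarrow>
          \<bar>cf_scaled_deriv \<mu> \<epsilon> w - 1\<bar> \<le> 1 / 2 \<and> \<bar>cf_quantile \<mu> \<epsilon> w - \<mu>\<bar> \<le> \<delta> / 2
          \<and> \<bar>cf_scaled \<mu> \<epsilon> w - w\<bar> \<le> 1 \<and> \<epsilon>^3 * (Ce * (1 + \<bar>w\<bar>) ^ k) \<le> 1)"
    using cf_scaled_window[OF \<delta> Ce(1), of Z k] by metis
  obtain Cg where Cg: "Cg > 0" "\<And>w::real. (1 + \<bar>w\<bar>) ^ k * exp (- (w^2) / 2) \<le> Cg / (1 + w^2)"
    using gaussian_moment_decay[of k] by metis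
  obtain Cp where Cp: "Cp > 0" "\<And>R. 0 \<le> R \<Longrightarrow> (1 + R) ^ (m * 3) * Phi (- R) \<le> Cp"
    using Phi_tail[of "m * 3"] by metis
  have "poly_bounded \<delta> (\<lambda>\<mu> \<epsilon> w. \<epsilon>^2 * (lin \<mu> - 2 * (k3 \<mu>)^2))"
    by (intro poly_bounded_intros poly_bounded_coeffs \<delta>)
  then obtain Ck kk where Ck: "Ck > 0" "\<And>\<mu> \<epsilon> w. \<delta> \<le> \<mu> \<Longrightarrow> \<mu> \<le> 1 - \<delta> \<Longrightarrow> 0 < \<epsilon> \<Longrightarrow> \<epsilon> \<le> 1 \<Longrightarrow>
      \<bar>\<epsilon>^2 * (lin \<mu> - 2 * (k3 \<mu>)^2)\<bar> \<le> Ck * (1 + \<bar>w\<bar>) ^ kk"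
    by (rule poly_boundedE) blast
  \<comment> \<open>\<open>Ct\<close> bounds the kernel beyond the window by \<epsilon>^4 times its
    peak. \<open>Cu\<close> restates this relative to \<open>K\<close>, which is at least the peak
    times \<delta> \<epsilon> exp (- Ck), so one power of \<epsilon> is lost. \<open>Cc\<close> is
    the error inside the window, and \<open>C5\<close> collects two kernel tails, the centre and two
    normal tails.\<close>
  define Ct where "Ct = exp (9 * \<delta>^2 / 8) * (fact (m * 4) / (\<delta>^2 / 2) ^ (m * 4))"
  define Cu where "Cu = Ct * exp Ck / \<delta>"
  define Cc where "Cc = 2 * Ce * Cg * pi"
  define C5 where "C5 = 2 * Cu + Cc + 2 * Cp"
  have pos: "0 < Ct" "0 < Cu" "0 < Cc" "0 < C5"
    unfolding Ct_def Cu_def Cc_def C5_def using \<delta> Ce(1) Cg(1) Cp(1)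
    by (auto intro!: mult_pos_pos divide_pos_pos add_pos_pos)
  \<comment> \<open>The second bound makes C5 \<epsilon>^3 at most 1/2, so that the true mass
    \<open>T\<close> is at least K / 2.\<close>
  define \<epsilon>0 where "\<epsilon>0 = min \<epsilon>1 (1 / (2 * C5))"
  show ?thesis
  proof (rule that[of "4 * C5" \<epsilon>0])
    show "0 < 4 * C5" "0 < \<epsilon>0" "\<epsilon>0 \<le> 1" unfolding \<epsilon>0_def using pos \<epsilon>1 by auto
    fix \<mu> \<epsilon> \<zeta> :: real
    assume \<mu>: "\<delta> \<le> \<mu>" "\<mu> \<le> 1 - \<delta>" and \<epsilon>: "0 < \<epsilon>" "\<epsilon> \<le> \<epsilon>0" and \<zeta>: "\<bar>\<zeta>\<bar> \<le> Z"
    have e1: "\<epsilon> \<le> 1" "\<epsilon> \<le> \<epsilon>1" "\<epsilon> \<le> 1 / (2 * C5)" using \<epsilon> \<epsilon>1 unfolding \<epsilon>0_def by auto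
    note sdb = sd_bounds[OF \<delta> \<mu>]
    obtain \<rho> where \<rho>: "3 + \<bar>Z\<bar> \<le> \<rho>" "\<rho> ^ m * \<epsilon> = 1" and
      w1: "\<And>w. \<bar>w\<bar> \<le> \<rho> - 1 \<Longrightarrow> \<bar>cf_scaled_deriv \<mu> \<epsilon> w - 1\<bar> \<le> 1 / 2" and
      w2: "\<And>w. \<bar>w\<bar> \<le> \<rho> - 1 \<Longrightarrow> \<bar>cf_quantile \<mu> \<epsilon> w - \<mu>\<bar> \<le> \<delta> / 2" and
      w3: "\<And>w. \<bar>w\<bar> \<le> \<rho> - 1 \<Longrightarrow> \<bar>cf_scaled \<mu> \<epsilon> w - w\<bar> \<le> 1" and
      w4: "\<And>w. \<bar>w\<bar> \<le> \<rho> - 1 \<Longrightarrow> \<epsilon>^3 * (Ce * (1 + \<bar>w\<bar>) ^ k) \<le> 1"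
      using win[OF \<epsilon>(1) e1(2)] \<mu> by metis
    define R where "R = \<rho> - 1"
    have R: "2 \<le> R" "Z \<le> R" "\<rho> = 1 + R" unfolding R_def using \<rho>(1) by auto
    define M where "M = 1 / \<epsilon>^2"
    have M: "0 < M" "M * \<epsilon>^2 = 1" unfolding M_def using \<epsilon>(1) by auto
    define f where "f = beta_kernel (M * \<mu>) (M * (1 - \<mu>))"
    define h where "h = cf_quantile \<mu> \<epsilon>"
    define I where "I = (\<lambda>a b. integral {a..b} f)"
    have fc: "continuous_on {0..1} f" unfolding f_def using M sdb
      by (intro continuous_on_beta_kernel) auto
    have fi: "f integrable_on {a..b}" if "0 \<le> a" "b \<le> 1" for a b
      using that by (intro integrable_continuous_real continuous_on_subset[OF fc]) auto
    have fnn: "0 \<le> f y" for y unfolding f_def by (rule beta_kernel_nonneg)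
    have hb: "\<delta> / 2 \<le> h w" "h w \<le> 1 - \<delta> / 2" "0 < h w" "h w < 1" if "\<bar>w\<bar> \<le> R" for w
    proof -
      have "\<bar>h w - \<mu>\<bar> \<le> \<delta> / 2" using w2[of w] that unfolding R_def h_def by simp
      then show "\<delta> / 2 \<le> h w" "h w \<le> 1 - \<delta> / 2" using \<mu> by linarith+
      then show "0 < h w" "h w < 1" using \<delta> by linarith+
    qed
    have hm: "h a \<le> h b" if "a \<le> b" "- R \<le> a" "b \<le> R" for a b
    proof (rule DERIV_nonneg_imp_nondecreasing[OF that(1)])
      fix x assume "a \<le> x" "x \<le> b"
      then have "\<bar>cf_scaled_deriv \<mu> \<epsilon> x - 1\<bar> \<le> 1 / 2" using w1[of x] that unfolding R_def by simp
      then have "0 \<le> cf_scaled_deriv \<mu> \<epsilon> x" by linarith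
      then have "0 \<le> sd \<mu> * \<epsilon> * cf_scaled_deriv \<mu> \<epsilon> x" using sdb \<epsilon> by simp
      then show "\<exists>y. (h has_real_derivative y) (at x) \<and> 0 \<le> y"
        unfolding h_def using has_real_derivative_cf_quantile by blast
    qed
    define \<kappa> where "\<kappa> = \<epsilon>^2 * (lin \<mu> - 2 * (k3 \<mu>)^2)"
    \<comment> \<open>The mass predicted by the normal approximation: peak value times the scale
      \<open>sd \<mu> * \<epsilon>\<close>, times exp \<kappa> for the constant left in the
      exponent, times sqrt (2 pi) for the normalisation of the normal density.\<close>
    define K where "K = f \<mu> * sd \<mu> * \<epsilon> * exp \<kappa> * sqrt (2 * pi)"
    have fmu: "0 < f \<mu>" unfolding f_def using sdb by (simp add: beta_kernel_exp)
    have K: "0 < K" unfolding K_def using fmu sdb \<epsilon> by simp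
    have Klow: "f \<mu> * \<delta> * \<epsilon> * exp (- Ck) \<le> K"
    proof -
      have "- Ck \<le> \<kappa>" using Ck(2)[OF \<mu> \<epsilon>(1) e1(1), of 0] unfolding \<kappa>_def by simp
      then have "f \<mu> * \<delta> * \<epsilon> * exp (- Ck) \<le> f \<mu> * sd \<mu> * \<epsilon> * exp \<kappa>"
        using fmu sdb \<epsilon> \<delta> by (intro mult_mono) auto
      also have "\<dots> \<le> \<dots> * sqrt (2 * pi)"
      proof -
        have "1 \<le> sqrt (2 * pi)" using pi_gt3 by (simp add: real_le_rsqrt)
        then show ?thesis using fmu sdb \<epsilon> mult_left_mono[of 1 "sqrt (2 * pi)" "f \<mu> * sd \<mu> * \<epsilon> * exp \<kappa>"] by simp
      qed
      finally show ?thesis unfolding K_def .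
    qed
    have dens: "\<bar>sd \<mu> * \<epsilon> * cf_scaled_deriv \<mu> \<epsilon> w * f (h w) - K * std_normal_density w\<bar>
        \<le> (K * \<epsilon>^3 * (2 * Ce * Cg)) / (1 + w^2)" if w: "\<bar>w\<bar> \<le> R" for w
    proof -
      have w': "\<bar>w\<bar> \<le> \<rho> - 1" using w unfolding R_def .
      define L where "L = (\<mu> * ln (h w / \<mu>) + (1 - \<mu>) * ln ((1 - h w) / (1 - \<mu>))) / \<epsilon>^2"
      define r where "r = L + ln (cf_scaled_deriv \<mu> \<epsilon> w) - (- (w^2)/2 + \<kappa>)"
      have r: "\<bar>r\<bar> \<le> \<epsilon>^3 * (Ce * (1 + \<bar>w\<bar>)^k)"
        unfolding r_def L_def \<kappa>_def h_def using Ce(2)[OF \<mu> \<epsilon>(1) e1(1) w2[OF w'] w1[OF w']] .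
      then have er: "\<bar>exp r - 1\<bar> \<le> 2 * (\<epsilon>^3 * (Ce * (1 + \<bar>w\<bar>)^k))"
        using abs_exp_minus_one_le[of r] w4[OF w'] by linarith
      have vp: "0 < cf_scaled_deriv \<mu> \<epsilon> w" using w1[OF w'] by linarith
      have "L = M * \<mu> * ln (h w) + M * (1 - \<mu>) * ln (1 - h w) - (M * \<mu> * ln \<mu> + M * (1 - \<mu>) * ln (1 - \<mu>))"
      proof -
        have "ln (h w / \<mu>) = ln (h w) - ln \<mu>" "ln ((1 - h w) / (1 - \<mu>)) = ln (1 - h w) - ln (1 - \<mu>)"
          using hb[OF w] sdb by (auto simp: ln_div)
        note lns = this
        show ?thesis unfolding L_def M_def lns by (simp add: divide_inverse algebra_simps)
      qed
      then have "f (h w) = f \<mu> * exp L"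
        unfolding f_def using hb[OF w] sdb by (simp add: beta_kernel_exp exp_add[symmetric] del: exp_add)
      then have "sd \<mu> * \<epsilon> * cf_scaled_deriv \<mu> \<epsilon> w * f (h w)
          = f \<mu> * sd \<mu> * \<epsilon> * exp (L + ln (cf_scaled_deriv \<mu> \<epsilon> w))"
        using vp by (simp add: exp_add)
      also have "L + ln (cf_scaled_deriv \<mu> \<epsilon> w) = \<kappa> + (- (w^2)/2) + r" unfolding r_def by simp
      also have "f \<mu> * sd \<mu> * \<epsilon> * exp (\<kappa> + (- (w^2)/2) + r) = K * std_normal_density w * exp r"
        unfolding K_def std_normal_density_def exp_add by simp
      finally have "sd \<mu> * \<epsilon> * cf_scaled_deriv \<mu> \<epsilon> w * f (h w) - K * std_normal_density w
          = K * std_normal_density w * (exp r - 1)" by (simp add: right_diff_distrib)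
      then have "\<bar>sd \<mu> * \<epsilon> * cf_scaled_deriv \<mu> \<epsilon> w * f (h w) - K * std_normal_density w\<bar>
          = K * std_normal_density w * \<bar>exp r - 1\<bar>" using K by (simp add: abs_mult)
      also have "\<dots> \<le> K * exp (- (w^2)/2) * (2 * (\<epsilon>^3 * (Ce * (1 + \<bar>w\<bar>)^k)))"
      proof (intro mult_mono er)
        have "1 \<le> sqrt (2 * pi)" using pi_gt3 by (simp add: real_le_rsqrt)
        then show "std_normal_density w \<le> exp (- (w^2) / 2)"
          unfolding std_normal_density_def by (simp add: divide_simps)
      qed (use K in auto)
      also have "\<dots> = K * \<epsilon>^3 * (2 * Ce) * ((1 + \<bar>w\<bar>)^k * exp (- (w^2)/2))" by simp
      also have "\<dots> \<le> K * \<epsilon>^3 * (2 * Ce) * (Cg / (1 + w^2))"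
        using K \<epsilon> Ce(1) by (intro mult_left_mono Cg(2)) auto
      finally show ?thesis by simp
    qed
    have cent: "\<bar>I (h a) (h b) - K * (Phi b - Phi a)\<bar> \<le> K * (Cc * \<epsilon>^3)" if ab: "a \<le> b" "- R \<le> a" "b \<le> R" for a b
    proof -
      have "((\<lambda>w. (sd \<mu> * \<epsilon> * cf_scaled_deriv \<mu> \<epsilon> w) *\<^sub>R f (h w)) has_integral I (h a) (h b)) {a..b}"
        unfolding I_def
      proof (rule has_integral_substitution[OF ab(1) hm[OF ab] _ fc])
        show "h ` {a..b} \<subseteq> {0..1}"
        proof
          fix y assume "y \<in> h ` {a..b}"
          then obtain w where "y = h w" "\<bar>w\<bar> \<le> R" using ab by (auto simp: abs_le_iff)
          then show "y \<in> {0..1}" using hb[of w] by simp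
        qed
      qed (unfold h_def, rule has_real_derivative_cf_quantile)
      then have "((\<lambda>w. sd \<mu> * \<epsilon> * cf_scaled_deriv \<mu> \<epsilon> w * f (h w) - K * std_normal_density w)
          has_integral (I (h a) (h b) - K * (Phi b - Phi a))) {a..b}"
        by (intro has_integral_diff has_integral_mult_right has_integral_std_normal_density ab(1)) simp
      then have i: "integral {a..b} (\<lambda>w. sd \<mu> * \<epsilon> * cf_scaled_deriv \<mu> \<epsilon> w * f (h w) - K * std_normal_density w)
          = I (h a) (h b) - K * (Phi b - Phi a)"
        "(\<lambda>w. sd \<mu> * \<epsilon> * cf_scaled_deriv \<mu> \<epsilon> w * f (h w) - K * std_normal_density w) integrable_on {a..b}"
        by (auto simp: integral_unique integrable_on_def)
      have "\<bar>I (h a) (h b) - K * (Phi b - Phi a)\<bar> \<le> K * \<epsilon>^3 * (2 * Ce * Cg) * pi"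
        unfolding i(1)[symmetric]
        using K \<epsilon> Ce(1) Cg(1) ab by (intro integral_abs_le_of_decay[OF ab(1) _ i(2)] dens) auto
      then show ?thesis unfolding Cc_def by (simp add: mult_ac)
    qed
    have tail: "I a b \<le> K * (Cu * \<epsilon>^3)"
      if ab: "0 \<le> a" "a \<le> b" "b \<le> 1" and far: "\<And>y. y \<in> {a..b} \<Longrightarrow> \<delta> * \<epsilon> * (R - 1) \<le> \<bar>y - \<mu>\<bar>" for a b
    proof -
      define c where "c = f \<mu> * (Ct * \<epsilon>^4)"
      have "f y \<le> c" if y: "y \<in> {a..b}" for y
      proof -
        have "f y \<le> f \<mu> * exp (- (M * ((y - \<mu>)^2 / 2)))"
          unfolding f_def using M sdb ab y by (intro beta_kernel_le) auto
        also have "\<dots> \<le> f \<mu> * (Ct * \<epsilon>^4)"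
        proof (rule mult_left_mono)
          have "(\<delta> * \<epsilon> * (R - 1))^2 \<le> \<bar>y - \<mu>\<bar>^2"
            using far[OF y] \<delta> \<epsilon> R(1) by (intro power_mono) auto
          then have "M * ((\<delta> * \<epsilon> * (R - 1))^2 / 2) \<le> M * ((y - \<mu>)^2 / 2)"
            using M by (intro mult_left_mono divide_right_mono) auto
          moreover have "M * ((\<delta> * \<epsilon> * (R - 1))^2 / 2) = (M * \<epsilon>^2) * (\<delta>^2 * (R - 1)^2 / 2)"
            by (simp add: power_mult_distrib)
          \<comment> \<open>The parabola (\<rho> - 2)^2 lies above its tangent at \<rho> = 5/2. A
            bound linear in \<rho> is the form that \<open>power_exp_bounded\<close> takes.\<close>
          moreover have "\<delta>^2 * (\<rho> - 9/4) \<le> \<delta>^2 * (R - 1)^2"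
          proof (rule mult_left_mono)
            have "0 \<le> (\<rho> - 5/2)^2" by simp
            then show "\<rho> - 9/4 \<le> (R - 1)^2" unfolding R_def by (simp add: power2_eq_square algebra_simps)
          qed simp
          ultimately have "- (M * ((y - \<mu>)^2 / 2)) \<le> 9 * \<delta>^2 / 8 + - (\<delta>^2 / 2 * \<rho>)"
            unfolding M(2) by (simp add: algebra_simps)
          then have "exp (- (M * ((y - \<mu>)^2 / 2))) \<le> exp (9 * \<delta>^2 / 8) * exp (- (\<delta>^2 / 2 * \<rho>))"
            unfolding exp_add[symmetric] by simp
          \<comment> \<open>Exponential decay in \<rho> beats \<rho>^(-4 m), and this is
            \<epsilon>^4 by the choice of \<rho>.\<close>
          also have "exp (- (\<delta>^2 / 2 * \<rho>)) \<le> fact (m * 4) / (\<delta>^2 / 2) ^ (m * 4) * \<epsilon>^4"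
          proof -
            have "\<rho> ^ (m * 4) * exp (- (\<delta>^2 / 2 * \<rho>)) \<le> fact (m * 4) / (\<delta>^2 / 2) ^ (m * 4)"
              using \<delta> \<rho>(1) by (intro power_exp_bounded) auto
            then have "(\<rho> ^ (m * 4) * exp (- (\<delta>^2 / 2 * \<rho>))) * \<epsilon>^4 \<le> fact (m * 4) / (\<delta>^2 / 2) ^ (m * 4) * \<epsilon>^4"
              using \<epsilon> by (intro mult_right_mono) auto
            moreover have "\<rho> ^ (m * 4) * \<epsilon>^4 = 1"
              unfolding power_mult power_mult_distrib[symmetric] \<rho>(2) by simp
            then have "(\<rho> ^ (m * 4) * exp (- (\<delta>^2 / 2 * \<rho>))) * \<epsilon>^4 = exp (- (\<delta>^2 / 2 * \<rho>))"
            proof -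
              assume *: "\<rho> ^ (m * 4) * \<epsilon>^4 = 1"
              have **: "(\<rho> ^ (m * 4) * E) * \<epsilon>^4 = (\<rho> ^ (m * 4) * \<epsilon>^4) * E" for E :: real by (simp only: mult_ac)
              show ?thesis unfolding ** * by simp
            qed
            ultimately show ?thesis by linarith
          qed
          finally show "exp (- (M * ((y - \<mu>)^2 / 2))) \<le> Ct * \<epsilon>^4" unfolding Ct_def by simp
        qed (use fmu in simp)
        finally show ?thesis unfolding c_def .
      qed
      then have "I a b \<le> integral {a..b} (\<lambda>y. c)"
        unfolding I_def using ab fi by (intro integral_le) auto
      also have "\<dots> = (b - a) * c" using ab by simp
      also have "\<dots> \<le> 1 * c" using ab fmu pos unfolding c_def by (intro mult_right_mono) auto
      also have "\<dots> = (f \<mu> * \<delta> * \<epsilon> * exp (- Ck)) * (Cu * \<epsilon>^3)"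
      proof -
        have "exp (- Ck) * exp Ck = 1" by (simp add: exp_minus)
        then have "(f \<mu> * \<delta> * \<epsilon> * exp (- Ck)) * (Ct * exp Ck / \<delta> * \<epsilon>^3) = f \<mu> * Ct * (\<epsilon> * \<epsilon>^3)"
          using \<delta> by simp
        then show ?thesis unfolding c_def Cu_def by (simp add: power_numeral_reduce)
      qed
      also have "\<dots> \<le> K * (Cu * \<epsilon>^3)" using Klow pos \<epsilon> by (intro mult_right_mono) auto
      finally show ?thesis .
    qed
    have Inn: "0 \<le> I a b" if "0 \<le> a" "b \<le> 1" for a b
      unfolding I_def using fi[OF that] fnn by (intro integral_nonneg) auto
    have hR: "\<bar>R\<bar> \<le> R" "\<bar>- R\<bar> \<le> R" using R by auto
    have edge: "\<delta> * \<epsilon> * (R - 1) \<le> sd \<mu> * \<epsilon> * (R - 1)" using sdb \<epsilon> R by (intro mult_right_mono) auto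
    have tl: "I 0 (h (- R)) \<le> K * (Cu * \<epsilon>^3)"
    proof (rule tail)
      fix y assume y: "y \<in> {0..h (- R)}"
      have "cf_scaled \<mu> \<epsilon> (- R) \<le> - (R - 1)" using w3[of "- R"] R unfolding R_def by linarith
      then have "sd \<mu> * \<epsilon> * cf_scaled \<mu> \<epsilon> (- R) \<le> sd \<mu> * \<epsilon> * (- (R - 1))"
        using sdb \<epsilon> by (intro mult_left_mono) auto
      then have "h (- R) - \<mu> \<le> - (sd \<mu> * \<epsilon> * (R - 1))"
        unfolding h_def cf_quantile_def mult_minus_right by linarith
      then have "sd \<mu> * \<epsilon> * (R - 1) \<le> \<mu> - y" using y by simp
      then show "\<delta> * \<epsilon> * (R - 1) \<le> \<bar>y - \<mu>\<bar>" using edge by linarith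
    qed (use hb[OF hR(2)] in auto)
    have tr: "I (h R) 1 \<le> K * (Cu * \<epsilon>^3)"
    proof (rule tail)
      fix y assume y: "y \<in> {h R..1}"
      have "R - 1 \<le> cf_scaled \<mu> \<epsilon> R" using w3[of R] R unfolding R_def by linarith
      then have "sd \<mu> * \<epsilon> * (R - 1) \<le> sd \<mu> * \<epsilon> * cf_scaled \<mu> \<epsilon> R"
        using sdb \<epsilon> by (intro mult_left_mono) auto
      then have "sd \<mu> * \<epsilon> * (R - 1) \<le> h R - \<mu>" unfolding h_def cf_quantile_def by simp
      then have "sd \<mu> * \<epsilon> * (R - 1) \<le> y - \<mu>" using y by simp
      then show "\<delta> * \<epsilon> * (R - 1) \<le> \<bar>y - \<mu>\<bar>" using edge by linarith
    qed (use hb[OF hR(1)] in auto)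
    have PhiR: "Phi (- R) \<le> Cp * \<epsilon>^3"
    proof -
      have "\<rho> ^ (m * 3) * Phi (- R) \<le> Cp" using Cp(2)[of R] R by simp
      then have "(\<rho> ^ (m * 3) * Phi (- R)) * \<epsilon>^3 \<le> Cp * \<epsilon>^3" using \<epsilon> by (intro mult_right_mono) auto
      moreover have "\<rho> ^ (m * 3) * \<epsilon>^3 = 1"
        unfolding power_mult power_mult_distrib[symmetric] \<rho>(2) by simp
      then have "(\<rho> ^ (m * 3) * Phi (- R)) * \<epsilon>^3 = Phi (- R)" by (simp add: mult_ac)
      ultimately show ?thesis by simp
    qed
    have PhiR0: "0 \<le> Phi (- R)" by (rule std_normal.cdf_nonneg)
    have PhiR1: "Phi R = 1 - Phi (- R)" using Phi_minus[of R] by linarith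
    have split: "I a c = I a b + I b c" if "0 \<le> a" "a \<le> b" "b \<le> c" "c \<le> 1" for a b c
      unfolding I_def using that fi[of a c] by (intro Henstock_Kurzweil_Integration.integral_combine[symmetric]) auto
    have KPhi: "K * Phi (- R) \<le> K * (Cp * \<epsilon>^3)" "0 \<le> K * Phi (- R)" using K PhiR PhiR0 by auto
    have \<zeta>R: "- R \<le> \<zeta>" "\<zeta> \<le> R" using \<zeta> R by auto
    then have \<zeta>R': "\<bar>\<zeta>\<bar> \<le> R" by simp
    define P where "P = I 0 (h \<zeta>)"
    define T where "T = I 0 1"
    define X where "X = K * (C5 * \<epsilon>^3)"
    have Xs: "X = K * (Cu * \<epsilon>^3) + K * (Cu * \<epsilon>^3) + K * (Cc * \<epsilon>^3) + K * (Cp * \<epsilon>^3) + K * (Cp * \<epsilon>^3)"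
      unfolding X_def C5_def by (simp add: algebra_simps)
    have nn: "0 \<le> K * (Cu * \<epsilon>^3)" "0 \<le> K * (Cp * \<epsilon>^3)" using K pos \<epsilon> Cp(1) by auto
    have "P = I 0 (h (- R)) + I (h (- R)) (h \<zeta>)"
      unfolding P_def using hb[OF hR(2)] hb[OF \<zeta>R'] hm[OF \<zeta>R(1) _ \<zeta>R(2)] by (intro split) auto
    moreover have "0 \<le> I 0 (h (- R))" using hb[OF hR(2)] by (intro Inn) auto
    moreover have "\<bar>I (h (- R)) (h \<zeta>) - (K * Phi \<zeta> - K * Phi (- R))\<bar> \<le> K * (Cc * \<epsilon>^3)"
      using cent[of "- R" \<zeta>] \<zeta>R by (simp add: right_diff_distrib)
    ultimately have P: "\<bar>P - K * Phi \<zeta>\<bar> \<le> X"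
      using tl KPhi nn unfolding Xs by (simp only: abs_le_iff) linarith
    have "T = I 0 (h (- R)) + I (h (- R)) 1"
      unfolding T_def using hb[OF hR(2)] by (intro split) auto
    moreover have "I (h (- R)) 1 = I (h (- R)) (h R) + I (h R) 1"
      using hb[OF hR(2)] hb[OF hR(1)] hm[of "- R" R] R by (intro split) auto
    moreover have "0 \<le> I 0 (h (- R))" "0 \<le> I (h R) 1" using hb[OF hR(2)] hb[OF hR(1)] by (auto intro: Inn)
    moreover have "\<bar>I (h (- R)) (h R) - (K - K * Phi (- R) - K * Phi (- R))\<bar> \<le> K * (Cc * \<epsilon>^3)"
      using cent[of "- R" R] R unfolding PhiR1 by (simp add: right_diff_distrib)
    ultimately have T: "\<bar>T - K\<bar> \<le> X"
      using tl tr KPhi nn unfolding Xs by (simp only: abs_le_iff) linarith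
    have "\<epsilon>^3 \<le> \<epsilon>" using \<epsilon>(1) e1(1) power_decreasing[of 1 3 \<epsilon>] by simp
    then have "C5 * \<epsilon>^3 \<le> C5 * (1 / (2 * C5))" using e1(3) pos by (intro mult_left_mono) auto
    then have "C5 * \<epsilon>^3 \<le> 1 / 2" using pos by simp
    then have "X \<le> K * (1 / 2)" unfolding X_def using K by (intro mult_left_mono) auto
    then have KT: "K \<le> 2 * T" using T by linarith
    have Phi01: "0 \<le> Phi \<zeta>" "Phi \<zeta> \<le> 1" using std_normal.cdf_nonneg std_normal.cdf_bounded_prob by auto
    \<comment> \<open>Replacing the predicted mass \<open>K\<close> by the true mass
      \<open>T\<close> costs a second \<open>X\<close>; passing from K to 2 T in the bound doubles
      it again, whence the constant 4 C5.\<close>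
    have "\<bar>Phi \<zeta> * (T - K)\<bar> \<le> 1 * X"
      unfolding abs_mult using Phi01 T by (intro mult_mono) auto
    then have "\<bar>P - Phi \<zeta> * T\<bar> \<le> 2 * X" using P by (simp add: algebra_simps abs_le_iff)
    also have "\<dots> \<le> 4 * C5 * \<epsilon>^3 * T"
      unfolding X_def using mult_left_mono[OF KT, of "2 * (C5 * \<epsilon>^3)"] pos \<epsilon> by (simp add: mult_ac)
    finally have "\<bar>P - Phi \<zeta> * T\<bar> \<le> 4 * C5 * \<epsilon>^3 * T" .
    then show "0 < cf_quantile \<mu> \<epsilon> \<zeta> \<and> cf_quantile \<mu> \<epsilon> \<zeta> < 1 \<and>
       0 < integral {0..1} (beta_kernel (1 / \<epsilon>^2 * \<mu>) (1 / \<epsilon>^2 * (1 - \<mu>))) \<and>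
       \<bar>integral {0..cf_quantile \<mu> \<epsilon> \<zeta>} (beta_kernel (1 / \<epsilon>^2 * \<mu>) (1 / \<epsilon>^2 * (1 - \<mu>)))
         - Phi \<zeta> * integral {0..1} (beta_kernel (1 / \<epsilon>^2 * \<mu>) (1 / \<epsilon>^2 * (1 - \<mu>)))\<bar>
       \<le> 4 * C5 * \<epsilon>^3 * integral {0..1} (beta_kernel (1 / \<epsilon>^2 * \<mu>) (1 / \<epsilon>^2 * (1 - \<mu>)))"
      using hb[OF \<zeta>R'] KT K unfolding P_def T_def I_def f_def M_def h_def by auto
  qed
qed

text \<open>Moving the normal argument by D \<epsilon>^3 with D = (C + 1) / \<phi> changes the
  normal distribution function by at least (C + 1) \<epsilon>^3, which exceeds the error C
  \<epsilon>^3 of the expansion. The polynomial has slope O(\<epsilon>) in its argument, so the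
  points \<open>lo\<close> and \<open>hi\<close> move by only O(\<epsilon>^4).\<close>

lemma beta_quantile_sandwich:
  fixes \<delta> z :: real
  assumes \<delta>: "0 < \<delta>"
  obtains C \<epsilon>0 where "0 < C" "0 < \<epsilon>0" "\<epsilon>0 \<le> 1"
    "\<And>\<mu> \<epsilon>. \<delta> \<le> \<mu> \<Longrightarrow> \<mu> \<le> 1 - \<delta> \<Longrightarrow> 0 < \<epsilon> \<Longrightarrow> \<epsilon> \<le> \<epsilon>0 \<Longrightarrow>
       \<exists>lo hi. 0 < lo \<and> lo < 1 \<and> 0 < hi \<and> hi < 1 \<and>
         \<bar>lo - cf_quantile \<mu> \<epsilon> z\<bar> \<le> C * \<epsilon>^4 \<and> \<bar>hi - cf_quantile \<mu> \<epsilon> z\<bar> \<le> C * \<epsilon>^4 \<and>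
         integral {0..lo} (beta_kernel (1 / \<epsilon>^2 * \<mu>) (1 / \<epsilon>^2 * (1 - \<mu>)))
           < Phi z * integral {0..1} (beta_kernel (1 / \<epsilon>^2 * \<mu>) (1 / \<epsilon>^2 * (1 - \<mu>))) \<and>
         Phi z * integral {0..1} (beta_kernel (1 / \<epsilon>^2 * \<mu>) (1 / \<epsilon>^2 * (1 - \<mu>)))
           < integral {0..hi} (beta_kernel (1 / \<epsilon>^2 * \<mu>) (1 / \<epsilon>^2 * (1 - \<mu>)))"
proof -
  define Z where "Z = \<bar>z\<bar> + 1"
  obtain C \<epsilon>1 where C: "0 < C" "0 < \<epsilon>1" "\<epsilon>1 \<le> 1" and
    ex: "\<And>\<mu> \<epsilon> \<zeta>. \<delta> \<le> \<mu> \<Longrightarrow> \<mu> \<le> 1 - \<delta> \<Longrightarrow> 0 < \<epsilon> \<Longrightarrow> \<epsilon> \<le> \<epsilon>1 \<Longrightarrow> \<bar>\<zeta>\<bar> \<le> Z \<Longrightarrow>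
       0 < cf_quantile \<mu> \<epsilon> \<zeta> \<and> cf_quantile \<mu> \<epsilon> \<zeta> < 1 \<and>
       0 < integral {0..1} (beta_kernel (1 / \<epsilon>^2 * \<mu>) (1 / \<epsilon>^2 * (1 - \<mu>))) \<and>
       \<bar>integral {0..cf_quantile \<mu> \<epsilon> \<zeta>} (beta_kernel (1 / \<epsilon>^2 * \<mu>) (1 / \<epsilon>^2 * (1 - \<mu>)))
         - Phi \<zeta> * integral {0..1} (beta_kernel (1 / \<epsilon>^2 * \<mu>) (1 / \<epsilon>^2 * (1 - \<mu>)))\<bar>
       \<le> C * \<epsilon>^3 * integral {0..1} (beta_kernel (1 / \<epsilon>^2 * \<mu>) (1 / \<epsilon>^2 * (1 - \<mu>)))"
    using beta_cdf_expansion[OF \<delta>, of Z] by metis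
  define \<phi> where "\<phi> = std_normal_density Z"
  have \<phi>: "0 < \<phi>" unfolding \<phi>_def by (rule normal_density_pos) simp
  define D where "D = (C + 1) / \<phi>"
  have D: "0 < D" unfolding D_def using C \<phi> by simp
  \<comment> \<open>The difference quotient of \<open>cf_quantile\<close> between w and z, divided
    by \<epsilon>.\<close>
  have "poly_bounded \<delta> (\<lambda>\<mu> \<epsilon> w. sd \<mu> * (1 + \<epsilon> * (k3 \<mu> * (w + z) + \<epsilon> * (cub \<mu> * (w^2 + w * z + z^2) + lin \<mu>))))"
    by (intro poly_bounded_intros poly_bounded_coeffs \<delta>)
  then obtain B k where B: "B > 0" "\<And>\<mu> \<epsilon> w. \<delta> \<le> \<mu> \<Longrightarrow> \<mu> \<le> 1 - \<delta> \<Longrightarrow> 0 < \<epsilon> \<Longrightarrow> \<epsilon> \<le> 1 \<Longrightarrow>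
      \<bar>sd \<mu> * (1 + \<epsilon> * (k3 \<mu> * (w + z) + \<epsilon> * (cub \<mu> * (w^2 + w * z + z^2) + lin \<mu>)))\<bar> \<le> B * (1 + \<bar>w\<bar>) ^ k"
    by (rule poly_boundedE) blast
  define L where "L = B * (1 + Z) ^ k"
  have L: "0 < L" unfolding L_def using B(1) by (simp add: Z_def)
  \<comment> \<open>Ensures D \<epsilon>^3 at most 1, so both shifted arguments stay within Z = |z|
    + 1.\<close>
  define \<epsilon>0 where "\<epsilon>0 = min \<epsilon>1 (1 / D)"
  show ?thesis
  proof (rule that[of "L * D" \<epsilon>0])
    show "0 < L * D" "0 < \<epsilon>0" "\<epsilon>0 \<le> 1" unfolding \<epsilon>0_def using L D C by auto
    fix \<mu> \<epsilon> :: real assume \<mu>: "\<delta> \<le> \<mu>" "\<mu> \<le> 1 - \<delta>" and \<epsilon>: "0 < \<epsilon>" "\<epsilon> \<le> \<epsilon>0"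
    have e1: "\<epsilon> \<le> 1" "\<epsilon> \<le> \<epsilon>1" "\<epsilon> \<le> 1 / D" using \<epsilon> C unfolding \<epsilon>0_def by auto
    have "\<epsilon>^3 \<le> \<epsilon>" using \<epsilon>(1) e1(1) power_decreasing[of 1 3 \<epsilon>] by simp
    then have "D * \<epsilon>^3 \<le> D * (1 / D)" using e1(3) D by (intro mult_left_mono) auto
    then have s: "D * \<epsilon>^3 \<le> 1" "0 \<le> D * \<epsilon>^3" using D \<epsilon> by auto
    define T where "T = integral {0..1} (beta_kernel (1 / \<epsilon>^2 * \<mu>) (1 / \<epsilon>^2 * (1 - \<mu>)))"
    define P where "P = (\<lambda>\<zeta>. integral {0..cf_quantile \<mu> \<epsilon> \<zeta>} (beta_kernel (1 / \<epsilon>^2 * \<mu>) (1 / \<epsilon>^2 * (1 - \<mu>))))"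
    have ex': "0 < cf_quantile \<mu> \<epsilon> \<zeta>" "cf_quantile \<mu> \<epsilon> \<zeta> < 1" "0 < T" "\<bar>P \<zeta> - Phi \<zeta> * T\<bar> \<le> C * \<epsilon>^3 * T"
      if "\<bar>\<zeta>\<bar> \<le> Z" for \<zeta>
      using ex[OF \<mu> \<epsilon>(1) e1(2) that] unfolding P_def T_def by auto
    have lip: "\<bar>cf_quantile \<mu> \<epsilon> \<zeta> - cf_quantile \<mu> \<epsilon> z\<bar> \<le> L * D * \<epsilon>^4"
      if "\<bar>\<zeta> - z\<bar> \<le> D * \<epsilon>^3" "\<bar>\<zeta>\<bar> \<le> Z" for \<zeta>
    proof -
      define q where "q = sd \<mu> * (1 + \<epsilon> * (k3 \<mu> * (\<zeta> + z) + \<epsilon> * (cub \<mu> * (\<zeta>^2 + \<zeta> * z + z^2) + lin \<mu>)))"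
      have "cf_quantile \<mu> \<epsilon> \<zeta> - cf_quantile \<mu> \<epsilon> z = \<epsilon> * (\<zeta> - z) * q"
        unfolding cf_quantile_def cf_scaled_def q_def by algebra
      then have "\<bar>cf_quantile \<mu> \<epsilon> \<zeta> - cf_quantile \<mu> \<epsilon> z\<bar> = \<epsilon> * \<bar>\<zeta> - z\<bar> * \<bar>q\<bar>"
        using \<epsilon>(1) by (simp add: abs_mult)
      also have "\<dots> \<le> \<epsilon> * (D * \<epsilon>^3) * L"
      proof (intro mult_mono)
        have "(1 + \<bar>\<zeta>\<bar>) ^ k \<le> (1 + Z) ^ k" using that(2) by (intro power_mono) auto
        then have "B * (1 + \<bar>\<zeta>\<bar>) ^ k \<le> L" unfolding L_def using B(1) by (intro mult_left_mono) auto
        then show "\<bar>q\<bar> \<le> L" unfolding q_def using B(2)[OF \<mu> \<epsilon>(1) e1(1), of \<zeta>] by linarith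
      qed (use that \<epsilon> D in auto)
      also have "\<dots> = L * D * \<epsilon>^4" by (simp add: power_numeral_reduce)
      finally show ?thesis .
    qed
    define a b where "a = z - D * \<epsilon>^3" and "b = z + D * \<epsilon>^3"
    have ab: "\<bar>a\<bar> \<le> Z" "\<bar>b\<bar> \<le> Z" "\<bar>z\<bar> \<le> Z" "a \<le> z" "z \<le> b" "\<bar>a - z\<bar> \<le> D * \<epsilon>^3" "\<bar>b - z\<bar> \<le> D * \<epsilon>^3"
      unfolding a_def b_def Z_def using s by auto
    have g: "\<phi> * (D * \<epsilon>^3) = (C + 1) * \<epsilon>^3" unfolding D_def using \<phi> by simp
    have e3: "0 < \<epsilon>^3" using \<epsilon> by simp
    have za: "z - a = D * \<epsilon>^3" "b - z = D * \<epsilon>^3" unfolding a_def b_def by simp_all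
    have T: "0 < T" using ex'(3)[OF ab(3)] .
    have "C * \<epsilon>^3 < Phi z - Phi a"
      using Phi_diff_ge[OF ab(4,1,3)] g e3 za unfolding \<phi>_def[symmetric] by (simp only: distrib_right)
    then have "C * \<epsilon>^3 * T < (Phi z - Phi a) * T" using T by (intro mult_strict_right_mono)
    then have lo: "P a < Phi z * T" using ex'(4)[OF ab(1)] by (simp add: left_diff_distrib abs_le_iff)
    have "C * \<epsilon>^3 < Phi b - Phi z"
      using Phi_diff_ge[OF ab(5,3,2)] g e3 za unfolding \<phi>_def[symmetric] by (simp only: distrib_right)
    then have "C * \<epsilon>^3 * T < (Phi b - Phi z) * T" using T by (intro mult_strict_right_mono)
    then have hi: "Phi z * T < P b" using ex'(4)[OF ab(2)] by (simp add: left_diff_distrib abs_le_iff)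
    show "\<exists>lo hi. 0 < lo \<and> lo < 1 \<and> 0 < hi \<and> hi < 1 \<and>
         \<bar>lo - cf_quantile \<mu> \<epsilon> z\<bar> \<le> L * D * \<epsilon>^4 \<and> \<bar>hi - cf_quantile \<mu> \<epsilon> z\<bar> \<le> L * D * \<epsilon>^4 \<and>
         integral {0..lo} (beta_kernel (1 / \<epsilon>^2 * \<mu>) (1 / \<epsilon>^2 * (1 - \<mu>)))
           < Phi z * integral {0..1} (beta_kernel (1 / \<epsilon>^2 * \<mu>) (1 / \<epsilon>^2 * (1 - \<mu>))) \<and>
         Phi z * integral {0..1} (beta_kernel (1 / \<epsilon>^2 * \<mu>) (1 / \<epsilon>^2 * (1 - \<mu>)))
           < integral {0..hi} (beta_kernel (1 / \<epsilon>^2 * \<mu>) (1 / \<epsilon>^2 * (1 - \<mu>)))"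
      using ex'(1,2)[OF ab(1)] ex'(1,2)[OF ab(2)] lip[OF ab(6,1)] lip[OF ab(7,2)] lo hi
      unfolding P_def T_def by blast
  qed
qed

subsection \<open>Beta quantiles and the Clopper-Pearson interval\<close>

lemma quantile_between:
  assumes mono: "\<And>x y. x \<le> y \<Longrightarrow> cdf M x \<le> cdf M y" and lo: "cdf M lo < \<gamma>" and hi: "\<gamma> \<le> cdf M hi"
  shows "lo \<le> quantile M \<gamma>" "quantile M \<gamma> \<le> hi"
proof -
  have lb: "lo \<le> x" if "\<gamma> \<le> cdf M x" for x
    using mono[of x lo] lo that by linarith
  show "lo \<le> quantile M \<gamma>" unfolding quantile_def using hi lb by (intro cInf_greatest) auto
  show "quantile M \<gamma> \<le> hi" unfolding quantile_def
    using hi lb by (intro cInf_lower bdd_belowI[of _ lo]) auto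
qed

lemma quantile_eq:
  assumes "cdf M r = \<gamma>" "\<And>x. x < r \<Longrightarrow> cdf M x < \<gamma>"
  shows "quantile M \<gamma> = r"
  unfolding quantile_def using assms by (intro cInf_eq_minimum) (auto simp: not_less[symmetric])

text \<open>The Lipschitz bound \<open>Phi_diff_le\<close> gives continuity, and the limits at both
  infinities give the two points for the intermediate value theorem.\<close>

lemma ex_Phi_eq:
  assumes "0 < \<gamma>" "\<gamma> < 1"
  obtains z where "Phi z = \<gamma>"
proof -
  have "\<forall>\<^sub>F n in sequentially. Phi (- real n) < \<gamma>"
    using order_tendstoD(2)[OF std_normal.cdf_lim_neg_infty assms(1)] .
  moreover have "\<forall>\<^sub>F n in sequentially. \<gamma> < Phi (real n)"
    using order_tendstoD(1)[OF std_normal.cdf_lim_infty_prob assms(2)] .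
  ultimately have "\<forall>\<^sub>F n in sequentially. Phi (- real n) < \<gamma> \<and> \<gamma> < Phi (real n)"
    by (rule eventually_conj)
  then obtain n where n: "Phi (- real n) < \<gamma>" "\<gamma> < Phi (real n)"
    using eventually_happens by fastforce
  have "continuous_on {- real n..real n} Phi"
  proof (rule continuous_onI)
    fix x e :: real assume "0 < e"
    moreover have "dist (Phi x') (Phi x) \<le> dist x' x" for x'
      using Phi_diff_le[of x x'] Phi_diff_le[of x' x] std_normal.cdf_nondecreasing[of x x'] std_normal.cdf_nondecreasing[of x' x]
      unfolding dist_real_def by (cases "x \<le> x'") linarith+
    ultimately show "\<exists>d>0. \<forall>x'\<in>{- real n..real n}. dist x' x < d \<longrightarrow> dist (Phi x') (Phi x) \<le> e"
      by (intro exI[of _ e]) (auto intro: order_trans less_imp_le)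
  qed
  then show ?thesis using IVT'[of Phi "- real n" \<gamma> "real n"] n that by auto
qed

lemma upper_normal_quantile_eqI:
  assumes "Phi z = 1 - \<beta>"
  shows "upper_normal_quantile \<beta> = z"
  unfolding upper_normal_quantile_def using assms Phi_strict_mono[of _ z] by (intro quantile_eq) auto

lemma Beta_real_positive: "0 < a \<Longrightarrow> 0 < b \<Longrightarrow> 0 < Beta a (b::real)"
  unfolding Beta_def by (intro divide_pos_pos mult_pos_pos Gamma_real_pos) auto

lemma beta_kernel_integrable:
  assumes "0 < a" "0 < b" "0 \<le> c" "d \<le> 1"
  shows "beta_kernel (a - 1) (b - 1) integrable_on {c..d}"
  using integrable_Beta'[OF assms(1,2)] assms(3,4) unfolding beta_kernel_def[abs_def]
  by (elim integrable_on_subinterval) auto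

lemma integral_beta_kernel: "0 < a \<Longrightarrow> 0 < b \<Longrightarrow> integral {0..1} (beta_kernel (a - 1) (b - 1)) = Beta a b"
  using has_integral_Beta_real[of a b] unfolding beta_kernel_def[abs_def] by (intro integral_unique)

text \<open>The set \<open>S\<close> is left open so that the whole line (with x = 1) and the
  half-line below x are both covered: the first gives the total mass, the second the distribution
  function.\<close>

lemma has_integral_beta_density:
  assumes ab: "0 < a" "0 < b" and x: "0 \<le> x" "x \<le> 1" and S: "S \<inter> {0..1} = {0..x}"
  shows "(beta_density a b has_integral integral {0..x} (beta_kernel (a - 1) (b - 1)) / Beta a b) S"
proof -
  have "((\<lambda>t. beta_kernel (a - 1) (b - 1) t / Beta a b) has_integral
      integral {0..x} (beta_kernel (a - 1) (b - 1)) / Beta a b) {0..x}"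
    using beta_kernel_integrable[OF ab, of 0 x] x
    by (intro has_integral_divide integrable_integral) auto
  then have "((\<lambda>t. if t \<in> {0..x} then beta_kernel (a - 1) (b - 1) t / Beta a b else 0) has_integral
      integral {0..x} (beta_kernel (a - 1) (b - 1)) / Beta a b) S"
    using S by (subst has_integral_restrict) auto
  then show ?thesis
  proof (rule has_integral_spike[of "{0, 1}", rotated 2])
    fix t assume t: "t \<in> S - {0, 1}"
    show "beta_density a b t = (if t \<in> {0..x} then beta_kernel (a - 1) (b - 1) t / Beta a b else 0)"
    proof (cases "t \<in> {0..1}")
      case True
      then have "t \<in> {0..x}" using S t by auto
      then show ?thesis using t True by (auto simp: beta_density_def beta_kernel_def)
    next
      case False
      then have "t \<notin> {0..x}" using x by auto
      then show ?thesis using False by (auto simp: beta_density_def)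
    qed
  qed simp
qed

lemma beta_density_measurable [measurable]: "beta_density a b \<in> borel_measurable borel"
  unfolding beta_density_def[abs_def] by measurable

lemma beta_density_nonneg: "0 < a \<Longrightarrow> 0 < b \<Longrightarrow> 0 \<le> beta_density a b x"
  unfolding beta_density_def using Beta_real_positive[of a b] by auto

lemma real_distribution_beta:
  assumes "0 < a" "0 < b"
  shows "real_distribution (beta_distribution a b)"
proof -
  have "(beta_density a b has_integral integral {0..1} (beta_kernel (a - 1) (b - 1)) / Beta a b) UNIV"
    using assms by (intro has_integral_beta_density) auto
  then have "(beta_density a b has_integral 1) UNIV"
    using integral_beta_kernel[OF assms] Beta_real_positive[OF assms] by simp
  then have "emeasure (beta_distribution a b) UNIV = 1"
    unfolding beta_distribution_def
    using measure_density_eq_integral(3)[of "beta_density a b" UNIV 1] beta_density_nonneg[OF assms] by simp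
  then have "prob_space (beta_distribution a b)"
    by (intro prob_spaceI) (simp add: beta_distribution_def)
  then show ?thesis
    unfolding real_distribution_def real_distribution_axioms_def by (simp add: beta_distribution_def)
qed

lemma cdf_beta_distribution:
  assumes "0 < a" "0 < b"
  shows "0 \<le> x \<Longrightarrow> x \<le> 1 \<Longrightarrow> cdf (beta_distribution a b) x = integral {0..x} (beta_kernel (a - 1) (b - 1)) / Beta a b"
    and "x < 0 \<Longrightarrow> cdf (beta_distribution a b) x = 0"
proof -
  assume "0 \<le> x" "x \<le> 1"
  then have "(beta_density a b has_integral integral {0..x} (beta_kernel (a - 1) (b - 1)) / Beta a b) {..x}"
    using assms by (intro has_integral_beta_density) auto
  then show "cdf (beta_distribution a b) x = integral {0..x} (beta_kernel (a - 1) (b - 1)) / Beta a b"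
    unfolding beta_distribution_def cdf_def2
    using measure_density_eq_integral(1)[of "beta_density a b" "{..x}"] beta_density_nonneg[OF assms] by simp
next
  assume "x < 0"
  then have "(beta_density a b has_integral 0) {..x}"
    by (intro has_integral_is_0) (auto simp: beta_density_def)
  then show "cdf (beta_distribution a b) x = 0"
    unfolding beta_distribution_def cdf_def2
    using measure_density_eq_integral(1)[of "beta_density a b" "{..x}"] beta_density_nonneg[OF assms] by simp
qed

lemma cdf_beta_distribution_1: "0 < a \<Longrightarrow> 0 < b \<Longrightarrow> cdf (beta_distribution a b) 1 = 1"
  using cdf_beta_distribution(1)[of a b 1] integral_beta_kernel[of a b] Beta_real_positive[of a b] by simp

lemma beta_quantile_bounds:
  assumes "0 < a" "0 < b" "0 < \<gamma>" "\<gamma> < 1"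
  shows "0 \<le> beta_quantile \<gamma> a b" "beta_quantile \<gamma> a b \<le> 1"
proof -
  interpret real_distribution "beta_distribution a b" by (rule real_distribution_beta[OF assms(1,2)])
  have "cdf (beta_distribution a b) 0 = 0"
    using cdf_beta_distribution(1)[OF assms(1,2), of 0] by simp
  then show "0 \<le> beta_quantile \<gamma> a b" unfolding beta_quantile_def
    using assms cdf_beta_distribution_1[OF assms(1,2)] by (intro quantile_between(1)[of _ _ _ 1] cdf_nondecreasing) auto
  show "beta_quantile \<gamma> a b \<le> 1" unfolding beta_quantile_def
    using assms cdf_beta_distribution_1[OF assms(1,2)] cdf_beta_distribution(1)[OF assms(1,2), of 0]
    by (intro quantile_between(2)[of _ 0] cdf_nondecreasing) auto
qed

text \<open>The integral over the unit interval is \<open>Beta a b\<close>, so the two integral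
  inequalities of the sandwich compare the distribution function at \<open>lo\<close> and
  \<open>hi\<close> with the level, and the quantile lies between them.\<close>

lemma beta_quantile_expansion:
  fixes \<delta> z :: real
  assumes \<delta>: "0 < \<delta>"
  obtains C M0 where "0 < C" "1 \<le> M0"
    "\<And>M \<mu>. M0 \<le> M \<Longrightarrow> \<delta> \<le> \<mu> \<Longrightarrow> \<mu> \<le> 1 - \<delta> \<Longrightarrow>
       \<bar>beta_quantile (Phi z) (M * \<mu> + 1) (M * (1 - \<mu>) + 1) - cf_quantile \<mu> (1 / sqrt M) z\<bar> \<le> C / M^2"
proof -
  obtain C \<epsilon>0 where C: "0 < C" "0 < \<epsilon>0" "\<epsilon>0 \<le> 1" and
    sw: "\<And>\<mu> \<epsilon>. \<delta> \<le> \<mu> \<Longrightarrow> \<mu> \<le> 1 - \<delta> \<Longrightarrow> 0 < \<epsilon> \<Longrightarrow> \<epsilon> \<le> \<epsilon>0 \<Longrightarrow>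
       \<exists>lo hi. 0 < lo \<and> lo < 1 \<and> 0 < hi \<and> hi < 1 \<and>
         \<bar>lo - cf_quantile \<mu> \<epsilon> z\<bar> \<le> C * \<epsilon>^4 \<and> \<bar>hi - cf_quantile \<mu> \<epsilon> z\<bar> \<le> C * \<epsilon>^4 \<and>
         integral {0..lo} (beta_kernel (1 / \<epsilon>^2 * \<mu>) (1 / \<epsilon>^2 * (1 - \<mu>)))
           < Phi z * integral {0..1} (beta_kernel (1 / \<epsilon>^2 * \<mu>) (1 / \<epsilon>^2 * (1 - \<mu>))) \<and>
         Phi z * integral {0..1} (beta_kernel (1 / \<epsilon>^2 * \<mu>) (1 / \<epsilon>^2 * (1 - \<mu>)))
           < integral {0..hi} (beta_kernel (1 / \<epsilon>^2 * \<mu>) (1 / \<epsilon>^2 * (1 - \<mu>)))"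
    using beta_quantile_sandwich[OF \<delta>, of z] by metis
  show ?thesis
  proof (rule that[of C "1 / \<epsilon>0^2"])
    show "0 < C" by fact
    show "1 \<le> 1 / \<epsilon>0^2" using C by (simp add: power_le_one)
    fix M \<mu> :: real assume M: "1 / \<epsilon>0^2 \<le> M" and \<mu>: "\<delta> \<le> \<mu>" "\<mu> \<le> 1 - \<delta>"
    have M1: "1 \<le> M" using M \<open>1 \<le> 1 / \<epsilon>0^2\<close> by linarith
    define \<epsilon> where "\<epsilon> = 1 / sqrt M"
    have \<epsilon>: "0 < \<epsilon>" "1 / \<epsilon>^2 = M" "\<epsilon>^4 = 1 / M^2"
    proof -
      have "(sqrt M)^4 = M^2"
        using M1 power_mult[of "sqrt M" 2 2] by simp
      then show "0 < \<epsilon>" "1 / \<epsilon>^2 = M" "\<epsilon>^4 = 1 / M^2" unfolding \<epsilon>_def using M1 by (auto simp: power_divide)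
    qed
    have "1 / \<epsilon>0 \<le> sqrt M" using M C real_sqrt_le_mono[OF M] by (simp add: real_sqrt_divide)
    then have \<epsilon>0: "\<epsilon> \<le> \<epsilon>0" unfolding \<epsilon>_def using C M1 by (simp add: field_simps)
    define a b where "a = M * \<mu> + 1" and "b = M * (1 - \<mu>) + 1"
    have ab: "0 < a" "0 < b" unfolding a_def b_def using M1 \<mu> \<delta> by (auto intro!: add_nonneg_pos)
    have k: "beta_kernel (M * \<mu>) (M * (1 - \<mu>)) = beta_kernel (a - 1) (b - 1)" unfolding a_def b_def by simp
    obtain lo hi where lh: "0 < lo" "lo < 1" "0 < hi" "hi < 1"
      "\<bar>lo - cf_quantile \<mu> \<epsilon> z\<bar> \<le> C * \<epsilon>^4" "\<bar>hi - cf_quantile \<mu> \<epsilon> z\<bar> \<le> C * \<epsilon>^4"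
      "integral {0..lo} (beta_kernel (a - 1) (b - 1)) < Phi z * Beta a b"
      "Phi z * Beta a b < integral {0..hi} (beta_kernel (a - 1) (b - 1))"
      using sw[OF \<mu> \<epsilon>(1) \<epsilon>0] unfolding \<epsilon>(2) k integral_beta_kernel[OF ab] by auto
    interpret real_distribution "beta_distribution a b" by (rule real_distribution_beta[OF ab])
    have "cdf (beta_distribution a b) lo < Phi z" "Phi z \<le> cdf (beta_distribution a b) hi"
      using lh Beta_real_positive[OF ab] cdf_beta_distribution(1)[OF ab]
      by (auto simp: pos_divide_less_eq pos_le_divide_eq)
    then have "lo \<le> beta_quantile (Phi z) a b" "beta_quantile (Phi z) a b \<le> hi"
      unfolding beta_quantile_def by (auto intro!: quantile_between cdf_nondecreasing)
    then have "\<bar>beta_quantile (Phi z) a b - cf_quantile \<mu> \<epsilon> z\<bar> \<le> C * \<epsilon>^4"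
      using lh(5,6) by linarith
    then have "\<bar>beta_quantile (Phi z) a b - cf_quantile \<mu> \<epsilon> z\<bar> \<le> C / M^2"
      unfolding \<epsilon>(3) by simp
    then show "\<bar>beta_quantile (Phi z) (M * \<mu> + 1) (M * (1 - \<mu>) + 1) - cf_quantile \<mu> (1 / sqrt M) z\<bar> \<le> C / M^2"
      unfolding a_def b_def \<epsilon>_def .
  qed
qed

section \<open>Binomial tails as beta distribution functions\<close>

definition binomial_tail :: "nat \<Rightarrow> nat \<Rightarrow> real \<Rightarrow> real" where
  "binomial_tail n X r = (\<Sum>k=X..n. real (n choose k) * r ^ k * (1 - r) ^ (n - k))"

text \<open>The derivatives of the summands telescope.\<close>

lemma has_derivative_binomial_tail:
  assumes "1 \<le> X" "X \<le> n"
  shows "(binomial_tail n X has_real_derivative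
    (real n * real (n - 1 choose (X - 1))) * (r ^ (X - 1) * (1 - r) ^ (n - X))) (at r within S)"
proof -
  define u where "u = (\<lambda>k. real n * real (n - 1 choose (k - 1)) * (r ^ (k - 1) * (1 - r) ^ (n - k)))"
  have "((\<lambda>r. real (n choose k) * r ^ k * (1 - r) ^ (n - k)) has_real_derivative u k - u (Suc k)) (at r within S)"
    if k: "k \<in> {X..n}" for k
  proof -
    have k1: "1 \<le> k" "k \<le> n" using k assms by auto
    have e1: "real k * real (n choose k) = real n * real (n - 1 choose (k - 1))"
      using times_binomial_minus1_eq[of k n] k1 by (simp flip: of_nat_mult)
    have e2: "real (n - k) * real (n choose k) = real n * real (n - 1 choose k)"
      using binomial_absorb_comp[of n k] by (simp flip: of_nat_mult)
    have "((\<lambda>r. real (n choose k) * r ^ k * (1 - r) ^ (n - k)) has_real_derivative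
        (real k * real (n choose k)) * (r ^ (k - 1) * (1 - r) ^ (n - k))
        - (real (n - k) * real (n choose k)) * (r ^ k * (1 - r) ^ (n - k - 1))) (at r within S)"
      by (auto intro!: derivative_eq_intros simp: algebra_simps)
    then show ?thesis unfolding e1 e2 u_def by (simp add: mult.assoc)
  qed
  then have "(binomial_tail n X has_real_derivative (\<Sum>k=X..n. u k - u (Suc k))) (at r within S)"
    unfolding binomial_tail_def[abs_def] by (intro DERIV_sum) auto
  also have "(\<Sum>k=X..n. u k - u (Suc k)) = u X - u (Suc n)"
    using sum_Suc_diff'[of X "Suc n" "\<lambda>k. - u k"] assms by (simp add: atLeastLessThanSuc_atLeastAtMost)
  \<comment> \<open>The binomial coefficient in it is n - 1 over n.\<close>
  also have "u (Suc n) = 0"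
    using assms by (simp add: u_def binomial_eq_0)
  finally show ?thesis unfolding u_def by simp
qed

lemma binomial_tail_0: "1 \<le> X \<Longrightarrow> binomial_tail n X 0 = 0"
  unfolding binomial_tail_def by (intro sum.neutral) (auto simp: power_0_left)

lemma binomial_tail_1: "X \<le> n \<Longrightarrow> binomial_tail n X 1 = 1"
proof -
  assume "X \<le> n"
  then have "binomial_tail n X 1 = (\<Sum>k\<in>{n}. real (n choose k) * 1 ^ k * (1 - 1) ^ (n - k))"
    unfolding binomial_tail_def by (intro sum.mono_neutral_right) (auto simp: power_0_left)
  then show ?thesis by simp
qed

lemma continuous_on_binomial_tail: "continuous_on S (binomial_tail n X)"
  unfolding binomial_tail_def[abs_def] by (intro continuous_intros)

lemma binomial_tail_strict_mono:
  assumes "1 \<le> X" "X \<le> n" "0 \<le> r" "r < s" "s \<le> 1"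
  shows "binomial_tail n X r < binomial_tail n X s"
proof (rule DERIV_pos_imp_increasing_open[OF assms(4)])
  fix x assume x: "r < x" "x < s"
  have "0 < (real n * real (n - 1 choose (X - 1))) * (x ^ (X - 1) * (1 - x) ^ (n - X))"
    using x assms by (intro mult_pos_pos zero_less_power) (auto simp: zero_less_binomial)
  then show "\<exists>y. (binomial_tail n X has_real_derivative y) (at x) \<and> 0 < y"
    using has_derivative_binomial_tail[OF assms(1,2)] by blast
qed (rule continuous_on_binomial_tail)

lemma binomial_tail_conv_integral:
  assumes X: "1 \<le> X" "X \<le> n" and r: "0 \<le> r" "r \<le> 1"
  shows "binomial_tail n X r
    = real n * real (n - 1 choose (X - 1)) * integral {0..r} (beta_kernel (real X - 1) (real (n - X + 1) - 1))"
proof -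
  define c where "c = real n * real (n - 1 choose (X - 1))"
  have "((\<lambda>x. c * (x ^ (X - 1) * (1 - x) ^ (n - X))) has_integral (binomial_tail n X r - binomial_tail n X 0)) {0..r}"
    unfolding c_def using has_derivative_binomial_tail[OF X]
    by (intro fundamental_theorem_of_calculus r)
       (auto simp: has_real_derivative_iff_has_vector_derivative[symmetric])
  then have "((\<lambda>x. c * beta_kernel (real X - 1) (real (n - X + 1) - 1) x) has_integral (binomial_tail n X r)) {0..r}"
    unfolding binomial_tail_0[OF X(1)] diff_zero
  \<comment> \<open>Real and natural powers differ where the base and the exponent are both zero:
    \<open>0 powr 0 = 0\<close>, but \<open>0 ^ 0 = 1\<close>.\<close>
  proof (rule has_integral_spike[of "{0, 1}", rotated 2])
    fix x assume x: "x \<in> {0..r} - {0, 1}"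
    then have "0 < x" "0 < 1 - x" using r by auto
    then have "beta_kernel (real X - 1) (real (n - X + 1) - 1) x = x ^ (X - 1) * (1 - x) ^ (n - X)"
      unfolding beta_kernel_def using X by (simp add: powr_realpow[symmetric] of_nat_diff)
    then show "c * beta_kernel (real X - 1) (real (n - X + 1) - 1) x = c * (x ^ (X - 1) * (1 - x) ^ (n - X))" by simp
  qed simp
  then have "integral {0..r} (\<lambda>x. c * beta_kernel (real X - 1) (real (n - X + 1) - 1) x) = binomial_tail n X r"
    by (rule integral_unique)
  then show ?thesis unfolding c_def by (simp add: integral_mult_right)
qed

text \<open>At r = 1 the tail is 1, so the integral formula itself identifies the beta function as
  the reciprocal of the binomial factor.\<close>

lemma cdf_beta_eq_binomial_tail:
  assumes X: "1 \<le> X" "X \<le> n" and r: "0 \<le> r" "r \<le> 1"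
  shows "cdf (beta_distribution (real X) (real (n - X + 1))) r = binomial_tail n X r"
proof -
  define c where "c = real n * real (n - 1 choose (X - 1))"
  have ab: "0 < real X" "0 < real (n - X + 1)" using X by auto
  have "c * Beta (real X) (real (n - X + 1)) = 1"
    using binomial_tail_conv_integral[OF X, of 1] binomial_tail_1[OF X(2)] integral_beta_kernel[OF ab]
    unfolding c_def by simp
  then have "Beta (real X) (real (n - X + 1)) = 1 / c" by (metis mult_zero_left nonzero_eq_divide_eq mult.commute zero_neq_one)
  then show ?thesis
    using cdf_beta_distribution(1)[OF ab r] binomial_tail_conv_integral[OF X r] unfolding c_def by simp
qed

text \<open>Strict monotonicity acts twice: it makes the root unique, as the definite description
  requires, and it keeps the distribution function below \<gamma> to the left of the root, as the
  quantile requires.\<close>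

lemma the_binomial_tail_eq_beta_quantile:
  assumes X: "1 \<le> X" "X \<le> n" and \<gamma>: "0 < \<gamma>" "\<gamma> < 1"
  shows "(THE r. r \<in> {0..1} \<and> binomial_tail n X r = \<gamma>) = beta_quantile \<gamma> (real X) (real (n - X + 1))"
proof -
  have ab: "0 < real X" "0 < real (n - X + 1)" using X by auto
  obtain r where r: "0 \<le> r" "r \<le> 1" "binomial_tail n X r = \<gamma>"
    using IVT'[of "binomial_tail n X" 0 \<gamma> 1] binomial_tail_0[OF X(1)] binomial_tail_1[OF X(2)] \<gamma> continuous_on_binomial_tail by auto
  have "(THE r. r \<in> {0..1} \<and> binomial_tail n X r = \<gamma>) = r"
  proof (rule the_equality)
    fix s assume "s \<in> {0..1} \<and> binomial_tail n X s = \<gamma>"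
    then show "s = r" using r binomial_tail_strict_mono[OF X, of s r] binomial_tail_strict_mono[OF X, of r s]
      by (cases s r rule: linorder_cases) auto
  qed (use r in auto)
  moreover have "beta_quantile \<gamma> (real X) (real (n - X + 1)) = r"
    unfolding beta_quantile_def
  proof (rule quantile_eq)
    show "cdf (beta_distribution (real X) (real (n - X + 1))) r = \<gamma>"
      using cdf_beta_eq_binomial_tail[OF X r(1,2)] r(3) by simp
    fix x assume "x < r"
    then show "cdf (beta_distribution (real X) (real (n - X + 1))) x < \<gamma>"
      using cdf_beta_distribution(2)[OF ab, of x] cdf_beta_eq_binomial_tail[OF X, of x]
        binomial_tail_strict_mono[OF X, of x r] r \<gamma> by (cases "x < 0") auto
  qed
  ultimately show ?thesis by simp
qed

text \<open>The sum for the upper end point is one minus the tail starting at X + 1; this raises the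
  first parameter to X + 1 and turns the level \<alpha>/2 into 1 - \<alpha>/2.\<close>

lemma clopper_pearson_eq_beta_quantiles:
  assumes X: "0 < X" "X < n" and \<alpha>: "0 < \<alpha>" "\<alpha> < 1"
  shows "clopper_pearson_interval \<alpha> n X =
    (beta_quantile (\<alpha> / 2) (real X) (real n - real X + 1),
     beta_quantile (1 - \<alpha> / 2) (real X + 1) (real n - real X))"
proof -
  have compl: "(\<Sum>k=0..X. real (n choose k) * r ^ k * (1 - r) ^ (n - k)) = 1 - binomial_tail n (X + 1) r" for r :: real
  proof -
    have "(\<Sum>k\<le>n. real (n choose k) * r ^ k * (1 - r) ^ (n - k)) = 1"
      using binomial_ring[of r "1 - r" n] by simp
    moreover have "{..n} = {0..X} \<union> {X + 1..n}" "{0..X} \<inter> {X + 1..n} = {}" using X by auto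
    ultimately show ?thesis unfolding binomial_tail_def by (simp add: sum.union_disjoint)
  qed
  have "(THE r. r \<in> {0..1} \<and> (\<Sum>k=X..n. real (n choose k) * r ^ k * (1 - r) ^ (n - k)) = \<alpha> / 2)
      = beta_quantile (\<alpha> / 2) (real X) (real (n - X + 1))"
    using the_binomial_tail_eq_beta_quantile[of X n "\<alpha> / 2"] X \<alpha> unfolding binomial_tail_def by simp
  moreover have "(THE r. r \<in> {0..1} \<and> (\<Sum>k=0..X. real (n choose k) * r ^ k * (1 - r) ^ (n - k)) = \<alpha> / 2)
      = beta_quantile (1 - \<alpha> / 2) (real (X + 1)) (real (n - (X + 1) + 1))"
  proof -
    have "(r \<in> {0..1} \<and> (\<Sum>k=0..X. real (n choose k) * r ^ k * (1 - r) ^ (n - k)) = \<alpha> / 2)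
       \<longleftrightarrow> (r \<in> {0..1} \<and> binomial_tail n (X + 1) r = 1 - \<alpha> / 2)" for r :: real
    proof -
      have "1 - t = \<alpha> / 2 \<longleftrightarrow> t = 1 - \<alpha> / 2" for t by linarith
      then show ?thesis unfolding compl by simp
    qed
    then show ?thesis
      using the_binomial_tail_eq_beta_quantile[of "X + 1" n "1 - \<alpha> / 2"] X \<alpha> by simp
  qed
  moreover have "real (n - X + 1) = real n - real X + 1" "real (n - (X + 1) + 1) = real n - real X"
    using X by (auto simp: of_nat_diff)
  ultimately show ?thesis unfolding clopper_pearson_interval_def using X by (simp add: add.commute)
qed

subsection \<open>Expansions uniform over the central range of observations\<close>

text \<open>The constant and the threshold for n precede \<open>X\<close>; this uniformity permits
  averaging over the observation. The exponent is real because the rate n^(-3/2) occurs.\<close>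

definition central_bigo :: "real \<Rightarrow> real \<Rightarrow> (nat \<Rightarrow> nat \<Rightarrow> real) \<Rightarrow> bool" where
  "central_bigo \<delta> k g \<longleftrightarrow> (\<exists>C. \<forall>\<^sub>F n in sequentially. \<forall>X.
     \<delta> * real n \<le> real X \<and> real X \<le> (1 - \<delta>) * real n \<longrightarrow> \<bar>g n X\<bar> \<le> C * real n powr (- k))"

lemma central_bigoI:
  assumes "\<forall>\<^sub>F n in sequentially. \<forall>X. \<delta> * real n \<le> real X \<longrightarrow> real X \<le> (1 - \<delta>) * real n \<longrightarrow> \<bar>g n X\<bar> \<le> C * real n powr (- k)"
  shows "central_bigo \<delta> k g"
  using assms unfolding central_bigo_def by (intro exI[of _ C]) (auto elim!: eventually_mono)

lemma central_bigo_add: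
  assumes "central_bigo \<delta> k f" "central_bigo \<delta> k g"
  shows "central_bigo \<delta> k (\<lambda>n X. f n X + g n X)"
proof -
  obtain C where C: "\<forall>\<^sub>F n in sequentially. \<forall>X. \<delta> * real n \<le> real X \<and> real X \<le> (1 - \<delta>) * real n \<longrightarrow> \<bar>f n X\<bar> \<le> C * real n powr (- k)"
    using assms(1) unfolding central_bigo_def by blast
  obtain D where D: "\<forall>\<^sub>F n in sequentially. \<forall>X. \<delta> * real n \<le> real X \<and> real X \<le> (1 - \<delta>) * real n \<longrightarrow> \<bar>g n X\<bar> \<le> D * real n powr (- k)"
    using assms(2) unfolding central_bigo_def by blast
  show ?thesis
  proof (rule central_bigoI[where C="C + D"])
    show "\<forall>\<^sub>F n in sequentially. \<forall>X. \<delta> * real n \<le> real X \<longrightarrow> real X \<le> (1 - \<delta>) * real n \<longrightarrow>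
        \<bar>f n X + g n X\<bar> \<le> (C + D) * real n powr (- k)"
      using C D
    proof eventually_elim
      case (elim n)
      show ?case
      proof (intro allI impI)
        fix X assume "\<delta> * real n \<le> real X" "real X \<le> (1 - \<delta>) * real n"
        then have "\<bar>f n X\<bar> \<le> C * real n powr (- k)" "\<bar>g n X\<bar> \<le> D * real n powr (- k)" using elim by auto
        then show "\<bar>f n X + g n X\<bar> \<le> (C + D) * real n powr (- k)" by (simp only: distrib_right)
      qed
    qed
  qed
qed

lemma central_bigo_cmult:
  assumes "central_bigo \<delta> k f"
  shows "central_bigo \<delta> k (\<lambda>n X. c * f n X)"
proof -
  obtain C where C: "\<forall>\<^sub>F n in sequentially. \<forall>X. \<delta> * real n \<le> real X \<and> real X \<le> (1 - \<delta>) * real n \<longrightarrow> \<bar>f n X\<bar> \<le> C * real n powr (- k)"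
    using assms unfolding central_bigo_def by blast
  show ?thesis
  proof (rule central_bigoI[where C="\<bar>c\<bar> * C"])
    show "\<forall>\<^sub>F n in sequentially. \<forall>X. \<delta> * real n \<le> real X \<longrightarrow> real X \<le> (1 - \<delta>) * real n \<longrightarrow>
        \<bar>c * f n X\<bar> \<le> \<bar>c\<bar> * C * real n powr (- k)"
      using C by eventually_elim (auto simp: abs_mult mult.assoc intro!: mult_left_mono)
  qed
qed

lemma central_bigo_diff:
  "central_bigo \<delta> k f \<Longrightarrow> central_bigo \<delta> k g \<Longrightarrow> central_bigo \<delta> k (\<lambda>n X. f n X - g n X)"
  using central_bigo_add[OF _ central_bigo_cmult[of \<delta> k g "-1"], of f] by simp

lemma central_bigo_mono:
  assumes "central_bigo \<delta> k f" "l \<le> k"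
  shows "central_bigo \<delta> l f"
proof -
  obtain C where C: "\<forall>\<^sub>F n in sequentially. \<forall>X. \<delta> * real n \<le> real X \<and> real X \<le> (1 - \<delta>) * real n \<longrightarrow> \<bar>f n X\<bar> \<le> C * real n powr (- k)"
    using assms unfolding central_bigo_def by blast
  show ?thesis
  proof (rule central_bigoI[where C="\<bar>C\<bar>"])
    show "\<forall>\<^sub>F n in sequentially. \<forall>X. \<delta> * real n \<le> real X \<longrightarrow> real X \<le> (1 - \<delta>) * real n \<longrightarrow>
        \<bar>f n X\<bar> \<le> \<bar>C\<bar> * real n powr (- l)"
      using C eventually_ge_at_top[of 1]
    proof eventually_elim
      case (elim n)
      have "C * real n powr (- k) \<le> \<bar>C\<bar> * real n powr (- l)"
        using elim(2) assms(2) by (intro mult_mono powr_mono) auto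
      then show ?case using elim(1) by (meson order_trans)
    qed
  qed
qed

lemma central_bigo_cong:
  assumes "\<forall>\<^sub>F n in sequentially. \<forall>X. \<delta> * real n \<le> real X \<longrightarrow> real X \<le> (1 - \<delta>) * real n \<longrightarrow> f n X = g n X"
    and "central_bigo \<delta> k f"
  shows "central_bigo \<delta> k g"
proof -
  obtain C where C: "\<forall>\<^sub>F n in sequentially. \<forall>X. \<delta> * real n \<le> real X \<and> real X \<le> (1 - \<delta>) * real n \<longrightarrow> \<bar>f n X\<bar> \<le> C * real n powr (- k)"
    using assms unfolding central_bigo_def by blast
  show ?thesis
    by (rule central_bigoI[where C=C]) (use C assms(1) in \<open>eventually_elim, auto\<close>)
qed

section \<open>Smoothness of the coefficients in the mode\<close>

lemma sd_lipschitz: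
  assumes "0 < \<delta>" "\<delta> \<le> a" "a \<le> 1 - \<delta>" "\<delta> \<le> b" "b \<le> 1 - \<delta>"
  shows "\<bar>sd a - sd b\<bar> \<le> \<bar>a - b\<bar> / (2 * \<delta>)"
proof -
  note A = sd_bounds[OF assms(1-3)] and B = sd_bounds[OF assms(1,4,5)]
  have "(sd a - sd b) * (sd a + sd b) = (sd a)^2 - (sd b)^2" by algebra
  also have "\<dots> = (a - b) * (1 - a - b)" unfolding A(4) B(4) by algebra
  finally have "\<bar>sd a - sd b\<bar> * (sd a + sd b) = \<bar>a - b\<bar> * \<bar>1 - a - b\<bar>"
    using A(3) B(3) by (metis abs_mult abs_of_pos add_pos_pos)
  also have "\<dots> \<le> \<bar>a - b\<bar> * 1" using A(5,6) B(5,6) by (intro mult_left_mono) auto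
  finally have "\<bar>sd a - sd b\<bar> * (sd a + sd b) \<le> \<bar>a - b\<bar>" by simp
  moreover have "\<bar>sd a - sd b\<bar> * (2 * \<delta>) \<le> \<bar>sd a - sd b\<bar> * (sd a + sd b)"
    using A(1) B(1) by (intro mult_left_mono) auto
  ultimately show ?thesis using assms(1) by (simp add: field_simps)
qed

lemma inverse_sd_lipschitz:
  assumes "0 < \<delta>" "\<delta> \<le> a" "a \<le> 1 - \<delta>" "\<delta> \<le> b" "b \<le> 1 - \<delta>"
  shows "\<bar>1 / sd a - 1 / sd b\<bar> \<le> \<bar>a - b\<bar> / (2 * \<delta>^3)"
proof -
  note A = sd_bounds[OF assms(1-3)] and B = sd_bounds[OF assms(1,4,5)]
  have "\<bar>1 / sd a - 1 / sd b\<bar> = \<bar>sd a - sd b\<bar> / (sd a * sd b)"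
    using A(3) B(3) by (simp add: diff_frac_eq abs_minus_commute abs_mult)
  also have "\<dots> \<le> (\<bar>a - b\<bar> / (2 * \<delta>)) / (\<delta> * \<delta>)"
    using A B assms(1) by (intro frac_le sd_lipschitz[OF assms] mult_mono mult_pos_pos) auto
  finally show ?thesis by (simp add: power3_eq_cube mult_ac)
qed

text \<open>Written as quotients with denominators sd (m + h) + sd m and sd (m - h) + sd m, the two
  one-sided differences have opposite first-order parts h (1 - 2 m). These cancel up to the
  difference of the reciprocals, which is itself O(h).\<close>

lemma sd_second_difference:
  assumes "0 < \<delta>" "\<delta> \<le> m - h" "m + h \<le> 1 - \<delta>" "0 \<le> h"
  shows "\<bar>sd (m + h) + sd (m - h) - 2 * sd m\<bar> \<le> h^2 * (1 / (4 * \<delta>^3) + 1 / \<delta>)"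
proof -
  define p q r where "p = sd (m + h)" and "q = sd (m - h)" and "r = sd m"
  have pb: "\<delta> \<le> p" "0 < p" "p^2 = (m + h) * (1 - (m + h))" unfolding p_def using sd_bounds[of \<delta> "m + h"] assms by auto
  have qb: "\<delta> \<le> q" "0 < q" "q^2 = (m - h) * (1 - (m - h))" unfolding q_def using sd_bounds[of \<delta> "m - h"] assms by auto
  have rb: "\<delta> \<le> r" "0 < r" "r^2 = m * (1 - m)" "0 < m" "m < 1" unfolding r_def using sd_bounds[of \<delta> m] assms by auto
  have d0: "p + r \<noteq> 0" "q + r \<noteq> 0" using pb qb rb by auto
  have "(p - r) * (p + r) = h * (1 - 2*m) - h^2" using pb(3) rb(3) by algebra
  then have e1: "p - r = (h * (1 - 2*m) - h^2) / (p + r)" using d0 by (simp add: field_simps)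
  have "(q - r) * (q + r) = - (h * (1 - 2*m)) - h^2" using qb(3) rb(3) by algebra
  then have e2: "q - r = (- (h * (1 - 2*m)) - h^2) / (q + r)" using d0 by (simp add: field_simps)
  have "p + q - 2 * r = (p - r) + (q - r)" by simp
  also have "\<dots> = h * (1 - 2*m) * (1 / (p + r) - 1 / (q + r)) - h^2 * (1 / (p + r) + 1 / (q + r))"
  proof -
    define i j where "i = 1 / (p + r)" and "j = 1 / (q + r)"
    have "p - r = (h * (1 - 2*m) - h^2) * i" "q - r = (- (h * (1 - 2*m)) - h^2) * j"
      unfolding i_def j_def e1 e2 by simp_all
    then show ?thesis unfolding i_def[symmetric] j_def[symmetric] by algebra
  qed
  also have "1 / (p + r) - 1 / (q + r) = (q - p) / ((p + r) * (q + r))" using d0 by (simp add: diff_frac_eq)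
  finally have eq: "p + q - 2 * r = h * (1 - 2*m) * ((q - p) / ((p + r) * (q + r))) - h^2 * (1 / (p + r) + 1 / (q + r))" .
  have "\<bar>(m - h) - (m + h)\<bar> = 2 * h" using assms(4) by simp
  then have qp: "\<bar>q - p\<bar> \<le> h / \<delta>"
    unfolding q_def p_def using sd_lipschitz[of \<delta> "m - h" "m + h"] assms by simp
  have "\<bar>h * (1 - 2*m) * ((q - p) / ((p + r) * (q + r)))\<bar> = (h * \<bar>1 - 2*m\<bar>) * (\<bar>q - p\<bar> / ((p + r) * (q + r)))"
    using assms(4) pb qb rb by (simp add: abs_mult)
  also have "\<dots> \<le> (h * 1) * ((h / \<delta>) / ((2 * \<delta>) * (2 * \<delta>)))"
    using assms pb qb rb qp by (intro mult_mono frac_le mult_pos_pos) auto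
  finally have 1: "\<bar>h * (1 - 2*m) * ((q - p) / ((p + r) * (q + r)))\<bar> \<le> h^2 * (1 / (4 * \<delta>^3))"
    by (simp add: power2_eq_square power3_eq_cube mult_ac)
  have "1 / (p + r) \<le> 1 / (2 * \<delta>)" "1 / (q + r) \<le> 1 / (2 * \<delta>)"
    using assms pb qb rb by (auto intro!: divide_left_mono mult_pos_pos)
  moreover have "0 \<le> 1 / (p + r)" "0 \<le> 1 / (q + r)" using pb qb rb by auto
  ultimately have "\<bar>1 / (p + r) + 1 / (q + r)\<bar> \<le> 1 / \<delta>" by (simp add: field_simps)
  then have 2: "\<bar>h^2 * (1 / (p + r) + 1 / (q + r))\<bar> \<le> h^2 * (1 / \<delta>)"
    unfolding abs_mult by (intro mult_mono) auto
  show ?thesis using 1 2 unfolding p_def[symmetric] q_def[symmetric] r_def[symmetric] eq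
    by (simp only: distrib_left)
qed

text \<open>Since (1 - 2 \<mu>)^2 = 1 - 4 (sd \<mu>)^2, the third-order coefficient depends on \<mu>
  only through \<open>sd \<mu>\<close> and its reciprocal, so its variation is controlled by the two
  Lipschitz bounds.\<close>

lemma sd_mult_coeffs:
  assumes "0 < \<delta>" "\<delta> \<le> \<mu>" "\<mu> \<le> 1 - \<delta>"
  shows "sd \<mu> * k3 \<mu> = (1 - 2 * \<mu>) / 3"
    and "sd \<mu> * (cub \<mu> * z^3 + lin \<mu> * z) = (z^3 / 36 + 11 / 36 * z) * (1 / sd \<mu>) - (13 / 36 * z^3 + 71 / 36 * z) * sd \<mu>"
proof -
  note S = sd_bounds[OF assms]
  define s where "s = sd \<mu>"
  have s: "0 < s" "s^2 = \<mu> * (1 - \<mu>)" using S unfolding s_def by auto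
  show "sd \<mu> * k3 \<mu> = (1 - 2 * \<mu>) / 3" unfolding k3_def using S by simp
  have "(1 - 2 * \<mu>)^2 = 1 - 4 * s^2" unfolding s(2) by algebra
  then have 1: "(k3 \<mu>)^2 = (1 - 4 * s^2) / (9 * s^2)"
    unfolding k3_def s_def[symmetric] by (simp add: power_divide power_mult_distrib)
  define i where "i = 1 / s"
  have 3: "s * (k3 \<mu>)^2 = i / 9 - 4 / 9 * s" and 4: "s * k4 \<mu> = i / 4 - 3 / 4 * s"
    unfolding 1 unfolding k4_def s_def[symmetric] i_def using s(1) by (simp_all add: field_simps power2_eq_square)
  have "sd \<mu> * (cub \<mu> * z^3 + lin \<mu> * z)
      = (5 / 2 * (s * (k3 \<mu>)^2) - s * k4 \<mu>) * (z^3 + 3 * z) + 2 * (s * (k3 \<mu>)^2) * z"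
    unfolding cub_def lin_def s_def[symmetric] by algebra
  also have "\<dots> = (z^3 / 36 + 11 / 36 * z) * i - (13 / 36 * z^3 + 71 / 36 * z) * s"
    unfolding 3 4 by (simp add: field_simps)
  finally show "sd \<mu> * (cub \<mu> * z^3 + lin \<mu> * z) = (z^3 / 36 + 11 / 36 * z) * (1 / sd \<mu>) - (13 / 36 * z^3 + 71 / 36 * z) * sd \<mu>"
    unfolding s_def i_def .
qed

lemma cf_quantile_expand:
  "cf_quantile \<mu> \<epsilon> z = \<mu> + \<epsilon> * (z * sd \<mu>) + \<epsilon>^2 * ((sd \<mu> * k3 \<mu>) * (z^2 + 2)) + \<epsilon>^3 * (sd \<mu> * (cub \<mu> * z^3 + lin \<mu> * z))"
  unfolding cf_quantile_def cf_scaled_def by algebra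

text \<open>The centre and the term of order \<epsilon>^2 are even in z and drop out; only the odd
  orders remain.\<close>

lemma cf_width:
  assumes \<delta>: "0 < \<delta>"
  obtains C where "0 < C" "\<And>\<mu> \<epsilon>. \<delta> \<le> \<mu> \<Longrightarrow> \<mu> \<le> 1 - \<delta> \<Longrightarrow> 0 < \<epsilon> \<Longrightarrow> \<epsilon> \<le> 1 \<Longrightarrow>
    \<bar>cf_quantile \<mu> \<epsilon> z - cf_quantile \<mu> \<epsilon> (- z) - 2 * z * (sd \<mu> * \<epsilon>)\<bar> \<le> C * \<epsilon>^3"
proof -
  have "poly_bounded \<delta> (\<lambda>\<mu> \<epsilon> w. 2 * (sd \<mu> * (cub \<mu> * z^3 + lin \<mu> * z)))"
    by (intro poly_bounded_intros poly_bounded_coeffs \<delta>)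
  then obtain C k where C: "C > 0" "\<And>\<mu> (\<epsilon>::real) w. \<delta> \<le> \<mu> \<Longrightarrow> \<mu> \<le> 1 - \<delta> \<Longrightarrow> 0 < \<epsilon> \<Longrightarrow> \<epsilon> \<le> 1 \<Longrightarrow>
      \<bar>2 * (sd \<mu> * (cub \<mu> * z^3 + lin \<mu> * z))\<bar> \<le> C * (1 + \<bar>w\<bar>) ^ k"
    by (rule poly_boundedE) blast
  show ?thesis
  proof (rule that[OF C(1)])
    fix \<mu> \<epsilon> :: real assume a: "\<delta> \<le> \<mu>" "\<mu> \<le> 1 - \<delta>" "0 < \<epsilon>" "\<epsilon> \<le> 1"
    have "cf_quantile \<mu> \<epsilon> z - cf_quantile \<mu> \<epsilon> (- z) - 2 * z * (sd \<mu> * \<epsilon>)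
        = \<epsilon>^3 * (2 * (sd \<mu> * (cub \<mu> * z^3 + lin \<mu> * z)))"
      unfolding cf_quantile_expand by (simp add: algebra_simps)
    then have "\<bar>cf_quantile \<mu> \<epsilon> z - cf_quantile \<mu> \<epsilon> (- z) - 2 * z * (sd \<mu> * \<epsilon>)\<bar>
        = \<epsilon>^3 * \<bar>2 * (sd \<mu> * (cub \<mu> * z^3 + lin \<mu> * z))\<bar>" using a by (simp add: abs_mult)
    also have "\<dots> \<le> \<epsilon>^3 * C" using C(2)[OF a, of 0] a by (intro mult_left_mono) auto
    finally show "\<bar>cf_quantile \<mu> \<epsilon> z - cf_quantile \<mu> \<epsilon> (- z) - 2 * z * (sd \<mu> * \<epsilon>)\<bar> \<le> C * \<epsilon>^3"
      by (simp add: mult.commute)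
  qed
qed

text \<open>With h = \<epsilon>^2 / 2, the centres contribute 2 h = \<epsilon>^2. The first-order
  terms give \<epsilon> z times a second difference of \<open>sd\<close>, which is O(\<epsilon>
  h^2). The second-order terms are linear in the mode and give - 4 h \<epsilon>^2 (z^2 + 2) / 3, of
  exact order \<epsilon>^4. The third-order terms change by O(\<epsilon>^3 h). \<open>C1\<close>,
  \<open>C2\<close> and \<open>C3\<close> belong to the last three in this order.\<close>

lemma cf_width_shift:
  assumes \<delta>: "0 < \<delta>"
  obtains C where "0 < C" "\<And>\<mu> \<epsilon>. \<delta> \<le> \<mu> - \<epsilon>^2 / 2 \<Longrightarrow> \<mu> + \<epsilon>^2 / 2 \<le> 1 - \<delta> \<Longrightarrow> 0 < \<epsilon> \<Longrightarrow> \<epsilon> \<le> 1 \<Longrightarrow>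
    \<bar>(cf_quantile (\<mu> + \<epsilon>^2 / 2) \<epsilon> z - cf_quantile (\<mu> - \<epsilon>^2 / 2) \<epsilon> (- z))
       - (cf_quantile \<mu> \<epsilon> z - cf_quantile \<mu> \<epsilon> (- z)) - \<epsilon>^2\<bar> \<le> C * \<epsilon>^4"
proof -
  define A where "A = z^3 / 36 + 11 / 36 * z"
  define B where "B = 13 / 36 * z^3 + 71 / 36 * z"
  define C1 where "C1 = \<bar>z\<bar> * (1 / (4 * \<delta>^3) + 1 / \<delta>)"
  define C2 where "C2 = 2 * (z^2 + 2) / 3"
  define C3 where "C3 = \<bar>A\<bar> / (2 * \<delta>^3) + \<bar>B\<bar> / (2 * \<delta>)"
  have nn: "0 \<le> C1" "0 \<le> C2" "0 \<le> C3" unfolding C1_def C2_def C3_def using \<delta> by auto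
  show ?thesis
  proof (rule that[of "C1 + C2 + C3 + 1"])
    show "0 < C1 + C2 + C3 + 1" using nn by simp
    fix \<mu> \<epsilon> :: real
    assume a: "\<delta> \<le> \<mu> - \<epsilon>^2 / 2" "\<mu> + \<epsilon>^2 / 2 \<le> 1 - \<delta>" "0 < \<epsilon>" "\<epsilon> \<le> 1"
    define h where "h = \<epsilon>^2 / 2"
    have h: "0 \<le> h" "\<epsilon>^2 = 2 * h" unfolding h_def by auto
    have r: "\<delta> \<le> \<mu> + h" "\<mu> + h \<le> 1 - \<delta>" "\<delta> \<le> \<mu> - h" "\<mu> - h \<le> 1 - \<delta>" "\<delta> \<le> \<mu>" "\<mu> \<le> 1 - \<delta>"
      using a(1,2) h(1) unfolding h_def[symmetric] by auto
    define G where "G = (\<lambda>\<mu>. A * (1 / sd \<mu>) - B * sd \<mu>)"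
    have ex: "cf_quantile m \<epsilon> y = m + \<epsilon> * (y * sd m) + \<epsilon>^2 * ((1 - 2 * m) / 3 * (y^2 + 2)) + \<epsilon>^3 * (sd m * (cub m * y^3 + lin m * y))"
      if "\<delta> \<le> m" "m \<le> 1 - \<delta>" for m y
      unfolding cf_quantile_expand sd_mult_coeffs(1)[OF \<delta> that] ..
    have g1: "sd m * (cub m * z^3 + lin m * z) = G m" if "\<delta> \<le> m" "m \<le> 1 - \<delta>" for m
      unfolding G_def A_def B_def by (rule sd_mult_coeffs(2)[OF \<delta> that])
    have g2: "sd m * (cub m * (- z)^3 + lin m * (- z)) = - G m" if "\<delta> \<le> m" "m \<le> 1 - \<delta>" for m
      unfolding g1[OF that, symmetric] by (simp add: algebra_simps)
    have G: "\<bar>G m - G \<mu>\<bar> \<le> h * C3" if "\<delta> \<le> m" "m \<le> 1 - \<delta>" "\<bar>m - \<mu>\<bar> = h" for m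
    proof -
      have "G m - G \<mu> = A * (1 / sd m - 1 / sd \<mu>) - B * (sd m - sd \<mu>)" unfolding G_def by algebra
      then have "\<bar>G m - G \<mu>\<bar> \<le> \<bar>A\<bar> * \<bar>1 / sd m - 1 / sd \<mu>\<bar> + \<bar>B\<bar> * \<bar>sd m - sd \<mu>\<bar>"
        by (metis abs_mult abs_triangle_ineq4)
      also have "\<dots> \<le> \<bar>A\<bar> * (h / (2 * \<delta>^3)) + \<bar>B\<bar> * (h / (2 * \<delta>))"
        using sd_lipschitz[OF \<delta> that(1,2) r(5,6)] inverse_sd_lipschitz[OF \<delta> that(1,2) r(5,6)] that(3)
        by (intro add_mono mult_left_mono) auto
      also have "\<dots> = h * C3" unfolding C3_def by (simp add: algebra_simps)
      finally show ?thesis .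
    qed
    define Q where "Q = (cf_quantile (\<mu> + h) \<epsilon> z - cf_quantile (\<mu> - h) \<epsilon> (- z))
       - (cf_quantile \<mu> \<epsilon> z - cf_quantile \<mu> \<epsilon> (- z)) - \<epsilon>^2"
    define D where "D = sd (\<mu> + h) + sd (\<mu> - h) - 2 * sd \<mu>"
    have "Q = \<epsilon> * z * D - \<epsilon>^2 * (4 * h / 3 * (z^2 + 2)) + \<epsilon>^3 * ((G (\<mu> + h) - G \<mu>) + (G (\<mu> - h) - G \<mu>))"
      unfolding Q_def D_def ex[OF r(1,2)] ex[OF r(3,4)] ex[OF r(5,6)] g1[OF r(1,2)] g1[OF r(3,4)] g1[OF r(5,6)]
        g2[OF r(1,2)] g2[OF r(3,4)] g2[OF r(5,6)] power2_minus
      unfolding h(2) by (simp add: field_simps)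
    then have "\<bar>Q\<bar> \<le> \<bar>\<epsilon> * z * D\<bar> + \<bar>\<epsilon>^2 * (4 * h / 3 * (z^2 + 2))\<bar> + \<bar>\<epsilon>^3 * ((G (\<mu> + h) - G \<mu>) + (G (\<mu> - h) - G \<mu>))\<bar>"
      by linarith
    also have "\<dots> \<le> C1 * \<epsilon>^4 + C2 * \<epsilon>^4 + C3 * \<epsilon>^4"
    proof (intro add_mono)
      have e5: "\<epsilon>^5 \<le> \<epsilon>^4" using a power_decreasing[of 4 5 \<epsilon>] by simp
      have "\<bar>\<epsilon> * z * D\<bar> = \<epsilon> * \<bar>z\<bar> * \<bar>D\<bar>" using a by (simp add: abs_mult)
      also have "\<dots> \<le> \<epsilon> * \<bar>z\<bar> * (h^2 * (1 / (4 * \<delta>^3) + 1 / \<delta>))"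
        using sd_second_difference[OF \<delta> r(3) r(2) h(1)] a unfolding D_def by (intro mult_left_mono) auto
      also have "\<dots> = (\<epsilon> * h^2) * C1" unfolding C1_def by simp
      also have "\<epsilon> * h^2 = \<epsilon>^5 / 4" unfolding h_def by (simp add: power_numeral_reduce)
      also have "\<epsilon>^5 / 4 * C1 \<le> \<epsilon>^4 * C1"
      proof (rule mult_right_mono[OF _ nn(1)])
        have "0 \<le> \<epsilon>^5" using a by simp
        then show "\<epsilon>^5 / 4 \<le> \<epsilon>^4" using e5 by linarith
      qed
      finally show "\<bar>\<epsilon> * z * D\<bar> \<le> C1 * \<epsilon>^4" by (simp add: mult.commute)
      have "0 \<le> z^2" by simp
      then have "\<bar>\<epsilon>^2 * (4 * h / 3 * (z^2 + 2))\<bar> = \<epsilon>^2 * (4 * h / 3 * (z^2 + 2))" using h(1) by (simp add: abs_mult)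
      also have "\<dots> = C2 * \<epsilon>^4" unfolding C2_def h_def by algebra
      finally show "\<bar>\<epsilon>^2 * (4 * h / 3 * (z^2 + 2))\<bar> \<le> C2 * \<epsilon>^4" by simp
      have "\<bar>(G (\<mu> + h) - G \<mu>) + (G (\<mu> - h) - G \<mu>)\<bar> \<le> h * C3 + h * C3"
      proof -
        have "\<bar>(\<mu> + h) - \<mu>\<bar> = h" "\<bar>(\<mu> - h) - \<mu>\<bar> = h" using h(1) by auto
        then show ?thesis using G[OF r(1,2)] G[OF r(3,4)] by linarith
      qed
      then have "\<bar>\<epsilon>^3 * ((G (\<mu> + h) - G \<mu>) + (G (\<mu> - h) - G \<mu>))\<bar> \<le> \<epsilon>^3 * (h * C3 + h * C3)"
        unfolding abs_mult using a by (intro mult_mono) auto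
      also have "\<dots> = \<epsilon>^5 * C3" using h(2) by algebra
      also have "\<dots> \<le> \<epsilon>^4 * C3" using e5 nn by (intro mult_right_mono)
      finally show "\<bar>\<epsilon>^3 * ((G (\<mu> + h) - G \<mu>) + (G (\<mu> - h) - G \<mu>))\<bar> \<le> C3 * \<epsilon>^4" by (simp add: mult.commute)
    qed
    also have "\<dots> \<le> (C1 + C2 + C3 + 1) * \<epsilon>^4" using a by (simp add: algebra_simps)
    finally show "\<bar>(cf_quantile (\<mu> + \<epsilon>^2 / 2) \<epsilon> z - cf_quantile (\<mu> - \<epsilon>^2 / 2) \<epsilon> (- z))
       - (cf_quantile \<mu> \<epsilon> z - cf_quantile \<mu> \<epsilon> (- z)) - \<epsilon>^2\<bar> \<le> (C1 + C2 + C3 + 1) * \<epsilon>^4"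
      unfolding Q_def h_def .
  qed
qed

lemma powr_neg_3_2: "0 < x \<Longrightarrow> x powr (- (3 / 2)) = 1 / (sqrt x)^3"
proof -
  assume x: "0 < x"
  have "x powr (3 / 2) = (x powr (1 / 2)) powr 3" by (simp add: powr_powr)
  also have "\<dots> = (sqrt x)^3" using x by (simp add: powr_half_sqrt flip: powr_numeral)
  finally show ?thesis by (simp add: powr_minus_divide)
qed

lemma powr_neg_2: "0 < (x::real) \<Longrightarrow> x powr (- 2) = 1 / x^2"
  by (simp add: powr_minus_divide)

text \<open>The modes of all beta distributions involved, and the centre of the Agresti-Coull
  interval, have the form (X + c) / (n + d).\<close>

lemma shifted_proportion:
  fixes \<delta> c d :: real
  assumes \<delta>: "0 < \<delta>"
  shows "\<forall>\<^sub>F n in sequentially. 1 \<le> n \<and> real n / 2 \<le> real n + d \<and> (\<forall>X. \<delta> * real n \<le> real X \<longrightarrow> real X \<le> (1 - \<delta>) * real n \<longrightarrow>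
     0 < X \<and> X < n \<and> \<delta> / 2 \<le> (real X + c) / (real n + d) \<and> (real X + c) / (real n + d) \<le> 1 - \<delta> / 2 \<and>
     \<bar>(real X + c) / (real n + d) - real X / real n\<bar> \<le> 2 * (\<bar>c\<bar> + \<bar>d\<bar>) / real n)"
proof -
  \<comment> \<open>The first summand keeps the shift of the proportion within \<delta> / 2, the
    second keeps n + d above n / 2.\<close>
  define N where "N = 4 * (\<bar>c\<bar> + \<bar>d\<bar>) / \<delta> + 2 * \<bar>d\<bar> + 1"
  have "\<forall>\<^sub>F n in sequentially. N \<le> real n"
    using filterlim_real_sequentially unfolding filterlim_at_top by blast
  then show ?thesis
  proof eventually_elim
    case (elim n)
    have n1: "1 \<le> real n" "2 * \<bar>d\<bar> \<le> real n" "4 * (\<bar>c\<bar> + \<bar>d\<bar>) / \<delta> \<le> real n"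
    proof -
      have "0 \<le> 4 * (\<bar>c\<bar> + \<bar>d\<bar>) / \<delta>" using \<delta> by auto
      then show "1 \<le> real n" "2 * \<bar>d\<bar> \<le> real n" "4 * (\<bar>c\<bar> + \<bar>d\<bar>) / \<delta> \<le> real n"
        using elim unfolding N_def by linarith+
    qed
    have M: "real n / 2 \<le> real n + d" using n1 by linarith
    then have Mp: "0 < real n + d" using n1 by linarith
    show ?case
    proof (intro conjI allI impI)
      show "1 \<le> n" using n1 by simp
      show "real n / 2 \<le> real n + d" by (rule M)
      fix X assume X: "\<delta> * real n \<le> real X" "real X \<le> (1 - \<delta>) * real n"
      have "0 < \<delta> * real n" using \<delta> n1 by simp
      then have "0 < real X" using X by linarith
      then show "0 < X" by simp
      have "real X \<le> real n - \<delta> * real n" using X(2) by (simp add: algebra_simps)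
      then have "real X < real n" using \<open>0 < \<delta> * real n\<close> by linarith
      then show "X < n" by simp
      have "(real X + c) / (real n + d) - real X / real n = (c * real n - d * real X) / ((real n + d) * real n)"
        using Mp n1 by (simp add: field_simps)
      also have "\<bar>\<dots>\<bar> \<le> ((\<bar>c\<bar> + \<bar>d\<bar>) * real n) / (real n / 2 * real n)"
        unfolding abs_divide
      proof (rule frac_le)
        have "\<bar>d * real X\<bar> \<le> \<bar>d\<bar> * real n" unfolding abs_mult using \<open>real X < real n\<close> by (intro mult_left_mono) auto
        moreover have "\<bar>c * real n\<bar> = \<bar>c\<bar> * real n" by (simp add: abs_mult)
        ultimately show "\<bar>c * real n - d * real X\<bar> \<le> (\<bar>c\<bar> + \<bar>d\<bar>) * real n"
          by (simp only: distrib_right)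
        show "real n / 2 * real n \<le> \<bar>(real n + d) * real n\<bar>"
          using M Mp n1 by (simp add: abs_mult)
      qed (use n1 in auto)
      also have "\<dots> = 2 * (\<bar>c\<bar> + \<bar>d\<bar>) / real n" using n1 by simp
      finally show b: "\<bar>(real X + c) / (real n + d) - real X / real n\<bar> \<le> 2 * (\<bar>c\<bar> + \<bar>d\<bar>) / real n" .
      have "2 * (\<bar>c\<bar> + \<bar>d\<bar>) / real n \<le> \<delta> / 2"
        using n1 \<delta> by (simp add: field_simps)
      moreover have "\<delta> \<le> real X / real n" "real X / real n \<le> 1 - \<delta>" using X n1 by (auto simp: field_simps)
      ultimately show "\<delta> / 2 \<le> (real X + c) / (real n + d)" "(real X + c) / (real n + d) \<le> 1 - \<delta> / 2"
        using b by linarith+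
    qed
  qed
qed

text \<open>Two changes are made in turn. The proportion moves by O(1 / n), which is multiplied by 1
  / sqrt (n + d); then sqrt (n + d) becomes sqrt n, where the difference of the roots is d divided
  by their sum. Each costs O(n^(-3/2)).\<close>

lemma sd_shifted:
  fixes \<delta> c d :: real
  assumes \<delta>: "0 < \<delta>"
  shows "central_bigo \<delta> (3 / 2) (\<lambda>n X. sd ((real X + c) / (real n + d)) / sqrt (real n + d) - sd (real X / real n) / sqrt (real n))"
proof (rule central_bigoI[where C="4 * (\<bar>c\<bar> + \<bar>d\<bar>) / \<delta> + 2 * \<bar>d\<bar>"])
  show "\<forall>\<^sub>F n in sequentially. \<forall>X. \<delta> * real n \<le> real X \<longrightarrow> real X \<le> (1 - \<delta>) * real n \<longrightarrow>
     \<bar>sd ((real X + c) / (real n + d)) / sqrt (real n + d) - sd (real X / real n) / sqrt (real n)\<bar>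
       \<le> (4 * (\<bar>c\<bar> + \<bar>d\<bar>) / \<delta> + 2 * \<bar>d\<bar>) * real n powr (- (3 / 2))"
    using shifted_proportion[OF \<delta>, of d c]
  proof eventually_elim
    case (elim n)
    show ?case
    proof (intro allI impI)
      fix X assume X: "\<delta> * real n \<le> real X" "real X \<le> (1 - \<delta>) * real n"
      define x where "x = real X / real n"
      define y where "y = (real X + c) / (real n + d)"
      define s where "s = sqrt (real n)"
      define t where "t = sqrt (real n + d)"
      have n: "1 \<le> real n" "real n / 2 \<le> real n + d" using elim by auto
      have y: "\<delta> / 2 \<le> y" "y \<le> 1 - \<delta> / 2" "\<bar>y - x\<bar> \<le> 2 * (\<bar>c\<bar> + \<bar>d\<bar>) / real n"
        using elim X unfolding x_def y_def by auto
      have x': "\<delta> \<le> x" "x \<le> 1 - \<delta>"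
        using X n unfolding x_def by (auto simp: field_simps)
      have x: "\<delta> / 2 \<le> x" "x \<le> 1 - \<delta> / 2" "\<delta> \<le> x" "x \<le> 1 - \<delta>"
        using x' \<delta> by linarith+
      have s: "0 < s" "s^2 = real n" and t: "0 < t" "t^2 = real n + d" unfolding s_def t_def using n by auto
      have "s / 2 \<le> t"
      proof -
        have "(s / 2)^2 \<le> t^2" unfolding power_divide s(2) t(2) using n by simp
        then show ?thesis by (rule power2_le_imp_le[OF _ less_imp_le[OF t(1)]])
      qed
      then have it: "1 / t \<le> 2 / s" using s(1) t(1) by (simp add: field_simps)
      have 1: "\<bar>sd y / t - sd x / t\<bar> \<le> 4 * (\<bar>c\<bar> + \<bar>d\<bar>) / \<delta> * (1 / s^3)"
      proof -
        have "\<bar>sd y / t - sd x / t\<bar> = \<bar>sd y - sd x\<bar> * (1 / t)"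
          using t(1) by (simp flip: diff_divide_distrib add: abs_divide)
        also have "\<dots> \<le> ((2 * (\<bar>c\<bar> + \<bar>d\<bar>) / real n) / \<delta>) * (2 / s)"
        proof (rule mult_mono)
          have "\<bar>sd y - sd x\<bar> \<le> \<bar>y - x\<bar> / (2 * (\<delta> / 2))" using \<delta> x y by (intro sd_lipschitz) auto
          also have "\<dots> = \<bar>y - x\<bar> / \<delta>" by simp
          also have "\<dots> \<le> (2 * (\<bar>c\<bar> + \<bar>d\<bar>) / real n) / \<delta>" using y \<delta> by (intro divide_right_mono) auto
          finally show "\<bar>sd y - sd x\<bar> \<le> (2 * (\<bar>c\<bar> + \<bar>d\<bar>) / real n) / \<delta>" .
        qed (use it t n \<delta> in auto)
        also have "\<dots> = 4 * (\<bar>c\<bar> + \<bar>d\<bar>) / \<delta> * (1 / s^3)"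
          unfolding s(2)[symmetric] using s(1) \<delta> by (simp add: power2_eq_square power3_eq_cube)
        finally show ?thesis .
      qed
      have 2: "\<bar>sd x / t - sd x / s\<bar> \<le> 2 * \<bar>d\<bar> * (1 / s^3)"
      proof -
        have "sd x / t - sd x / s = sd x * ((s - t) / (t * s))" using s(1) t(1) by (simp add: field_simps)
        also have "s - t = (s^2 - t^2) / (s + t)" using s(1) t(1) by (simp add: field_simps power2_eq_square)
        also have "s^2 - t^2 = - d" using s t by simp
        finally have "sd x / t - sd x / s = sd x * ((- d / (s + t)) / (t * s))" .
        then have "\<bar>sd x / t - sd x / s\<bar> = sd x * (\<bar>d\<bar> / (s + t) / (t * s))"
          using s(1) t(1) sd_bounds[OF \<delta> x(3,4)] by (simp add: abs_mult abs_divide)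
        also have "\<dots> \<le> 1 * (\<bar>d\<bar> / s / (s / 2 * s))"
          using s(1) t(1) \<open>s / 2 \<le> t\<close> sd_bounds[OF \<delta> x(3,4)]
          by (intro mult_mono frac_le mult_pos_pos) auto
        also have "\<dots> = 2 * \<bar>d\<bar> * (1 / s^3)" using s(1) by (simp add: power3_eq_cube mult_ac)
        finally show ?thesis .
      qed
      have p: "real n powr (- (3 / 2)) = 1 / s^3" unfolding s_def using n by (intro powr_neg_3_2) auto
      show "\<bar>sd ((real X + c) / (real n + d)) / sqrt (real n + d) - sd (real X / real n) / sqrt (real n)\<bar>
       \<le> (4 * (\<bar>c\<bar> + \<bar>d\<bar>) / \<delta> + 2 * \<bar>d\<bar>) * real n powr (- (3 / 2))"
        unfolding p x_def[symmetric] y_def[symmetric] s_def[symmetric] t_def[symmetric] distrib_right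
        using 1 2 by linarith
    qed
  qed
qed

text \<open>The parameters X + a and n - X + b are reached with c = a - 1 and d = a + b - 2; then M
  = n + d and the mode is (X + c) / M.\<close>

lemma beta_quantile_central:
  fixes \<delta> c d z :: real
  assumes \<delta>: "0 < \<delta>"
  shows "central_bigo \<delta> 2 (\<lambda>n X. beta_quantile (Phi z) (real X + c + 1) (real n - real X + (d - c) + 1)
     - cf_quantile ((real X + c) / (real n + d)) (1 / sqrt (real n + d)) z)"
proof -
  obtain C M0 where C: "0 < C" "1 \<le> M0" and q:
    "\<And>M \<mu>. M0 \<le> M \<Longrightarrow> \<delta> / 2 \<le> \<mu> \<Longrightarrow> \<mu> \<le> 1 - \<delta> / 2 \<Longrightarrow>
       \<bar>beta_quantile (Phi z) (M * \<mu> + 1) (M * (1 - \<mu>) + 1) - cf_quantile \<mu> (1 / sqrt M) z\<bar> \<le> C / M^2"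
    using beta_quantile_expansion[of "\<delta> / 2" z] \<delta> by (metis half_gt_zero)
  have N: "\<forall>\<^sub>F n in sequentially. 2 * M0 \<le> real n"
    using filterlim_real_sequentially unfolding filterlim_at_top by blast
  show ?thesis
  proof (rule central_bigoI[where C="4 * C"])
    show "\<forall>\<^sub>F n in sequentially. \<forall>X. \<delta> * real n \<le> real X \<longrightarrow> real X \<le> (1 - \<delta>) * real n \<longrightarrow>
       \<bar>beta_quantile (Phi z) (real X + c + 1) (real n - real X + (d - c) + 1)
        - cf_quantile ((real X + c) / (real n + d)) (1 / sqrt (real n + d)) z\<bar> \<le> 4 * C * real n powr (- 2)"
      using shifted_proportion[OF \<delta>, of d c] N
    proof eventually_elim
      case (elim n)
      show ?case
      proof (intro allI impI)
        fix X assume X: "\<delta> * real n \<le> real X" "real X \<le> (1 - \<delta>) * real n"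
        define M where "M = real n + d"
        define \<mu> where "\<mu> = (real X + c) / M"
        have n: "1 \<le> real n" "real n / 2 \<le> M" using elim unfolding M_def by auto
        have \<mu>: "\<delta> / 2 \<le> \<mu>" "\<mu> \<le> 1 - \<delta> / 2" using elim X unfolding \<mu>_def M_def by auto
        have M: "0 < M" "M0 \<le> M" using n elim by auto
        have e: "real X + c + 1 = M * \<mu> + 1" "real n - real X + (d - c) + 1 = M * (1 - \<mu>) + 1"
          using M(1) unfolding \<mu>_def by (auto simp: right_diff_distrib) (simp add: M_def)
        have "C / M^2 \<le> C / (real n / 2)^2" using C(1) n M by (intro divide_left_mono power_mono mult_pos_pos) auto
        also have "\<dots> = 4 * C * real n powr (- 2)" using n by (simp add: powr_neg_2 power_divide)
        finally show "\<bar>beta_quantile (Phi z) (real X + c + 1) (real n - real X + (d - c) + 1)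
        - cf_quantile ((real X + c) / (real n + d)) (1 / sqrt (real n + d)) z\<bar> \<le> 4 * C * real n powr (- 2)"
          using q[OF M(2) \<mu>] unfolding e M_def[symmetric] \<mu>_def[symmetric] by linarith
      qed
    qed
  qed
qed

subsection \<open>Interval lengths and expectations\<close>

lemma inverse_sqrt_shift_le:
  assumes "0 < x" "x / 2 \<le> y"
  shows "1 / sqrt y \<le> 2 * (1 / sqrt x)"
proof -
  have "sqrt (x / 4) \<le> sqrt y" using assms by (intro real_sqrt_le_mono) auto
  then have "sqrt x / 2 \<le> sqrt y" by (simp add: real_sqrt_divide)
  moreover have "0 < sqrt x" "0 < sqrt y" using assms by auto
  ultimately show ?thesis by (simp add: field_simps)
qed

lemma cf_width_central:
  fixes \<delta> c d z :: real
  assumes \<delta>: "0 < \<delta>"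
  shows "central_bigo \<delta> (3 / 2) (\<lambda>n X. cf_quantile ((real X + c) / (real n + d)) (1 / sqrt (real n + d)) z
     - cf_quantile ((real X + c) / (real n + d)) (1 / sqrt (real n + d)) (- z)
     - 2 * z * (sd ((real X + c) / (real n + d)) / sqrt (real n + d)))"
proof -
  obtain C where C: "0 < C" and w: "\<And>\<mu> \<epsilon>. \<delta> / 2 \<le> \<mu> \<Longrightarrow> \<mu> \<le> 1 - \<delta> / 2 \<Longrightarrow> 0 < \<epsilon> \<Longrightarrow> \<epsilon> \<le> 1 \<Longrightarrow>
    \<bar>cf_quantile \<mu> \<epsilon> z - cf_quantile \<mu> \<epsilon> (- z) - 2 * z * (sd \<mu> * \<epsilon>)\<bar> \<le> C * \<epsilon>^3"
    using cf_width[of "\<delta> / 2" z] \<delta> by (metis half_gt_zero)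
  show ?thesis
  proof (rule central_bigoI[where C="8 * C"])
    show "\<forall>\<^sub>F n in sequentially. \<forall>X. \<delta> * real n \<le> real X \<longrightarrow> real X \<le> (1 - \<delta>) * real n \<longrightarrow>
       \<bar>cf_quantile ((real X + c) / (real n + d)) (1 / sqrt (real n + d)) z
     - cf_quantile ((real X + c) / (real n + d)) (1 / sqrt (real n + d)) (- z)
     - 2 * z * (sd ((real X + c) / (real n + d)) / sqrt (real n + d))\<bar> \<le> 8 * C * real n powr (- (3 / 2))"
      using shifted_proportion[OF \<delta>, of d c] eventually_ge_at_top[of 2]
    proof eventually_elim
      case (elim n)
      show ?case
      proof (intro allI impI)
        fix X assume X: "\<delta> * real n \<le> real X" "real X \<le> (1 - \<delta>) * real n"
        define M where "M = real n + d"
        define \<mu> where "\<mu> = (real X + c) / M"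
        define \<epsilon> where "\<epsilon> = 1 / sqrt M"
        have n: "2 \<le> real n" "real n / 2 \<le> M" using elim unfolding M_def by auto
        have \<mu>: "\<delta> / 2 \<le> \<mu>" "\<mu> \<le> 1 - \<delta> / 2" using elim X unfolding \<mu>_def M_def by auto
        have M: "1 \<le> M" using n by linarith
        have \<epsilon>: "0 < \<epsilon>" "\<epsilon> \<le> 1" unfolding \<epsilon>_def using M by auto
        have "\<epsilon> \<le> 2 * (1 / sqrt (real n))" unfolding \<epsilon>_def using n by (intro inverse_sqrt_shift_le) auto
        then have "\<epsilon>^3 \<le> (2 * (1 / sqrt (real n)))^3" using \<epsilon> by (intro power_mono) auto
        also have "\<dots> = 8 * real n powr (- (3 / 2))"
          using n powr_neg_3_2[of "real n"] by (simp add: power_divide)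
        finally have "C * \<epsilon>^3 \<le> C * (8 * real n powr (- (3 / 2)))" using C by (intro mult_left_mono) auto
        then have "\<bar>cf_quantile \<mu> \<epsilon> z - cf_quantile \<mu> \<epsilon> (- z) - 2 * z * (sd \<mu> * \<epsilon>)\<bar> \<le> 8 * C * real n powr (- (3 / 2))"
          using w[OF \<mu> \<epsilon>] by linarith
        moreover have "sd \<mu> * \<epsilon> = sd \<mu> / sqrt M" unfolding \<epsilon>_def by simp
        ultimately show "\<bar>cf_quantile ((real X + c) / (real n + d)) (1 / sqrt (real n + d)) z
     - cf_quantile ((real X + c) / (real n + d)) (1 / sqrt (real n + d)) (- z)
     - 2 * z * (sd ((real X + c) / (real n + d)) / sqrt (real n + d))\<bar> \<le> 8 * C * real n powr (- (3 / 2))"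
          unfolding \<mu>_def \<epsilon>_def M_def by simp
      qed
    qed
  qed
qed

text \<open>The common reference for all lengths, with the normal quantile as an argument in place
  of \<alpha>; \<open>sd (X / n) / sqrt n\<close> is the estimated standard error.\<close>

definition wald_length :: "real \<Rightarrow> nat \<Rightarrow> nat \<Rightarrow> real" where
  "wald_length z n X = 2 * z * (sd (real X / real n) / sqrt (real n))"

lemma interval_length_bayes:
  assumes "Phi z = 1 - \<alpha> / 2"
  shows "interval_length (bayes_interval a b \<alpha> n X)
    = beta_quantile (Phi z) (real X + (a - 1) + 1) (real n - real X + ((a + b - 2) - (a - 1)) + 1)
    - beta_quantile (Phi (- z)) (real X + (a - 1) + 1) (real n - real X + ((a + b - 2) - (a - 1)) + 1)"
proof -
  have z': "Phi (- z) = \<alpha> / 2" using Phi_minus[of z] assms by simp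
  show ?thesis unfolding interval_length_def bayes_interval_def z' assms by (simp add: algebra_simps)
qed

text \<open>Three replacements in succession: the quantiles by their expansions, the resulting width
  by its leading term, and the shifted proportion and sample size by X / n and n.\<close>

lemma bayes_length_central:
  assumes \<delta>: "0 < \<delta>" and z: "Phi z = 1 - \<alpha> / 2"
  shows "central_bigo \<delta> (3 / 2) (\<lambda>n X. interval_length (bayes_interval a b \<alpha> n X) - wald_length z n X)"
proof -
  define c d where "c = a - 1" and "d = a + b - 2"
  have 1: "central_bigo \<delta> (3 / 2) (\<lambda>n X. beta_quantile (Phi y) (real X + c + 1) (real n - real X + (d - c) + 1)
     - cf_quantile ((real X + c) / (real n + d)) (1 / sqrt (real n + d)) y)" for y
    by (rule central_bigo_mono[OF beta_quantile_central[OF \<delta>]]) simp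
  show ?thesis
    by (rule central_bigo_cong[OF always_eventually
        central_bigo_add[OF central_bigo_diff[OF 1[of z] 1[of "- z"]]
          central_bigo_add[OF cf_width_central[OF \<delta>, of c d z]
            central_bigo_cmult[OF sd_shifted[OF \<delta>, of c d], of "2 * z"]]]])
       (auto simp: interval_length_bayes[OF z] wald_length_def c_def[symmetric] d_def[symmetric] right_diff_distrib)
qed

lemma wald_length_central:
  assumes \<delta>: "0 < \<delta>" and z: "Phi z = 1 - \<alpha> / 2"
  shows "central_bigo \<delta> (3 / 2) (\<lambda>n X. interval_length (wald_interval \<alpha> n X) - wald_length z n X)"
proof -
  have "interval_length (wald_interval \<alpha> n X) - wald_length z n X = 0" for n X
    unfolding interval_length_def wald_interval_def wald_length_def upper_normal_quantile_eqI[OF z] sd_def Let_def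
    by (simp add: real_sqrt_divide)
  then show ?thesis by (intro central_bigoI[where C=0]) simp
qed

lemma agresti_coull_length_central:
  assumes \<delta>: "0 < \<delta>" and z: "Phi z = 1 - \<alpha> / 2"
  shows "central_bigo \<delta> (3 / 2) (\<lambda>n X. interval_length (agresti_coull_interval \<alpha> n X) - wald_length z n X)"
proof -
  have "interval_length (agresti_coull_interval \<alpha> n X)
      = 2 * z * (sd ((real X + z^2 / 2) / (real n + z^2)) / sqrt (real n + z^2))" for n X
    unfolding interval_length_def agresti_coull_interval_def upper_normal_quantile_eqI[OF z] sd_def Let_def
    by (simp add: real_sqrt_divide)
  then show ?thesis
    using central_bigo_cmult[OF sd_shifted[OF \<delta>, of "z^2 / 2" "z^2"], of "2 * z"]
    unfolding wald_length_def by (simp add: right_diff_distrib)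
qed

text \<open>With r = sqrt n and s = \<open>sd (X / n)\<close>, the extra z^2 / 4 under the root
  raises it from r s to t, where t - r s = (z^2 / 4) / (t + r s) = O(1 / r); this is divided by n +
  z^2. Using n + z^2 in place of n changes the quotient by s z^2 / ((n + z^2) r). Both effects are
  O(r^(-3)).\<close>

lemma wilson_length_central:
  assumes \<delta>: "0 < \<delta>" and z: "Phi z = 1 - \<alpha> / 2"
  shows "central_bigo \<delta> (3 / 2) (\<lambda>n X. interval_length (wilson_interval \<alpha> n X) - wald_length z n X)"
proof (rule central_bigoI[where C="2 * \<bar>z\<bar> * (z^2 / (4 * \<delta>) + z^2)"])
  show "\<forall>\<^sub>F n in sequentially. \<forall>X. \<delta> * real n \<le> real X \<longrightarrow> real X \<le> (1 - \<delta>) * real n \<longrightarrow>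
      \<bar>interval_length (wilson_interval \<alpha> n X) - wald_length z n X\<bar>
        \<le> 2 * \<bar>z\<bar> * (z^2 / (4 * \<delta>) + z^2) * real n powr (- (3 / 2))"
    using eventually_ge_at_top[of 1]
  proof eventually_elim
    case (elim n)
    show ?case
    proof (intro allI impI)
      fix X assume X: "\<delta> * real n \<le> real X" "real X \<le> (1 - \<delta>) * real n"
      define x where "x = real X / real n"
      define r where "r = sqrt (real n)"
      define N where "N = real n + z^2"
      define s where "s = sd x"
      define t where "t = sqrt (x * (1 - x) * real n + z^2 / 4)"
      have n: "1 \<le> real n" using elim by simp
      have r: "0 < r" "r^2 = real n" unfolding r_def using n by auto
      have x: "\<delta> \<le> x" "x \<le> 1 - \<delta>" using X n unfolding x_def by (auto simp: field_simps)
      note sb = sd_bounds[OF \<delta> x, folded s_def]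
      have N: "r^2 \<le> N" "0 < N" "N - r^2 = z^2" unfolding N_def r(2) using n by (auto intro: add_pos_nonneg)
      have "0 \<le> x * (1 - x) * real n" using sb n by simp
      then have t: "t^2 = (r * s)^2 + z^2 / 4" "0 \<le> t"
        unfolding t_def power_mult_distrib r(2) sb(4) by auto
      have rs: "0 < r * s" "r * \<delta> \<le> r * s" "0 < r * \<delta>" using r sb \<delta> by auto
      have "(t - r * s) * (t + r * s) = z^2 / 4" using t(1) by algebra
      then have "t - r * s = (z^2 / 4) / (t + r * s)" using t(2) rs by (simp add: field_simps)
      moreover have "(z^2 / 4) / (t + r * s) \<le> (z^2 / 4) / (r * \<delta>)"
        using t(2) rs by (intro divide_left_mono mult_pos_pos[OF _ rs(3)]) auto
      moreover have "(z^2 / 4) / (r * \<delta>) = z^2 / (4 * \<delta>) / r" "0 \<le> (z^2 / 4) / (t + r * s)"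
        using t(2) rs by simp_all
      ultimately have d: "0 \<le> t - r * s" "t - r * s \<le> z^2 / (4 * \<delta>) / r" by linarith+
      have "t / N - s / r = (t - r * s) / N - s * (z^2 / (N * r))"
      proof -
        have "t / N - s / r = (t - r * s) / N - s * ((N - r^2) / (N * r))"
          using N(2) r(1) by (simp add: field_simps power2_eq_square)
        then show ?thesis unfolding N(3) .
      qed
      then have "\<bar>t / N - s / r\<bar> \<le> \<bar>(t - r * s) / N\<bar> + \<bar>s * (z^2 / (N * r))\<bar>" by linarith
      also have "\<dots> \<le> z^2 / (4 * \<delta>) / r / r^2 + 1 * (z^2 / (r^2 * r))"
      proof (rule add_mono)
        have "\<bar>(t - r * s) / N\<bar> = (t - r * s) / N" using d N by simp
        also have "\<dots> \<le> z^2 / (4 * \<delta>) / r / r^2" using d N r(1) \<delta> by (intro frac_le) auto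
        finally show "\<bar>(t - r * s) / N\<bar> \<le> z^2 / (4 * \<delta>) / r / r^2" .
        have "\<bar>s * (z^2 / (N * r))\<bar> = s * (z^2 / (N * r))" using sb N r by (simp add: abs_mult)
        also have "\<dots> \<le> 1 * (z^2 / (r^2 * r))"
          using sb(2,3) N(1,2) r(1) by (intro mult_mono frac_le mult_right_mono) auto
        finally show "\<bar>s * (z^2 / (N * r))\<bar> \<le> 1 * (z^2 / (r^2 * r))" .
      qed
      also have "\<dots> = (z^2 / (4 * \<delta>) + z^2) * (1 / r^3)"
        using r(1) by (simp add: power2_eq_square power3_eq_cube field_simps)
      finally have b: "\<bar>t / N - s / r\<bar> \<le> (z^2 / (4 * \<delta>) + z^2) * (1 / r^3)" .
      have "interval_length (wilson_interval \<alpha> n X) - wald_length z n X = 2 * z * (t / N - s / r)"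
        unfolding interval_length_def wilson_interval_def wald_length_def upper_normal_quantile_eqI[OF z] Let_def
          s_def r_def t_def N_def x_def by (simp add: right_diff_distrib)
      then have "\<bar>interval_length (wilson_interval \<alpha> n X) - wald_length z n X\<bar> = 2 * \<bar>z\<bar> * \<bar>t / N - s / r\<bar>"
        by (simp add: abs_mult)
      also have "\<dots> \<le> 2 * \<bar>z\<bar> * ((z^2 / (4 * \<delta>) + z^2) * (1 / r^3))" using b by (intro mult_left_mono) auto
      finally show "\<bar>interval_length (wilson_interval \<alpha> n X) - wald_length z n X\<bar>
        \<le> 2 * \<bar>z\<bar> * (z^2 / (4 * \<delta>) + z^2) * real n powr (- (3 / 2))"
        using n powr_neg_3_2[of "real n"] unfolding r_def by (simp add: mult.assoc)
    qed
  qed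
qed

text \<open>This is \<open>cf_width_shift\<close> at \<epsilon>^2 = 1 / (n - 1); passing from 1 / (n
  - 1) to 1 / n costs O(n^(-2)). The summands \<open>0\<close> and \<open>- 1\<close> preserve the
  form X + c, n + d in which the quantile expansions are stated.\<close>

lemma cf_shift_central:
  fixes \<delta> z :: real
  assumes \<delta>: "0 < \<delta>"
  shows "central_bigo \<delta> 2 (\<lambda>n X.
     (cf_quantile ((real X + 0) / (real n + (- 1))) (1 / sqrt (real n + (- 1))) z
       - cf_quantile ((real X + (- 1)) / (real n + (- 1))) (1 / sqrt (real n + (- 1))) (- z))
     - (cf_quantile ((real X + (- 1 / 2)) / (real n + (- 1))) (1 / sqrt (real n + (- 1))) z
       - cf_quantile ((real X + (- 1 / 2)) / (real n + (- 1))) (1 / sqrt (real n + (- 1))) (- z))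
     - 1 / real n)"
proof -
  obtain C where C: "0 < C" and w: "\<And>\<mu> \<epsilon>. \<delta> / 2 \<le> \<mu> - \<epsilon>^2 / 2 \<Longrightarrow> \<mu> + \<epsilon>^2 / 2 \<le> 1 - \<delta> / 2 \<Longrightarrow> 0 < \<epsilon> \<Longrightarrow> \<epsilon> \<le> 1 \<Longrightarrow>
    \<bar>(cf_quantile (\<mu> + \<epsilon>^2 / 2) \<epsilon> z - cf_quantile (\<mu> - \<epsilon>^2 / 2) \<epsilon> (- z))
       - (cf_quantile \<mu> \<epsilon> z - cf_quantile \<mu> \<epsilon> (- z)) - \<epsilon>^2\<bar> \<le> C * \<epsilon>^4"
    using cf_width_shift[of "\<delta> / 2" z] \<delta> by (metis half_gt_zero)
  show ?thesis
  proof (rule central_bigoI[where C="4 * C + 2"])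
    show "\<forall>\<^sub>F n in sequentially. \<forall>X. \<delta> * real n \<le> real X \<longrightarrow> real X \<le> (1 - \<delta>) * real n \<longrightarrow>
     \<bar>(cf_quantile ((real X + 0) / (real n + (- 1))) (1 / sqrt (real n + (- 1))) z
       - cf_quantile ((real X + (- 1)) / (real n + (- 1))) (1 / sqrt (real n + (- 1))) (- z))
     - (cf_quantile ((real X + (- 1 / 2)) / (real n + (- 1))) (1 / sqrt (real n + (- 1))) z
       - cf_quantile ((real X + (- 1 / 2)) / (real n + (- 1))) (1 / sqrt (real n + (- 1))) (- z))
     - 1 / real n\<bar> \<le> (4 * C + 2) * real n powr (- 2)"
      using shifted_proportion[OF \<delta>, of "- 1" 0] shifted_proportion[OF \<delta>, of "- 1" "- 1"] eventually_ge_at_top[of 2]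
    proof eventually_elim
      case (elim n)
      show ?case
      proof (intro allI impI)
        fix X assume X: "\<delta> * real n \<le> real X" "real X \<le> (1 - \<delta>) * real n"
        define M where "M = real n + (- 1)"
        define \<mu> where "\<mu> = (real X + (- 1 / 2)) / M"
        define \<epsilon> where "\<epsilon> = 1 / sqrt M"
        have n: "2 \<le> real n" using elim by simp
        have nM: "real n / 2 \<le> M" "1 \<le> M" "M = real n - 1" unfolding M_def using n by auto
        have \<epsilon>: "0 < \<epsilon>" "\<epsilon> \<le> 1" "\<epsilon>^2 = 1 / M" unfolding \<epsilon>_def using nM by (auto simp: power_divide)
        have e4: "\<epsilon>^4 = 1 / M^2" using power_mult[of \<epsilon> 2 2] \<epsilon>(3) by (simp add: power_divide)
        have \<mu>1: "\<mu> + \<epsilon>^2 / 2 = (real X + 0) / M" "\<mu> - \<epsilon>^2 / 2 = (real X + (- 1)) / M"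
          unfolding \<mu>_def \<epsilon>(3) using nM by (auto simp: field_simps)
        have \<mu>: "\<delta> / 2 \<le> \<mu> - \<epsilon>^2 / 2" "\<mu> + \<epsilon>^2 / 2 \<le> 1 - \<delta> / 2"
          unfolding \<mu>1 using elim X unfolding M_def by auto
        have iM: "1 / M^2 \<le> 4 * real n powr (- 2)"
        proof -
          have "1 / M^2 \<le> 1 / (real n / 2)^2" using n nM by (intro divide_left_mono power_mono mult_pos_pos) auto
          also have "\<dots> = 4 * real n powr (- 2)" using n by (simp add: powr_neg_2 power_divide)
          finally show ?thesis .
        qed
        have "\<bar>1 / M - 1 / real n\<bar> \<le> 2 * real n powr (- 2)"
        proof -
          have eq: "1 / M - 1 / real n = 1 / (M * real n)" using nM n by (simp add: field_simps)
          have "1 / (M * real n) \<le> 1 / (real n / 2 * real n)" using n nM by (intro divide_left_mono mult_right_mono mult_pos_pos) auto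
          also have "\<dots> = 2 * real n powr (- 2)" using n by (simp add: powr_neg_2 power2_eq_square)
          finally show ?thesis unfolding eq using nM n by simp
        qed
        moreover have "C * (1 / M^2) \<le> C * (4 * real n powr (- 2))" using iM C by (intro mult_left_mono) auto
        moreover note w[OF \<mu> \<epsilon>(1,2)]
        ultimately show "\<bar>(cf_quantile ((real X + 0) / (real n + (- 1))) (1 / sqrt (real n + (- 1))) z
       - cf_quantile ((real X + (- 1)) / (real n + (- 1))) (1 / sqrt (real n + (- 1))) (- z))
     - (cf_quantile ((real X + (- 1 / 2)) / (real n + (- 1))) (1 / sqrt (real n + (- 1))) z
       - cf_quantile ((real X + (- 1 / 2)) / (real n + (- 1))) (1 / sqrt (real n + (- 1))) (- z))
     - 1 / real n\<bar> \<le> (4 * C + 2) * real n powr (- 2)"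
          unfolding M_def[symmetric] \<mu>1[symmetric] \<mu>_def[symmetric] \<epsilon>_def[symmetric] e4 \<epsilon>(3) distrib_right
          by linarith
      qed
    qed
  qed
qed

text \<open>In \<open>beta_quantile_central\<close> all four quantiles have d = - 1: the upper
  Clopper-Pearson end point with c = 0, the lower one with c = - 1, both Jeffreys end points with c
  = - 1/2. The four expansion errors and the shift estimate then add up.\<close>

lemma clopper_pearson_jeffreys_central:
  assumes \<delta>: "0 < \<delta>" and z: "Phi z = 1 - \<alpha> / 2" and \<alpha>: "0 < \<alpha>" "\<alpha> < 1"
  shows "central_bigo \<delta> 2 (\<lambda>n X. interval_length (clopper_pearson_interval \<alpha> n X)
    - interval_length (jeffreys_interval \<alpha> n X) - 1 / real n)"
proof -
  define D where "D = (\<lambda>c y n X. beta_quantile (Phi y) (real X + c + 1) (real n - real X + (- 1 - c) + 1)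
     - cf_quantile ((real X + c) / (real n + (- 1))) (1 / sqrt (real n + (- 1))) y)"
  have D: "central_bigo \<delta> 2 (D c y)" for c y
    unfolding D_def by (rule beta_quantile_central[OF \<delta>])
  show ?thesis
  proof (rule central_bigo_cong[OF _ central_bigo_add[OF central_bigo_diff[OF central_bigo_diff[OF D[of 0 z] D[of "- 1" "- z"]]
          central_bigo_diff[OF D[of "- 1 / 2" z] D[of "- 1 / 2" "- z"]]] cf_shift_central[OF \<delta>, of z]]])
    show "\<forall>\<^sub>F n in sequentially. \<forall>X. \<delta> * real n \<le> real X \<longrightarrow> real X \<le> (1 - \<delta>) * real n \<longrightarrow>
     D 0 z n X - D (- 1) (- z) n X - (D (- 1 / 2) z n X - D (- 1 / 2) (- z) n X) +
     ((cf_quantile ((real X + 0) / (real n + (- 1))) (1 / sqrt (real n + (- 1))) z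
       - cf_quantile ((real X + (- 1)) / (real n + (- 1))) (1 / sqrt (real n + (- 1))) (- z))
     - (cf_quantile ((real X + (- 1 / 2)) / (real n + (- 1))) (1 / sqrt (real n + (- 1))) z
       - cf_quantile ((real X + (- 1 / 2)) / (real n + (- 1))) (1 / sqrt (real n + (- 1))) (- z))
     - 1 / real n) = interval_length (clopper_pearson_interval \<alpha> n X)
    - interval_length (jeffreys_interval \<alpha> n X) - 1 / real n"
      using shifted_proportion[OF \<delta>, of 0 0]
    proof eventually_elim
      case (elim n)
      show ?case
      proof (intro allI impI)
        fix X assume "\<delta> * real n \<le> real X" "real X \<le> (1 - \<delta>) * real n"
        then have X: "0 < X" "X < n" using elim by auto
        have z': "Phi (- z) = \<alpha> / 2" using Phi_minus[of z] z by simp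
        have cp: "interval_length (clopper_pearson_interval \<alpha> n X)
            = beta_quantile (Phi z) (real X + 0 + 1) (real n - real X + (- 1 - 0) + 1)
            - beta_quantile (Phi (- z)) (real X + (- 1) + 1) (real n - real X + (- 1 - (- 1)) + 1)"
          unfolding interval_length_def clopper_pearson_eq_beta_quantiles[OF X \<alpha>] z z' by simp
        have j: "interval_length (jeffreys_interval \<alpha> n X)
            = beta_quantile (Phi z) (real X + (- 1 / 2) + 1) (real n - real X + (- 1 - (- 1 / 2)) + 1)
            - beta_quantile (Phi (- z)) (real X + (- 1 / 2) + 1) (real n - real X + (- 1 - (- 1 / 2)) + 1)"
        proof -
          have "real X + (- 1 / 2) + 1 = real X + 1 / 2" "real n - real X + (- 1 - (- 1 / 2)) + 1 = real n - real X + 1 / 2"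
            by simp_all
          then show ?thesis unfolding interval_length_def jeffreys_interval_def bayes_interval_def z z' by (simp only: fst_conv snd_conv)
        qed
        show "D 0 z n X - D (- 1) (- z) n X - (D (- 1 / 2) z n X - D (- 1 / 2) (- z) n X) +
     ((cf_quantile ((real X + 0) / (real n + (- 1))) (1 / sqrt (real n + (- 1))) z
       - cf_quantile ((real X + (- 1)) / (real n + (- 1))) (1 / sqrt (real n + (- 1))) (- z))
     - (cf_quantile ((real X + (- 1 / 2)) / (real n + (- 1))) (1 / sqrt (real n + (- 1))) z
       - cf_quantile ((real X + (- 1 / 2)) / (real n + (- 1))) (1 / sqrt (real n + (- 1))) (- z))
     - 1 / real n) = interval_length (clopper_pearson_interval \<alpha> n X)
    - interval_length (jeffreys_interval \<alpha> n X) - 1 / real n"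
          unfolding cp j D_def by linarith
      qed
    qed
  qed
qed

section \<open>From bounds on the central range to expectations\<close>

text \<open>For observations outside the central range a crude uniform bound suffices, since it is
  multiplied by an exponentially small probability.\<close>

definition bounded_length :: "real \<Rightarrow> interval_method \<Rightarrow> bool" where
  "bounded_length \<alpha> I \<longleftrightarrow> (\<exists>K. \<forall>n X. 1 \<le> n \<longrightarrow> X \<le> n \<longrightarrow> \<bar>interval_length (I \<alpha> n X)\<bar> \<le> K)"

lemma bounded_lengthI:
  "(\<And>n X. 1 \<le> n \<Longrightarrow> X \<le> n \<Longrightarrow> \<bar>interval_length (I \<alpha> n X)\<bar> \<le> K) \<Longrightarrow> bounded_length \<alpha> I"
  unfolding bounded_length_def by blast

lemma bounded_length_bayes:
  assumes "0 < \<alpha>" "\<alpha> < 1" "0 < a" "0 < b"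
  shows "bounded_length \<alpha> (bayes_interval a b)"
proof (rule bounded_lengthI[where K=1])
  fix n X :: nat assume "1 \<le> n" "X \<le> n"
  then have "0 < real X + a" "0 < real n - real X + b" using assms by auto
  then show "\<bar>interval_length (bayes_interval a b \<alpha> n X)\<bar> \<le> 1"
    using beta_quantile_bounds[of "real X + a" "real n - real X + b" "\<alpha> / 2"]
      beta_quantile_bounds[of "real X + a" "real n - real X + b" "1 - \<alpha> / 2"] assms(1,2)
    unfolding interval_length_def bayes_interval_def by simp
qed

lemma bounded_length_clopper_pearson:
  assumes \<alpha>: "0 < \<alpha>" "\<alpha> < 1"
  shows "bounded_length \<alpha> clopper_pearson_interval"
proof (rule bounded_lengthI[where K=1])
  fix n X :: nat assume n: "1 \<le> n" "X \<le> n"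
  have p: "0 \<le> (\<alpha> / 2) powr (1 / real n)" "(\<alpha> / 2) powr (1 / real n) \<le> 1"
    using \<alpha> by (auto intro!: powr_le1)
  show "\<bar>interval_length (clopper_pearson_interval \<alpha> n X)\<bar> \<le> 1"
  proof (cases "0 < X \<and> X < n")
    case True
    then show ?thesis
      using beta_quantile_bounds[of "real X" "real n - real X + 1" "\<alpha> / 2"]
        beta_quantile_bounds[of "real X + 1" "real n - real X" "1 - \<alpha> / 2"] \<alpha>
      unfolding interval_length_def by (simp add: clopper_pearson_eq_beta_quantiles)
  next
    case False
    then have "X = 0 \<or> X = n" using n by auto
    then show ?thesis using p n unfolding interval_length_def clopper_pearson_interval_def by auto
  qed
qed

lemma bounded_length_wald:
  "bounded_length \<alpha> wald_interval"
proof (rule bounded_lengthI[where K="2 * \<bar>upper_normal_quantile (\<alpha> / 2)\<bar>"])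
  fix n X :: nat assume n: "1 \<le> n" "X \<le> n"
  define z where "z = upper_normal_quantile (\<alpha> / 2)"
  define x where "x = real X / real n"
  have x: "0 \<le> x" "x \<le> 1" unfolding x_def using n by auto
  have "x * (1 - x) / real n \<le> 1 * 1 / 1" using x n by (intro frac_le mult_mono) auto
  then have "sqrt (x * (1 - x) / real n) \<le> 1" by simp
  moreover have "0 \<le> sqrt (x * (1 - x) / real n)" using x by simp
  ultimately have "\<bar>z\<bar> * \<bar>sqrt (x * (1 - x) / real n)\<bar> \<le> \<bar>z\<bar> * 1" by (intro mult_left_mono) auto
  moreover have "interval_length (wald_interval \<alpha> n X) = 2 * (z * sqrt (x * (1 - x) / real n))"
    unfolding interval_length_def wald_interval_def Let_def z_def x_def by simp
  ultimately show "\<bar>interval_length (wald_interval \<alpha> n X)\<bar> \<le> 2 * \<bar>upper_normal_quantile (\<alpha> / 2)\<bar>"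
    unfolding z_def[symmetric] by (simp add: abs_mult)
qed

lemma bounded_length_agresti_coull:
  "bounded_length \<alpha> agresti_coull_interval"
proof (rule bounded_lengthI[where K="2 * \<bar>upper_normal_quantile (\<alpha> / 2)\<bar>"])
  fix n X :: nat assume n: "1 \<le> n" "X \<le> n"
  define z where "z = upper_normal_quantile (\<alpha> / 2)"
  define N where "N = real n + z^2"
  define x where "x = (real X + z^2 / 2) / N"
  have z2: "0 \<le> z^2" by simp
  have N: "1 \<le> N" unfolding N_def using n z2 by linarith
  have "real X + z^2 / 2 \<le> N" unfolding N_def using n z2 by linarith
  then have x: "0 \<le> x" "x \<le> 1" unfolding x_def using N by auto
  have "x * (1 - x) / N \<le> 1 * 1 / 1" using x N by (intro frac_le mult_mono) auto
  then have "sqrt (x * (1 - x) / N) \<le> 1" by simp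
  moreover have "0 \<le> sqrt (x * (1 - x) / N)" using x N by simp
  ultimately have "\<bar>z\<bar> * \<bar>sqrt (x * (1 - x) / N)\<bar> \<le> \<bar>z\<bar> * 1" by (intro mult_left_mono) auto
  moreover have "interval_length (agresti_coull_interval \<alpha> n X) = 2 * (z * sqrt (x * (1 - x) / N))"
    unfolding interval_length_def agresti_coull_interval_def Let_def z_def x_def N_def by simp
  ultimately show "\<bar>interval_length (agresti_coull_interval \<alpha> n X)\<bar> \<le> 2 * \<bar>upper_normal_quantile (\<alpha> / 2)\<bar>"
    unfolding z_def[symmetric] by (simp add: abs_mult)
qed

lemma bounded_length_wilson:
  "bounded_length \<alpha> wilson_interval"
proof (rule bounded_lengthI[where K="2 * \<bar>upper_normal_quantile (\<alpha> / 2)\<bar>"])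
  fix n X :: nat assume n: "1 \<le> n" "X \<le> n"
  define z where "z = upper_normal_quantile (\<alpha> / 2)"
  define N where "N = real n + z^2"
  define x where "x = real X / real n"
  define t where "t = sqrt (x * (1 - x) * real n + z^2 / 4)"
  have z2: "0 \<le> z^2" by simp
  have N: "1 \<le> N" unfolding N_def using n z2 by linarith
  have x: "0 \<le> x" "x \<le> 1" unfolding x_def using n by auto
  have "x * (1 - x) * real n \<le> 1 * 1 * real n" using x by (intro mult_right_mono mult_mono) auto
  then have "x * (1 - x) * real n + z^2 / 4 \<le> N" unfolding N_def using z2 by linarith
  also have "N \<le> N^2" using N by (simp add: power2_eq_square)
  finally have "t \<le> N" unfolding t_def using N by (intro real_le_lsqrt) auto
  moreover have "0 \<le> t" unfolding t_def using x by simp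
  ultimately have "\<bar>z\<bar> * (t / N) \<le> \<bar>z\<bar> * 1" using N by (intro mult_left_mono) auto
  moreover have "interval_length (wilson_interval \<alpha> n X) = 2 * (z * (t / N))"
    unfolding interval_length_def wilson_interval_def Let_def z_def x_def N_def t_def by simp
  ultimately show "\<bar>interval_length (wilson_interval \<alpha> n X)\<bar> \<le> 2 * \<bar>upper_normal_quantile (\<alpha> / 2)\<bar>"
    unfolding z_def[symmetric] using \<open>0 \<le> t\<close> N by (simp add: abs_mult)
qed

text \<open>Near p the central bound applies pointwise; elsewhere the integrand is bounded. The
  exponential probability of the latter case is estimated by a multiple of n^(-2), which explains
  the condition on \<open>k\<close>.\<close>

lemma expected_length_difference:
  assumes p: "0 < p" "p < 1" and b: "bounded_length \<alpha> I" "bounded_length \<alpha> J" and k: "k \<le> 2"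
    and c: "\<And>\<delta>. 0 < \<delta> \<Longrightarrow> central_bigo \<delta> k (\<lambda>n X. interval_length (I \<alpha> n X) - interval_length (J \<alpha> n X) - 1 / real n)"
  shows "\<exists>C. \<forall>\<^sub>F n in sequentially. \<bar>expected_length I \<alpha> p n - expected_length J \<alpha> p n - 1 / real n\<bar> \<le> C * real n powr (- k)"
proof -
  \<comment> \<open>Half the distance of p from the boundary, so that a proportion within \<delta>
    of p lies between \<delta> and 1 - \<delta>.\<close>
  define \<delta> where "\<delta> = min p (1 - p) / 2"
  have \<delta>: "0 < \<delta>" "\<delta> \<le> p - \<delta>" "p + \<delta> \<le> 1 - \<delta>" unfolding \<delta>_def using p by (auto simp: min_def)
  obtain K1 where K1: "\<And>n X. 1 \<le> n \<Longrightarrow> X \<le> n \<Longrightarrow> \<bar>interval_length (I \<alpha> n X)\<bar> \<le> K1"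
    using b(1) unfolding bounded_length_def by blast
  obtain K2 where K2: "\<And>n X. 1 \<le> n \<Longrightarrow> X \<le> n \<Longrightarrow> \<bar>interval_length (J \<alpha> n X)\<bar> \<le> K2"
    using b(2) unfolding bounded_length_def by blast
  obtain C where C: "\<forall>\<^sub>F n in sequentially. \<forall>X. \<delta> * real n \<le> real X \<and> real X \<le> (1 - \<delta>) * real n \<longrightarrow>
      \<bar>interval_length (I \<alpha> n X) - interval_length (J \<alpha> n X) - 1 / real n\<bar> \<le> C * real n powr (- k)"
    using c[OF \<delta>(1)] unfolding central_bigo_def by blast
  \<comment> \<open>The summand 1 accounts for 1 / n. \<open>E\<close> is the constant of
    \<open>power_exp_bounded\<close> for n^2 against exp (- 2 \<delta>^2 n).\<close>
  define K where "K = \<bar>K1\<bar> + \<bar>K2\<bar> + 1"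
  define E where "E = fact 2 / (2 * \<delta>^2) ^ 2"
  have "\<forall>\<^sub>F n in sequentially. \<bar>expected_length I \<alpha> p n - expected_length J \<alpha> p n - 1 / real n\<bar> \<le> (\<bar>C\<bar> + K * (2 * E)) * real n powr (- k)"
    using C eventually_ge_at_top[of 1]
  proof eventually_elim
    case (elim n)
    have n: "1 \<le> n" "0 < real n" using elim by auto
    let ?P = "binomial_pmf n p"
    define f where "f = (\<lambda>X. interval_length (I \<alpha> n X) - interval_length (J \<alpha> n X) - 1 / real n)"
    define B where "B = {X::nat. \<delta> \<le> \<bar>real X / real n - p\<bar>}"
    \<comment> \<open>A pointwise majorant whose expectation needs only the probability of
      \<open>B\<close>.\<close>
    define g where "g = (\<lambda>X. \<bar>C\<bar> * real n powr (- k) + K * indicator B X)"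
    have fin: "finite (set_pmf ?P)" using p by (simp add: set_pmf_binomial)
    note int = integrable_measure_pmf_finite[OF fin]
    have Xn: "X \<le> n" if "X \<in> set_pmf ?P" for X
      using that p by (simp add: set_pmf_binomial)
    have "expected_length I \<alpha> p n - expected_length J \<alpha> p n - 1 / real n = measure_pmf.expectation ?P f"
      unfolding f_def expected_length_def by (simp add: int)
    moreover have "\<bar>measure_pmf.expectation ?P f\<bar> \<le> measure_pmf.expectation ?P g"
    proof -
      have "\<bar>measure_pmf.expectation ?P f\<bar> \<le> measure_pmf.expectation ?P (\<lambda>X. \<bar>f X\<bar>)"
        by (rule integral_abs_bound)
      also have "\<dots> \<le> measure_pmf.expectation ?P g"
      proof (rule integral_mono_AE[OF int int], rule AE_pmfI)
        fix X assume X: "X \<in> set_pmf ?P"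
        show "\<bar>f X\<bar> \<le> g X"
        proof (cases "X \<in> B")
          case True
          have "1 / real n \<le> 1" using n by simp
          then have "\<bar>f X\<bar> \<le> K" unfolding f_def K_def using K1[OF n(1) Xn[OF X]] K2[OF n(1) Xn[OF X]] n
            by (smt (verit) divide_nonneg_nonneg of_nat_0_le_iff)
          moreover have "0 \<le> \<bar>C\<bar> * real n powr (- k)" by simp
          moreover have "g X = \<bar>C\<bar> * real n powr (- k) + K" unfolding g_def using True by simp
          ultimately show ?thesis by linarith
        next
          case False
          then have "\<bar>real X / real n - p\<bar> < \<delta>" unfolding B_def by simp
          then have "\<delta> \<le> real X / real n" "real X / real n \<le> 1 - \<delta>" using \<delta> by linarith+
          then have "\<delta> * real n \<le> real X" "real X \<le> (1 - \<delta>) * real n" using n by (auto simp: field_simps)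
          then have "\<bar>f X\<bar> \<le> C * real n powr (- k)" unfolding f_def using elim by simp
          also have "\<dots> \<le> \<bar>C\<bar> * real n powr (- k)" by (intro mult_right_mono) auto
          finally show ?thesis unfolding g_def using False by simp
        qed
      qed
      finally show ?thesis .
    qed
    moreover have "measure_pmf.expectation ?P g = \<bar>C\<bar> * real n powr (- k) + K * measure_pmf.prob ?P B"
      unfolding g_def by (simp add: int)
    moreover have "K * measure_pmf.prob ?P B \<le> K * (2 * E) * real n powr (- k)"
    proof -
      interpret binomial_distribution n p by unfold_locales (use p in auto)
      have "measure_pmf.prob ?P B \<le> 2 * exp (- 2 * real n * \<delta>^2)"
        unfolding B_def using prob_abs_ge'[of \<delta>] n \<delta>(1) by simp
      also have "exp (- 2 * real n * \<delta>^2) \<le> E * real n powr (- k)"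
      proof -
        have "real n ^ 2 * exp (- (2 * \<delta>^2 * real n)) \<le> E"
          unfolding E_def using \<delta>(1) by (intro power_exp_bounded) auto
        then have "exp (- (2 * \<delta>^2 * real n)) \<le> E * real n powr (- 2)"
          using n by (simp add: powr_neg_2 field_simps)
        also have "\<dots> \<le> E * real n powr (- k)"
          using n k by (intro mult_left_mono powr_mono) (auto simp: E_def)
        finally show ?thesis by (simp add: mult_ac)
      qed
      finally have "measure_pmf.prob ?P B \<le> 2 * (E * real n powr (- k))" by simp
      then have "K * measure_pmf.prob ?P B \<le> K * (2 * (E * real n powr (- k)))"
        by (intro mult_left_mono) (auto simp: K_def)
      then show ?thesis by (simp add: mult.assoc)
    qed
    ultimately show ?case by (simp only: distrib_right)
  qed
  then show ?thesis by blast
qed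

theorem corollary1:
  fixes p \<alpha> :: real
  assumes "0 < p" and "p < 1" and "0 < \<alpha>" and "\<alpha> < 1"
  shows
    "(\<forall>I \<in> {wald_interval, wilson_interval, agresti_coull_interval, jeffreys_interval}
              \<union> {bayes_interval a b | a b. a > 0 \<and> b > 0}.
        \<forall>\<^sub>F n in sequentially.
          expected_length clopper_pearson_interval \<alpha> p n > expected_length I \<alpha> p n)
     \<and> (\<lambda>n. expected_length clopper_pearson_interval \<alpha> p n
              - (expected_length jeffreys_interval \<alpha> p n + 1 / real n))
         \<in> O[sequentially](\<lambda>n. 1 / (real n)\<^sup>2)
     \<and> (\<forall>I \<in> {wilson_interval, agresti_coull_interval}.
          (\<lambda>n. expected_length clopper_pearson_interval \<alpha> p n
                 - (expected_length I \<alpha> p n + 1 / real n))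
            \<in> O[sequentially](\<lambda>n. real n powr (- 3 / 2)))"
proof -
  obtain z where z: "Phi z = 1 - \<alpha> / 2"
    using ex_Phi_eq[of "1 - \<alpha> / 2"] assms by auto
  define cp where "cp = expected_length clopper_pearson_interval \<alpha> p"
  \<comment> \<open>The two properties through which every competing interval enters: bounded
    length, and agreement with \<open>wald_length\<close> up to n^(-3/2).\<close>
  define near where "near = (\<lambda>I. bounded_length \<alpha> I \<and>
    (\<forall>\<delta>>0. central_bigo \<delta> (3 / 2) (\<lambda>n X. interval_length (I \<alpha> n X) - wald_length z n X)))"
  have bayes: "near (bayes_interval a b)" if "0 < a" "0 < b" for a b
    unfolding near_def using bayes_length_central[OF _ z] bounded_length_bayes[OF assms(3,4) that] by simp
  have jeff: "near jeffreys_interval" unfolding jeffreys_interval_def by (rule bayes) auto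
  have wald: "near wald_interval"
    unfolding near_def using wald_length_central[OF _ z] bounded_length_wald by simp
  have wilson: "near wilson_interval"
    unfolding near_def using wilson_length_central[OF _ z] bounded_length_wilson by simp
  have ac: "near agresti_coull_interval"
    unfolding near_def using agresti_coull_length_central[OF _ z] bounded_length_agresti_coull by simp
  note bcp = bounded_length_clopper_pearson[OF assms(3,4)]
  have diff: "\<exists>C. \<forall>\<^sub>F n in sequentially. \<bar>cp n - expected_length I \<alpha> p n - 1 / real n\<bar> \<le> C * real n powr (- (3 / 2))"
    if I: "near I" for I
    unfolding cp_def
  proof (rule expected_length_difference[OF assms(1,2) bcp])
    show "bounded_length \<alpha> I" using I unfolding near_def by simp
    fix \<delta> :: real assume \<delta>: "0 < \<delta>"
    have 1: "central_bigo \<delta> (3 / 2) (\<lambda>n X. interval_length (I \<alpha> n X) - wald_length z n X)"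
      and 2: "central_bigo \<delta> (3 / 2) (\<lambda>n X. interval_length (jeffreys_interval \<alpha> n X) - wald_length z n X)"
      using I jeff \<delta> unfolding near_def by auto
    have 3: "central_bigo \<delta> (3 / 2) (\<lambda>n X. interval_length (clopper_pearson_interval \<alpha> n X)
      - interval_length (jeffreys_interval \<alpha> n X) - 1 / real n)"
      by (rule central_bigo_mono[OF clopper_pearson_jeffreys_central[OF \<delta> z assms(3,4)]]) simp
    \<comment> \<open>Clopper-Pearson is compared with Jeffreys, and Jeffreys with the given
      interval through their common reference \<open>wald_length\<close>.\<close>
    show "central_bigo \<delta> (3 / 2) (\<lambda>n X. interval_length (clopper_pearson_interval \<alpha> n X)
      - interval_length (I \<alpha> n X) - 1 / real n)"
      by (rule central_bigo_cong[OF _ central_bigo_add[OF 3 central_bigo_diff[OF 2 1]]]) (simp add: algebra_simps)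
  qed simp
  have wider: "\<forall>\<^sub>F n in sequentially. cp n > expected_length I \<alpha> p n" if I: "near I" for I
  proof -
    obtain C where C: "\<forall>\<^sub>F n in sequentially. \<bar>cp n - expected_length I \<alpha> p n - 1 / real n\<bar> \<le> C * real n powr (- (3 / 2))"
      using diff[OF I] by blast
    \<comment> \<open>Once sqrt n exceeds C, the error C n^(-3/2) is smaller than the gain 1 /
      n.\<close>
    have "\<forall>\<^sub>F n in sequentially. (\<bar>C\<bar> + 1)^2 \<le> real n"
      using filterlim_real_sequentially unfolding filterlim_at_top by blast
    with C show ?thesis
    proof eventually_elim
      case (elim n)
      define r where "r = sqrt (real n)"
      have "0 < (\<bar>C\<bar> + 1)^2" by (intro zero_less_power) auto
      then have n: "0 < real n" using elim by linarith
      have r: "0 < r" "r^2 = real n" unfolding r_def using n by auto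
      have "\<bar>C\<bar> + 1 \<le> r" unfolding r_def using elim(2) by (intro real_le_rsqrt)
      then have "C < r" by linarith
      then have "C * (1 / r^3) < r * (1 / r^3)" using r by (intro mult_strict_right_mono) auto
      also have "\<dots> = 1 / real n" unfolding r(2)[symmetric] using r(1) by (simp add: power2_eq_square power3_eq_cube)
      finally have "C * real n powr (- (3 / 2)) < 1 / real n"
        using powr_neg_3_2[OF n] unfolding r_def by simp
      then show ?case using elim(1) by linarith
    qed
  qed
  have 1: "\<forall>I \<in> {wald_interval, wilson_interval, agresti_coull_interval, jeffreys_interval}
              \<union> {bayes_interval a b | a b. a > 0 \<and> b > 0}.
        \<forall>\<^sub>F n in sequentially. cp n > expected_length I \<alpha> p n"
    using wider wald wilson ac jeff bayes by blast
  have 2: "(\<lambda>n. cp n - (expected_length jeffreys_interval \<alpha> p n + 1 / real n)) \<in> O[sequentially](\<lambda>n. 1 / (real n)\<^sup>2)"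
  proof -
    have "bounded_length \<alpha> jeffreys_interval" using jeff unfolding near_def by simp
    from expected_length_difference[OF assms(1,2) bcp this _ clopper_pearson_jeffreys_central[OF _ z assms(3,4)]]
    obtain C where C: "\<forall>\<^sub>F n in sequentially. \<bar>cp n - expected_length jeffreys_interval \<alpha> p n - 1 / real n\<bar> \<le> C * real n powr (- 2)"
      unfolding cp_def by auto
    show ?thesis
    proof (rule bigoI[where c=C])
      show "\<forall>\<^sub>F n in sequentially. norm (cp n - (expected_length jeffreys_interval \<alpha> p n + 1 / real n)) \<le> C * norm (1 / (real n)\<^sup>2)"
        using C eventually_gt_at_top[of 0]
        by eventually_elim (simp add: powr_neg_2 diff_diff_eq)
    qed
  qed
  have 3: "(\<lambda>n. cp n - (expected_length I \<alpha> p n + 1 / real n)) \<in> O[sequentially](\<lambda>n. real n powr (- 3 / 2))"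
    if I: "near I" for I
  proof -
    obtain C where C: "\<forall>\<^sub>F n in sequentially. \<bar>cp n - expected_length I \<alpha> p n - 1 / real n\<bar> \<le> C * real n powr (- (3 / 2))"
      using diff[OF I] by blast
    show ?thesis
    proof (rule bigoI[where c=C])
      show "\<forall>\<^sub>F n in sequentially. norm (cp n - (expected_length I \<alpha> p n + 1 / real n)) \<le> C * norm (real n powr (- 3 / 2))"
        using C by eventually_elim (simp add: diff_diff_eq)
    qed
  qed
  show ?thesis using 1 2 3[OF wilson] 3[OF ac] unfolding cp_def by blast
qed

end
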